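(* Let $f\in\mathbb{C}\{X,Y\}$ be reduced, singular and unitangent. Then the tangent direction of $f$ is a special direction of $f$.
   Context: $\mathbb{C}\{X,Y\}$ is the ring of convergent power series. For a nonzero $f=\sum c_{\alpha\beta}X^\alpha Y^\beta$, $\operatorname{ord} f$ is the minimum of $\alpha+\beta$ with $c_{\alpha\beta}\ne0$, and $\operatorname{in} f$ is the sum of the terms of degree $\operatorname{ord} f$. $f$ is singular if $2\le\operatorname{ord} f<\infty$; reduced if it has no multiple irreducible factors (up to units). $f$ is unitangent if $\operatorname{in} f$ has, up to proportionality, exactly one linear factor; its tangent direction is the unique $(a:b)\in\mathbb{P}^1(\mathbb{C})$ with $(\operatorname{in} f)(a,b)=0$. For $A\subset\mathbb{C}^2$ with $0\in\overline{A\setminus\{0\}}$, $$\mathcal{L}_0(f|A)=\inf\{\theta\ge0:\ \text{there is } c>0 \text{ with } |\operatorname{grad} f(z)|\ge c|z|^\theta \text{ for } z\in A \text{ near } 0\in\mathbb{C}^2\},$$ where $\operatorname{grad} f=(\partial f/\partial X,\partial f/\partial Y)$, and $\mathcal{L}_0(f)=\mathcal{L}_0(f|\mathbb{C}^2)$. A regular parameter is a $\lambda\in\mathbb{C}\{X,Y\}$ with $\operatorname{ord}\lambda=1$. $\Gamma_{f,\lambda}$ is the germ at $0$ of the polar curve $\mathbf{J}(\lambda,f)=\frac{\partial\lambda}{\partial X}\frac{\partial f}{\partial Y}-\frac{\partial\lambda}{\partial Y}\frac{\partial f}{\partial X}=0$. $\lambda$ is a special parameter for $f$ if $\mathcal{L}_0(f|\Gamma_{f,\lambda})\neq\mathcal{L}_0(f)$.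 A direction $\mathbf w=(a:b)\in\mathbb{P}^1(\mathbb{C})$ is a special direction of $f$ if there exists a special parameter $\lambda$ for $f$ tangent to $\mathbf w$, i.e. with $(\operatorname{in}\lambda)(a,b)=0$. *)

theory Defs
  imports
    "HOL-Analysis.Infinite_Sum"
    "HOL-Analysis.Product_Vector"
    "HOL-Computational_Algebra.Formal_Power_Series"
    "HOL-Computational_Algebra.Polynomial"
    "HOL-Computational_Algebra.Factorial_Ring"
    "HOL-Library.Extended_Nat"
    "HOL-Library.Extended_Real"
begin

section \<open>The ring of convergent power series in two variables\<close>

text \<open>
  A formal series in \<open>X\<close>, \<open>Y\<close> is read as a series in \<open>Y\<close> whose coefficients are series
  in \<open>X\<close>: the coefficient of \<open>X\<^sup>i Y\<^sup>j\<close> in \<open>f\<close> is \<open>fps_nth (fps_nth f j) i\<close>.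
\<close>

definition convergent2 :: "complex fps fps \<Rightarrow> bool" where
  "convergent2 f \<longleftrightarrow>
     (\<exists>r>0. (\<lambda>(i, j). fps_nth (fps_nth f j) i * complex_of_real r ^ i * complex_of_real r ^ j)
              abs_summable_on UNIV)"

lemma convergent2_iff_bound:
  "convergent2 f \<longleftrightarrow> (\<exists>C R. C \<ge> 0 \<and> R > 0 \<and> (\<forall>i j. norm (fps_nth (fps_nth f j) i) \<le> C * R ^ (i + j)))"
proof
  assume "convergent2 f"
  then obtain r where r: "r > 0"
    and s: "(\<lambda>(i, j). fps_nth (fps_nth f j) i * complex_of_real r ^ i * complex_of_real r ^ j)
              abs_summable_on UNIV"
    unfolding convergent2_def by blast
  let ?g = "\<lambda>(i, j). norm (fps_nth (fps_nth f j) i) * r ^ (i + j)"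
  have eq: "(\<lambda>p. norm ((\<lambda>(i, j). fps_nth (fps_nth f j) i * complex_of_real r ^ i * complex_of_real r ^ j) p)) = ?g"
    using r by (auto simp: fun_eq_iff norm_mult norm_power power_add)
  have s': "?g summable_on UNIV" using s unfolding eq .
  define S where "S = infsum ?g UNIV"
  have b: "?g p \<le> S" for p
    using finite_sum_le_infsum[OF s', of "{p}"] r unfolding S_def by auto
  have "0 \<le> ?g (0, 0)" using r by simp
  with b[of "(0, 0)"] have "S \<ge> 0" by linarith
  moreover have "norm (fps_nth (fps_nth f j) i) \<le> S * (1 / r) ^ (i + j)" for i j
    using b[of "(i, j)"] r by (simp add: power_divide field_simps)
  ultimately show "\<exists>C R. C \<ge> 0 \<and> R > 0 \<and> (\<forall>i j. norm (fps_nth (fps_nth f j) i) \<le> C * R ^ (i + j))"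
    using r by (intro exI[of _ S] exI[of _ "1 / r"]) auto
next
  assume "\<exists>C R. C \<ge> 0 \<and> R > 0 \<and> (\<forall>i j. norm (fps_nth (fps_nth f j) i) \<le> C * R ^ (i + j))"
  then obtain C R where C: "C \<ge> 0" and R: "R > 0"
    and b: "\<And>i j. norm (fps_nth (fps_nth f j) i) \<le> C * R ^ (i + j)" by blast
  define r where "r = 1 / (2 * R)"
  have r: "r > 0" using R by (simp add: r_def)
  have geo: "(\<lambda>n. (1 / 2 :: real) ^ n) summable_on UNIV"
    by (rule norm_summable_imp_summable_on) (simp add: summable_geometric)
  have "(\<lambda>(i, j). C * (1 / 2 :: real) ^ i * (1 / 2) ^ j) abs_summable_on (UNIV \<times> UNIV)"
    unfolding abs_summable_on_Sigma_iff
  proof (intro conjI ballI)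
    fix i :: nat
    show "(\<lambda>j. case (i, j) of (i, j) \<Rightarrow> C * (1 / 2 :: real) ^ i * (1 / 2) ^ j) abs_summable_on UNIV"
      using summable_on_cmult_right[OF geo, of "C * (1 / 2) ^ i"] C by (simp add: abs_mult power_abs)
  next
    have "infsum (\<lambda>j. norm (case (i, j) of (i, j) \<Rightarrow> C * (1 / 2 :: real) ^ i * (1 / 2) ^ j)) UNIV
        = (C * infsum (\<lambda>j. (1 / 2 :: real) ^ j) UNIV) * (1 / 2) ^ i" for i :: nat
      using infsum_cmult_right[of "C * (1 / 2) ^ i" "\<lambda>j. (1 / 2 :: real) ^ j" UNIV] geo C
      by (simp add: abs_mult power_abs mult_ac)
    moreover have "(\<lambda>i. (C * infsum (\<lambda>j. (1 / 2 :: real) ^ j) UNIV) * (1 / 2) ^ i) abs_summable_on UNIV"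
      using summable_on_cmult_right[OF geo, of "C * infsum (\<lambda>j. (1 / 2 :: real) ^ j) UNIV"]
      by (metis summable_on_iff_abs_summable_on_real)
    ultimately show "(\<lambda>i. infsum (\<lambda>j. norm (case (i, j) of (i, j) \<Rightarrow> C * (1 / 2 :: real) ^ i * (1 / 2) ^ j)) UNIV)
        abs_summable_on UNIV"
      by simp
  qed
  then have geo2: "(\<lambda>(i, j). C * (1 / 2 :: real) ^ i * (1 / 2) ^ j) abs_summable_on UNIV"
    by simp
  have "(\<lambda>(i, j). fps_nth (fps_nth f j) i * complex_of_real r ^ i * complex_of_real r ^ j) abs_summable_on UNIV"
  proof (rule Infinite_Sum.abs_summable_on_comparison_test[OF geo2], clarify)
    fix i j :: nat
    have "norm (fps_nth (fps_nth f j) i) * r ^ (i + j) \<le> C * R ^ (i + j) * r ^ (i + j)"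
      using b r by (intro mult_right_mono) auto
    also have "\<dots> = C * (R * r) ^ (i + j)" by (simp only: power_mult_distrib mult.assoc)
    also have "R * r = 1 / 2" using R by (simp add: r_def)
    finally show "norm (fps_nth (fps_nth f j) i * complex_of_real r ^ i * complex_of_real r ^ j)
        \<le> norm (C * (1 / 2) ^ i * (1 / 2) ^ j)"
      using r C by (simp add: norm_mult norm_power power_add mult_ac abs_mult power_abs)
  qed
  with r show "convergent2 f" unfolding convergent2_def by blast
qed

lemma Suc_le_two_power: "real (Suc n) \<le> 2 ^ n"
  by (induction n) auto

lemma convergent2E:
  assumes "convergent2 f"
  obtains C R where "C \<ge> 0" "R > 0" "\<And>i j. norm (fps_nth (fps_nth f j) i) \<le> C * R ^ (i + j)"
  using assms unfolding convergent2_iff_bound by metis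

lemma convergent2I:
  assumes "C \<ge> 0" "R > 0" "\<And>i j. norm (fps_nth (fps_nth f j) i) \<le> C * R ^ (i + j)"
  shows "convergent2 f"
  using assms unfolding convergent2_iff_bound by metis

lemma convergent2_common:
  assumes "convergent2 f" "convergent2 g"
  obtains C R where "C \<ge> 0" "R > 0"
    "\<And>i j. norm (fps_nth (fps_nth f j) i) \<le> C * R ^ (i + j)"
    "\<And>i j. norm (fps_nth (fps_nth g j) i) \<le> C * R ^ (i + j)"
proof -
  from assms(1) obtain C R where 1: "C \<ge> 0" "R > 0" "\<And>i j. norm (fps_nth (fps_nth f j) i) \<le> C * R ^ (i + j)"
    by (rule convergent2E) blast
  from assms(2) obtain D S where 2: "D \<ge> 0" "S > 0" "\<And>i j. norm (fps_nth (fps_nth g j) i) \<le> D * S ^ (i + j)"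
    by (rule convergent2E) blast
  have "C * R ^ n \<le> max C D * max R S ^ n" for n
    using 1 2 by (intro mult_mono power_mono) auto
  moreover have "D * S ^ n \<le> max C D * max R S ^ n" for n
    using 1 2 by (intro mult_mono power_mono) auto
  ultimately show thesis
    using 1(1,2) 2(1,2) order_trans[OF 1(3)] order_trans[OF 2(3)]
    by (intro that[of "max C D" "max R S"]) auto
qed

lemma convergent2_0: "convergent2 0"
  by (rule convergent2I[of 0 1]) auto

lemma convergent2_1: "convergent2 1"
  by (rule convergent2I[of 1 1]) auto

lemma convergent2_uminus: "convergent2 f \<Longrightarrow> convergent2 (- f)"
  unfolding convergent2_iff_bound by simp

lemma convergent2_add:
  assumes "convergent2 f" "convergent2 g" shows "convergent2 (f + g)"
proof -
  from assms obtain C R where *: "C \<ge> 0" "R > 0"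
    "\<And>i j. norm (fps_nth (fps_nth f j) i) \<le> C * R ^ (i + j)"
    "\<And>i j. norm (fps_nth (fps_nth g j) i) \<le> C * R ^ (i + j)"
    by (rule convergent2_common) blast
  show ?thesis
  proof (rule convergent2I[of "2 * C" R])
    fix i j
    show "norm (fps_nth (fps_nth (f + g) j) i) \<le> 2 * C * R ^ (i + j)"
      using norm_triangle_mono[OF *(3)[of j i] *(4)[of j i]] by simp
  qed (use * in auto)
qed

lemma convergent2_diff:
  assumes "convergent2 f" "convergent2 g" shows "convergent2 (f - g)"
  using convergent2_add[OF assms(1) convergent2_uminus[OF assms(2)]] by simp

lemma convergent2_mult:
  assumes "convergent2 f" "convergent2 g" shows "convergent2 (f * g)"
proof -
  from assms obtain C R where *: "C \<ge> 0" "R > 0"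
    "\<And>i j. norm (fps_nth (fps_nth f j) i) \<le> C * R ^ (i + j)"
    "\<And>i j. norm (fps_nth (fps_nth g j) i) \<le> C * R ^ (i + j)"
    by (rule convergent2_common) blast
  show ?thesis
  proof (rule convergent2I[of "C * C" "2 * R"])
    fix i j
    have "norm (fps_nth (fps_nth (f * g) j) i)
        = norm (\<Sum>k=0..j. \<Sum>l=0..i. fps_nth (fps_nth f k) l * fps_nth (fps_nth g (j - k)) (i - l))"
      by (simp add: fps_mult_nth fps_sum_nth)
    also have "\<dots> \<le> (\<Sum>k=0..j. \<Sum>l=0..i. C * C * R ^ (i + j))"
    proof (intro sum_norm_le)
      fix k l assume k: "k \<in> {0..j}" and l: "l \<in> {0..i}"
      have "norm (fps_nth (fps_nth f k) l * fps_nth (fps_nth g (j - k)) (i - l))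
          \<le> (C * R ^ (l + k)) * (C * R ^ ((i - l) + (j - k)))"
        unfolding norm_mult using * by (intro mult_mono) auto
      also have "\<dots> = C * C * R ^ ((l + k) + ((i - l) + (j - k)))"
        by (simp only: power_add mult_ac)
      also have "(l + k) + ((i - l) + (j - k)) = i + j" using k l by auto
      finally show "norm (fps_nth (fps_nth f k) l * fps_nth (fps_nth g (j - k)) (i - l))
          \<le> C * C * R ^ (i + j)" .
    qed
    also have "\<dots> = (C * C * R ^ (i + j)) * (real (Suc i) * real (Suc j))"
      by (simp add: mult_ac)
    also have "\<dots> \<le> (C * C * R ^ (i + j)) * (2 ^ i * 2 ^ j)"
      using * by (intro mult_left_mono mult_mono Suc_le_two_power) auto
    also have "\<dots> = C * C * (2 * R) ^ (i + j)"
      by (simp only: power_mult_distrib power_add mult_ac)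
    finally show "norm (fps_nth (fps_nth (f * g) j) i) \<le> C * C * (2 * R) ^ (i + j)" .
  qed (use * in auto)
qed

lemma convergent2_deriv_aux:
  assumes "C \<ge> 0" "R > 0" "x \<le> C * R ^ Suc n" "m \<le> n"
  shows "real (Suc m) * x \<le> (C * R) * (2 * R) ^ n"
proof -
  have "real (Suc m) * x \<le> real (Suc m) * (C * R ^ Suc n)"
    using assms by (intro mult_left_mono) auto
  also have "\<dots> \<le> 2 ^ n * (C * R ^ Suc n)"
    using assms order_trans[OF Suc_le_two_power[of m], of "2 ^ n"]
    by (intro mult_right_mono) auto
  also have "\<dots> = (C * R) * (2 * R) ^ n" by (simp add: power_mult_distrib mult_ac)
  finally show ?thesis .
qed

lemma convergent2_deriv_X:
  assumes "convergent2 f" shows "convergent2 (Abs_fps (\<lambda>j. fps_deriv (fps_nth f j)))"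
proof -
  from assms obtain C R where *: "C \<ge> 0" "R > 0"
    "\<And>i j. norm (fps_nth (fps_nth f j) i) \<le> C * R ^ (i + j)" by (rule convergent2E) blast
  show ?thesis
  proof (rule convergent2I[of "C * R" "2 * R"])
    fix i j
    show "norm (fps_nth (fps_nth (Abs_fps (\<lambda>j. fps_deriv (fps_nth f j))) j) i) \<le> C * R * (2 * R) ^ (i + j)"
      using convergent2_deriv_aux[OF *(1,2), of "norm (fps_nth (fps_nth f j) (Suc i))" "i + j" i]
        *(3)[of j "Suc i"]
      by (simp add: norm_mult del: of_nat_Suc)
  qed (use * in auto)
qed

lemma convergent2_deriv_Y:
  assumes "convergent2 f" shows "convergent2 (fps_deriv f)"
proof -
  from assms obtain C R where *: "C \<ge> 0" "R > 0"
    "\<And>i j. norm (fps_nth (fps_nth f j) i) \<le> C * R ^ (i + j)" by (rule convergent2E) blast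
  show ?thesis
  proof (rule convergent2I[of "C * R" "2 * R"])
    fix i j
    show "norm (fps_nth (fps_nth (fps_deriv f) j) i) \<le> C * R * (2 * R) ^ (i + j)"
      using convergent2_deriv_aux[OF *(1,2), of "norm (fps_nth (fps_nth f (Suc j)) i)" "i + j" j]
        *(3)[of "Suc j" i]
      by (simp add: norm_mult del: of_nat_Suc)
  qed (use * in auto)
qed

typedef cps2 = "{f :: complex fps fps. convergent2 f}"
  morphisms fps_of_cps2 Abs_cps2
  using convergent2_0 by blast

setup_lifting type_definition_cps2

instantiation cps2 :: idom
begin

lift_definition zero_cps2 :: cps2 is 0 by (rule convergent2_0)
lift_definition one_cps2 :: cps2 is 1 by (rule convergent2_1)
lift_definition plus_cps2 :: "cps2 \<Rightarrow> cps2 \<Rightarrow> cps2" is "(+)" by (rule convergent2_add)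
lift_definition minus_cps2 :: "cps2 \<Rightarrow> cps2 \<Rightarrow> cps2" is "(-)" by (rule convergent2_diff)
lift_definition uminus_cps2 :: "cps2 \<Rightarrow> cps2" is uminus by (rule convergent2_uminus)
lift_definition times_cps2 :: "cps2 \<Rightarrow> cps2 \<Rightarrow> cps2" is "(*)" by (rule convergent2_mult)

instance
  by standard (transfer; simp add: algebra_simps)+

end

lift_definition coeff2 :: "cps2 \<Rightarrow> nat \<Rightarrow> nat \<Rightarrow> complex" is
  "\<lambda>f i j. fps_nth (fps_nth f j) i" .

lift_definition deriv_X :: "cps2 \<Rightarrow> cps2" is "\<lambda>f. Abs_fps (\<lambda>j. fps_deriv (fps_nth f j))"
  by (rule convergent2_deriv_X)

lift_definition deriv_Y :: "cps2 \<Rightarrow> cps2" is fps_deriv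
  by (rule convergent2_deriv_Y)

text \<open>
  The sum of the series, meaningful near the origin. (Where the series does not converge
  absolutely, \<^const>\<open>infsum\<close> is \<open>0\<close>; all uses below only depend on the germ at \<open>0\<close>.)
\<close>

definition eval2 :: "cps2 \<Rightarrow> complex \<times> complex \<Rightarrow> complex" where
  "eval2 f z = (\<Sum>\<^sub>\<infinity>(i, j)\<in>UNIV. coeff2 f i j * fst z ^ i * snd z ^ j)"


section \<open>Order and initial form\<close>

text \<open>The order of \<open>0\<close> is \<open>\<infinity>\<close>, the infimum of the empty set.\<close>

definition ord2 :: "cps2 \<Rightarrow> enat" where
  "ord2 f = Inf {enat (i + j) | i j. coeff2 f i j \<noteq> 0}"

definition singular2 :: "cps2 \<Rightarrow> bool" where
  "singular2 f \<longleftrightarrow> 2 \<le> ord2 f \<and> ord2 f < \<infinity>"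

definition reduced2 :: "cps2 \<Rightarrow> bool" where
  "reduced2 f \<longleftrightarrow> (\<forall>p. irreducible p \<longrightarrow> \<not> p ^ 2 dvd f)"

text \<open>
  Polynomials in \<open>X\<close>, \<open>Y\<close> are elements of \<open>\<complex>[X][Y]\<close>; the inner variable is \<open>X\<close>, so
  \<open>monom (monom c i) j\<close> is \<open>c X\<^sup>i Y\<^sup>j\<close>.
\<close>

definition poly2 :: "complex poly poly \<Rightarrow> complex \<Rightarrow> complex \<Rightarrow> complex" where
  "poly2 p a b = poly (poly p [:b:]) a"

definition initial_form :: "cps2 \<Rightarrow> complex poly poly" where
  "initial_form f =
     (let d = the_enat (ord2 f) in \<Sum>i\<le>d. monom (monom (coeff2 f i (d - i)) i) (d - i))"

text \<open>The form \<open>a X + b Y\<close>.\<close>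

definition linear_form :: "complex \<Rightarrow> complex \<Rightarrow> complex poly poly" where
  "linear_form a b = [:[:0, a:], [:b:]:]"

definition linear_factor :: "complex poly poly \<Rightarrow> complex poly poly \<Rightarrow> bool" where
  "linear_factor l p \<longleftrightarrow> (\<exists>a b. (a, b) \<noteq> (0, 0) \<and> l = linear_form a b) \<and> l dvd p"

definition unitangent :: "cps2 \<Rightarrow> bool" where
  "unitangent f \<longleftrightarrow>
     (\<exists>l. linear_factor l (initial_form f) \<and>
          (\<forall>l'. linear_factor l' (initial_form f) \<longrightarrow> (\<exists>c. l' = smult [:c:] l)))"


section \<open>The projective line and directions\<close>

definition proportional :: "complex \<times> complex \<Rightarrow> complex \<times> complex \<Rightarrow> bool" where
  "proportional v w \<longleftrightarrow> v \<noteq> (0, 0) \<and> w \<noteq> (0, 0) \<and> (\<exists>c. v = (c * fst w, c * snd w))"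

lemma part_equivp_proportional: "part_equivp proportional"
proof (rule part_equivpI)
  show "\<exists>x. proportional x x"
    by (rule exI[of _ "(1, 1)"]) (auto simp: proportional_def intro: exI[of _ 1])
  show "symp proportional"
  proof (rule sympI)
    fix v w assume "proportional v w"
    then obtain c where nz: "v \<noteq> (0, 0)" "w \<noteq> (0, 0)" and v: "v = (c * fst w, c * snd w)"
      unfolding proportional_def by blast
    with nz have "c \<noteq> 0" by auto
    with v have "w = (inverse c * fst v, inverse c * snd v)" by (cases w) (simp add: field_simps)
    with nz show "proportional w v" unfolding proportional_def by blast
  qed
  show "transp proportional"
  proof (rule transpI)
    fix u v w assume "proportional u v" "proportional v w"
    then obtain c d where "u \<noteq> (0, 0)" "w \<noteq> (0, 0)"
      "u = (c * fst v, c * snd v)" "v = (d * fst w, d * snd w)"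
      unfolding proportional_def by blast
    then show "proportional u w" unfolding proportional_def
      by (intro conjI exI[of _ "c * d"]) (auto simp: mult_ac)
  qed
qed

quotient_type proj_line = "complex \<times> complex" / partial: proportional
  by (rule part_equivp_proportional)

lemma poly2_initial_form:
  "poly2 (initial_form f) a b =
     (\<Sum>i\<le>the_enat (ord2 f). coeff2 f i (the_enat (ord2 f) - i) * a ^ i * b ^ (the_enat (ord2 f) - i))"
  by (simp add: poly2_def initial_form_def Let_def poly_sum poly_monom poly_power poly_const_pow mult_ac)

lemma poly2_initial_form_scale:
  "poly2 (initial_form f) (c * a) (c * b) = c ^ the_enat (ord2 f) * poly2 (initial_form f) a b"
proof -
  define d where "d = the_enat (ord2 f)"
  have "coeff2 f i (d - i) * (c * a) ^ i * (c * b) ^ (d - i)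
      = c ^ d * (coeff2 f i (d - i) * a ^ i * b ^ (d - i))" if "i \<le> d" for i
  proof -
    have "c ^ d = c ^ i * c ^ (d - i)" using that by (simp flip: power_add)
    then show ?thesis by (simp add: power_mult_distrib mult_ac)
  qed
  then show ?thesis
    unfolding poly2_initial_form d_def[symmetric] sum_distrib_left by (intro sum.cong) auto
qed

text \<open>\<open>initial_form_vanishes_at f (a : b)\<close> is \<open>(in f)(a, b) = 0\<close>.\<close>

lift_definition initial_form_vanishes_at :: "cps2 \<Rightarrow> proj_line \<Rightarrow> bool" is
  "\<lambda>f (a, b). poly2 (initial_form f) a b = 0"
  by (auto simp: proportional_def poly2_initial_form_scale)

definition tangent_direction :: "cps2 \<Rightarrow> proj_line" where
  "tangent_direction f = (THE w. initial_form_vanishes_at f w)"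

lemma linear_form_dvd_initial_form_iff:
  assumes "(a, b) \<noteq> (0, 0)"
  shows "linear_form b (- a) dvd initial_form f \<longleftrightarrow> poly2 (initial_form f) a b = 0"
proof
  assume "linear_form b (- a) dvd initial_form f"
  then obtain q where "initial_form f = linear_form b (- a) * q" by (rule dvdE)
  then show "poly2 (initial_form f) a b = 0"
    by (simp add: poly2_def linear_form_def)
next
  assume z: "poly2 (initial_form f) a b = 0"
  define d where "d = the_enat (ord2 f)"
  define c where "c i = coeff2 f i (d - i)" for i
  have P: "initial_form f = (\<Sum>i\<le>d. monom (monom (c i) i) (d - i))"
    by (simp add: initial_form_def Let_def d_def c_def)
  show "linear_form b (- a) dvd initial_form f"
  proof (cases "a = 0")
    case True
    with assms have b: "b \<noteq> 0" by simp
    have "(\<Sum>i\<le>d. c i * a ^ i * b ^ (d - i)) = 0"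
      using z unfolding poly2_initial_form d_def c_def .
    moreover have "(\<Sum>i\<le>d. c i * a ^ i * b ^ (d - i)) = (\<Sum>i\<le>d. if i = 0 then c 0 * b ^ d else 0)"
      using True by (intro sum.cong) auto
    ultimately have c0: "c 0 = 0" using b by (simp add: sum.delta)
    have "linear_form b (- a) dvd monom (monom (c i) i) (d - i)" if "i \<le> d" for i
    proof (cases i)
      case 0
      then show ?thesis using c0 by simp
    next
      case (Suc k)
      have "monom (monom (c i) i) (d - i) = linear_form b (- a) * monom (monom (c i / b) k) (d - i)"
        using True b Suc by (simp add: linear_form_def smult_monom monom_Suc mult_monom)
      then show ?thesis by simp
    qed
    then show ?thesis unfolding P by (intro dvd_sum) auto
  next
    case False
    define t where "t = b / a"
    have b: "b = a * t" using False by (simp add: t_def)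
    have "poly2 (initial_form f) (a * 1) (a * t) = 0" using z b by simp
    then have "poly2 (initial_form f) 1 t = 0"
      using False unfolding poly2_initial_form_scale by simp
    then have s: "(\<Sum>i\<le>d. c i * t ^ (d - i)) = 0"
      unfolding poly2_initial_form d_def c_def by simp
    have mt: "[:0, t:] = monom t 1" by (simp add: monom_Suc monom_0)
    have "poly (initial_form f) [:0, t:] = (\<Sum>i\<le>d. monom (c i * t ^ (d - i)) d)"
      unfolding P mt poly_sum
      by (intro sum.cong) (auto simp: poly_monom monom_power mult_monom)
    also have "\<dots> = monom (\<Sum>i\<le>d. c i * t ^ (d - i)) d"
      by (rule poly_eqI) (simp add: coeff_sum)
    finally have "poly (initial_form f) [:0, t:] = 0" using s by simp
    then have "[:- [:0, t:], 1:] dvd initial_form f"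
      by (simp only: poly_eq_0_iff_dvd)
    then obtain q where q: "initial_form f = [:- [:0, t:], 1:] * q" by (rule dvdE)
    have "[:- [:0, t:], 1:] = linear_form b (- a) * [:[:- inverse a:]:]"
      using False by (simp add: linear_form_def t_def field_simps)
    with q have "initial_form f = linear_form b (- a) * ([:[:- inverse a:]:] * q)"
      by (simp only: mult.assoc)
    then show ?thesis by (rule dvdI)
  qed
qed

lemma ex1_tangent_direction:
  assumes "unitangent f"
  shows "\<exists>!w. initial_form_vanishes_at f w"
proof -
  from assms obtain a b where nz: "(a, b) \<noteq> (0, 0)" and
    dv: "linear_form a b dvd initial_form f" and
    un: "\<And>l'. linear_factor l' (initial_form f) \<Longrightarrow> \<exists>c. l' = smult [:c:] (linear_form a b)"
    unfolding unitangent_def linear_factor_def by blast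
  show ?thesis
  proof (rule ex1I)
    have nz': "(- b, a) \<noteq> (0, 0)" using nz by auto
    then have pr: "proportional (- b, a) (- b, a)"
      by (auto simp: proportional_def intro: exI[of _ 1])
    have "poly2 (initial_form f) (- b) a = 0"
      using linear_form_dvd_initial_form_iff[OF nz'] dv by simp
    then show "initial_form_vanishes_at f (abs_proj_line (- b, a))"
      by (simp add: initial_form_vanishes_at.abs_eq[OF pr])
    fix w assume w: "initial_form_vanishes_at f w"
    obtain p q where pq: "w = abs_proj_line (p, q)" "proportional (p, q) (p, q)"
      by (metis Quotient_proj_line Quotient_abs_rep Quotient_rep_reflp surj_pair)
    then have nzp: "(p, q) \<noteq> (0, 0)" by (simp add: proportional_def)
    have "poly2 (initial_form f) p q = 0"
      using w pq by (simp add: initial_form_vanishes_at.abs_eq)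
    then have "linear_form q (- p) dvd initial_form f"
      using linear_form_dvd_initial_form_iff[OF nzp] by simp
    moreover have "(q, - p) \<noteq> (0, 0)" using nzp by auto
    ultimately obtain c where "linear_form q (- p) = smult [:c:] (linear_form a b)"
      using un unfolding linear_factor_def by blast
    then have "q = c * a" "p = c * (- b)"
      by (auto simp: linear_form_def mult_ac minus_equation_iff[of p] split: if_splits)
    then have "proportional (p, q) (- b, a)"
      using nzp nz' by (auto simp: proportional_def)
    then show "w = abs_proj_line (- b, a)"
      unfolding pq(1) using Quotient_rel_abs[OF Quotient_proj_line] by blast
  qed
qed


section \<open>Lojasiewicz exponents and special directions\<close>

definition grad2 :: "cps2 \<Rightarrow> complex \<times> complex \<Rightarrow> complex \<times> complex" where
  "grad2 f z = (eval2 (deriv_X f) z, eval2 (deriv_Y f) z)"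

text \<open>
  The infimum is taken in the extended reals, so that it is \<open>\<infinity>\<close> if no exponent works.
  Since \<open>0 powr \<theta> = 0\<close>, the inequality is void at \<open>z = 0\<close>.
\<close>

definition lojasiewicz_on :: "cps2 \<Rightarrow> (complex \<times> complex) set \<Rightarrow> ereal" where
  "lojasiewicz_on f A =
     Inf {ereal \<theta> | \<theta>. \<theta> \<ge> 0 \<and>
            (\<exists>c>0. \<forall>\<^sub>F z in nhds 0. z \<in> A \<longrightarrow> norm (grad2 f z) \<ge> c * norm z powr \<theta>)}"

definition lojasiewicz :: "cps2 \<Rightarrow> ereal" where
  "lojasiewicz f = lojasiewicz_on f UNIV"

definition jacobian2 :: "cps2 \<Rightarrow> cps2 \<Rightarrow> cps2" where
  "jacobian2 g f = deriv_X g * deriv_Y f - deriv_Y g * deriv_X f"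

definition polar_curve :: "cps2 \<Rightarrow> cps2 \<Rightarrow> (complex \<times> complex) set" where
  "polar_curve f g = {z. eval2 (jacobian2 g f) z = 0}"

definition regular_parameter :: "cps2 \<Rightarrow> bool" where
  "regular_parameter g \<longleftrightarrow> ord2 g = 1"

definition special_parameter :: "cps2 \<Rightarrow> cps2 \<Rightarrow> bool" where
  "special_parameter f g \<longleftrightarrow>
     regular_parameter g \<and> lojasiewicz_on f (polar_curve f g) \<noteq> lojasiewicz f"

definition special_direction :: "cps2 \<Rightarrow> proj_line \<Rightarrow> bool" where
  "special_direction f w \<longleftrightarrow> (\<exists>g. special_parameter f g \<and> initial_form_vanishes_at g w)"

end

theory Submission
  imports Defs "HOL-Complex_Analysis.Complex_Analysis" "HOL-Library.Landau_Symbols"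
    "HOL-Computational_Algebra.Fundamental_Theorem_Algebra"
begin

text \<open>
  After a linear change of coordinates, \<open>in f = c Y\<^sup>n\<close>; all roots of \<open>f\<close> and \<open>f\<^sub>Y\<close> are then Puiseux series of order
  greater than 1 in \<open>X\<close>. For \<open>\<lambda> = Y + c X Y\<close> the polar curve is \<open>(1 + c X) f\<^sub>X = c Y f\<^sub>Y\<close>, so on a
  branch \<open>\<gamma>\<close> of it the gradient has the size of \<open>f\<^sub>Y\<close>, whereas on the curves \<open>\<delta>\<close> of \<open>f\<^sub>Y = 0\<close> it has the size of
  \<open>f\<^sub>X\<close>. If \<open>\<gamma>\<close> is not tangent to \<open>Y = 0\<close>, the gradient has order \<open>n - 1\<close> on \<open>\<gamma>\<close>, but at least \<open>n\<close> on every \<open>\<delta>\<close>.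
  Otherwise \<open>Y\<close> has order greater than 1 on \<open>\<gamma>\<close>, and differentiating \<open>f\<close> along \<open>\<gamma>\<close> gives
  \<open>ord f(\<gamma>) \<ge> ord f\<^sub>Y(\<gamma>) + ord Y > ord f\<^sub>Y(\<gamma>) + 1\<close>, whereas \<open>ord f(\<delta>) = ord f\<^sub>X(\<delta>) + 1\<close>. So it suffices to find a \<open>\<delta>\<close>
  with \<open>ord f(\<delta>) > ord f\<^sub>Y(\<gamma>) + 1\<close>: by a Rolle theorem there is a \<open>\<delta>\<close> as close to \<open>\<gamma>\<close> as the second closest root
  of \<open>f\<close>. Reducedness ensures that \<open>f\<^sub>Y\<close> does not vanish on \<open>\<gamma>\<close>.
\<close>

section \<open>Convergent power series in one variable\<close>

text \<open>Closeness of \<delta> to the second closest root y_k pays off as follows. Let y_l be the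
  root closest to \<gamma>, and P the product of all \<gamma> - y_i with i \<noteq> l. In f = unit *
  \<Prod>(Y - y_i), passing from \<gamma> to \<delta> enlarges the factors with i \<noteq> l at most
  by a constant, and the factor of y_l becomes at most of the size of \<gamma> - y_k; so f(\<delta>)
  = O((\<gamma> - y_k) P). If y_k is as close as y_l, this is the size of f(\<gamma>), which the
  derivative along \<gamma> controls. If y_l is strictly closer, P is bounded by f_Y(\<gamma>), and
  \<gamma> - y_k has order greater than 1 in X because \<gamma> and y_k do. All series are written
  in one t with X = t^m, so a strict inequality of orders is a gain of a full factor t. There are
  finitely many polar branches; hence the exponents on them stay below every global exponent by at
  least 1/m, and passing to infima keeps the inequality strict.\<close>

lemma fps_conv_radius_pos_iff_bound:
  fixes a :: "complex fps"
  shows "fps_conv_radius a > 0 \<longleftrightarrow> (\<exists>C R. C \<ge> 0 \<and> R > 0 \<and> (\<forall>k. norm (fps_nth a k) \<le> C * R ^ k))"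
proof
  assume "fps_conv_radius a > 0"
  then obtain r :: real where r: "0 < ereal r" "ereal r < fps_conv_radius a"
    using ereal_dense2 by blast
  then have "summable (\<lambda>n. fps_nth a n * of_real r ^ n)"
    by (intro summable_fps) auto
  then have "bounded (range (\<lambda>n. fps_nth a n * of_real r ^ n))"
    using summable_LIMSEQ_zero convergent_imp_bounded by blast
  then obtain C where C: "\<And>n. norm (fps_nth a n * of_real r ^ n) \<le> C"
    by (auto simp: bounded_iff)
  have "0 \<le> C" using C[of 0] norm_ge_zero order_trans by blast
  moreover have "norm (fps_nth a k) \<le> C * (1 / r) ^ k" for k
    using C[of k] r by (simp add: norm_mult norm_power power_divide field_simps)
  ultimately show "\<exists>C R. C \<ge> 0 \<and> R > 0 \<and> (\<forall>k. norm (fps_nth a k) \<le> C * R ^ k)"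
    using r by (intro exI[of _ C] exI[of _ "1/r"]) auto
next
  assume "\<exists>C R. C \<ge> 0 \<and> R > 0 \<and> (\<forall>k. norm (fps_nth a k) \<le> C * R ^ k)"
  then obtain C R where CR: "C \<ge> 0" "R > 0" "\<And>k. norm (fps_nth a k) \<le> C * R ^ k" by blast
  have "summable (\<lambda>n. fps_nth a n * of_real (1 / (2 * R)) ^ n)"
  proof (rule summable_comparison_test)
    show "\<exists>N. \<forall>n\<ge>N. norm (fps_nth a n * of_real (1 / (2 * R)) ^ n) \<le> C * (1/2) ^ n"
    proof (intro exI allI impI)
      fix n :: nat
      have "norm (fps_nth a n * of_real (1 / (2 * R)) ^ n) \<le> C * R ^ n * (1 / (2 * R)) ^ n"
        unfolding norm_mult norm_power using CR by (intro mult_mono power_mono) (auto simp: norm_divide norm_mult)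
      also have "\<dots> = C * (1/2) ^ n" using CR(2) by (simp add: power_divide power_mult_distrib)
      finally show "norm (fps_nth a n * of_real (1 / (2 * R)) ^ n) \<le> C * (1/2) ^ n" .
    qed
  qed (intro summable_mult summable_geometric, simp)
  then have "conv_radius (fps_nth a) \<ge> norm (of_real (1 / (2 * R)) :: complex)"
    by (rule conv_radius_geI)
  moreover have "ereal (norm (of_real (1 / (2 * R)) :: complex)) > 0" using CR(2) by simp
  ultimately show "fps_conv_radius a > 0" unfolding fps_conv_radius_def by (rule order.strict_trans2[rotated])
qed

typedef cps1 = "{a :: complex fps. fps_conv_radius a > 0}"
  morphisms fps_of_cps1 Abs_cps1
  by (rule exI[of _ 0]) simp

setup_lifting type_definition_cps1

lemma fps_conv_radius_pos_add:
  fixes a b :: "complex fps"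
  shows "fps_conv_radius a > 0 \<Longrightarrow> fps_conv_radius b > 0 \<Longrightarrow> fps_conv_radius (a + b) > 0"
  using fps_conv_radius_add[of a b] by (meson min_less_iff_conj order.strict_trans2)

lemma fps_conv_radius_pos_mult:
  fixes a b :: "complex fps"
  shows "fps_conv_radius a > 0 \<Longrightarrow> fps_conv_radius b > 0 \<Longrightarrow> fps_conv_radius (a * b) > 0"
  using fps_conv_radius_mult[of a b] by (meson min_less_iff_conj order.strict_trans2)

lemma fps_conv_radius_pos_diff:
  fixes a b :: "complex fps"
  shows "fps_conv_radius a > 0 \<Longrightarrow> fps_conv_radius b > 0 \<Longrightarrow> fps_conv_radius (a - b) > 0"
  using fps_conv_radius_diff[of a b] by (meson min_less_iff_conj order.strict_trans2)

instantiation cps1 :: idom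
begin

lift_definition zero_cps1 :: cps1 is 0 by simp
lift_definition one_cps1 :: cps1 is 1 by simp
lift_definition plus_cps1 :: "cps1 \<Rightarrow> cps1 \<Rightarrow> cps1" is "(+)" by (rule fps_conv_radius_pos_add)
lift_definition minus_cps1 :: "cps1 \<Rightarrow> cps1 \<Rightarrow> cps1" is "(-)" by (rule fps_conv_radius_pos_diff)
lift_definition uminus_cps1 :: "cps1 \<Rightarrow> cps1" is uminus by simp
lift_definition times_cps1 :: "cps1 \<Rightarrow> cps1 \<Rightarrow> cps1" is "(*)" by (rule fps_conv_radius_pos_mult)

instance
  by standard (transfer; simp add: algebra_simps)+

end

lift_definition const1 :: "complex \<Rightarrow> cps1" is fps_const by simp
lift_definition var1 :: cps1 is fps_X by simp
lift_definition coeff1 :: "cps1 \<Rightarrow> nat \<Rightarrow> complex" is fps_nth .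

lemma cps1_eqI: "(\<And>i. coeff1 a i = coeff1 b i) \<Longrightarrow> a = b"
  by transfer (simp add: fps_eq_iff)

lemma cps2_eqI: "(\<And>i j. coeff2 f i j = coeff2 g i j) \<Longrightarrow> f = g"
  by transfer (simp add: fps_eq_iff)

lemma coeff1_bound: "\<exists>C R. C \<ge> 0 \<and> R > 0 \<and> (\<forall>k. norm (coeff1 a k) \<le> C * R ^ k)"
  by transfer (simp add: fps_conv_radius_pos_iff_bound)

lemma exists_cps1:
  assumes "C \<ge> 0" "R > 0" "\<And>k. norm (c k) \<le> C * R ^ k"
  shows "\<exists>a. \<forall>i. coeff1 a i = c i"
  using assms
  apply transfer
  subgoal for C R c
    by (intro bexI[of _ "Abs_fps c"] CollectI, simp, unfold fps_conv_radius_pos_iff_bound, intro exI[of _ C] exI[of _ R], simp)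
  done

lemma exists_cps2:
  assumes "C \<ge> 0" "R > 0" "\<And>i j. norm (c i j) \<le> C * R ^ (i + j)"
  shows "\<exists>a. \<forall>i j. coeff2 a i j = c i j"
  using assms
  apply transfer
  subgoal for C R c
    by (rule bexI[of _ "Abs_fps (\<lambda>j. Abs_fps (\<lambda>i. c i j))"]) (auto intro: convergent2I)
  done

lemma coeff1_simps [simp]:
  "coeff1 0 i = 0" "coeff1 1 i = (if i = 0 then 1 else 0)" "coeff1 (a + b) i = coeff1 a i + coeff1 b i"
  "coeff1 (a - b) i = coeff1 a i - coeff1 b i" "coeff1 (- a) i = - coeff1 a i"
  "coeff1 (const1 c) i = (if i = 0 then c else 0)"
  "coeff1 var1 i = (if i = 1 then 1 else 0)"
  by (transfer; simp)+

lemma coeff1_sum: "coeff1 (sum g A) i = (\<Sum>k\<in>A. coeff1 (g k) i)"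
  by (induction A rule: infinite_finite_induct) auto

lemma coeff1_mult: "coeff1 (a * b) i = (\<Sum>k\<le>i. coeff1 a k * coeff1 b (i - k))"
  by transfer (simp add: fps_mult_nth atLeast0AtMost)

lemma coeff1_const1_mult: "coeff1 (const1 c * a) i = c * coeff1 a i"
  by transfer simp

lemma of_nat_cps1: "of_nat k = const1 (of_nat k)"
  by (induction k) (auto intro!: cps1_eqI)

lemma coeff1_of_nat_mult: "coeff1 (of_nat k * a) i = of_nat k * coeff1 a i"
  by (simp add: of_nat_cps1 coeff1_const1_mult)

lemma coeff1_mult_0 [simp]: "coeff1 (a * b) 0 = coeff1 a 0 * coeff1 b 0"
  by (simp add: coeff1_mult)

lemma coeff2_simps [simp]:
  "coeff2 0 i j = 0" "coeff2 1 i j = (if i = 0 \<and> j = 0 then 1 else 0)"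
  "coeff2 (f + g) i j = coeff2 f i j + coeff2 g i j"
  "coeff2 (f - g) i j = coeff2 f i j - coeff2 g i j" "coeff2 (- f) i j = - coeff2 f i j"
  by (transfer; simp)+

lemma coeff2_mult:
  "coeff2 (f * g) i j = (\<Sum>k\<le>i. \<Sum>l\<le>j. coeff2 f k l * coeff2 g (i - k) (j - l))"
proof -
  have "coeff2 (f * g) i j = (\<Sum>l\<le>j. \<Sum>k\<le>i. coeff2 f k l * coeff2 g (i - k) (j - l))"
    by transfer (simp add: fps_mult_nth fps_sum_nth atLeast0AtMost)
  then show ?thesis by (simp only: sum.swap[of _ "{..i}"])
qed

lemma coeff2_mult_00 [simp]: "coeff2 (f * g) 0 0 = coeff2 f 0 0 * coeff2 g 0 0"
  by (simp add: coeff2_mult)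

lemma coeff2_deriv_X: "coeff2 (deriv_X f) i j = of_nat (Suc i) * coeff2 f (Suc i) j"
  by transfer simp

lemma coeff2_deriv_Y: "coeff2 (deriv_Y f) i j = of_nat (Suc j) * coeff2 f i (Suc j)"
proof -
  have "fps_nth (of_nat n * g) i = of_nat n * fps_nth g i" for n and g :: "complex fps"
    by (simp add: fps_of_nat flip: fps_of_nat)
  then show ?thesis by transfer (simp del: of_nat_Suc)
qed

lemma coeff2_bound: "\<exists>C R. C \<ge> 0 \<and> R > 0 \<and> (\<forall>i j. norm (coeff2 f i j) \<le> C * R ^ (i + j))"
proof -
  have "convergent2 (fps_of_cps2 f)" using fps_of_cps2 by blast
  then show ?thesis unfolding convergent2_iff_bound coeff2.rep_eq .
qed

section \<open>Weierstrass division and preparation\<close>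

definition l1_summable :: "real \<Rightarrow> complex fps \<Rightarrow> bool" where
  "l1_summable \<rho> \<phi> \<longleftrightarrow> summable (\<lambda>n. norm (fps_nth \<phi> n) * \<rho> ^ n)"

text \<open>In Weierstrass division the coefficients of the powers of X are whole series in Y. This
  norm is submultiplicative and controls shifts, so the recursion for these series becomes a
  recursion for real numbers.\<close>

definition l1_norm :: "real \<Rightarrow> complex fps \<Rightarrow> real" where
  "l1_norm \<rho> \<phi> = (\<Sum>n. norm (fps_nth \<phi> n) * \<rho> ^ n)"

context
  fixes \<rho> :: real
  assumes \<rho>: "\<rho> > 0"
begin

lemma l1_norm_nonneg: "l1_summable \<rho> \<phi> \<Longrightarrow> l1_norm \<rho> \<phi> \<ge> 0"
  unfolding l1_norm_def l1_summable_def using \<rho> by (intro suminf_nonneg) auto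

lemma norm_nth_le_l1_norm:
  assumes "l1_summable \<rho> \<phi>"
  shows "norm (fps_nth \<phi> n) \<le> l1_norm \<rho> \<phi> * (1 / \<rho>) ^ n"
proof -
  have "norm (fps_nth \<phi> n) * \<rho> ^ n = (\<Sum>k\<in>{n}. norm (fps_nth \<phi> k) * \<rho> ^ k)" by simp
  also have "\<dots> \<le> l1_norm \<rho> \<phi>"
    using assms \<rho> unfolding l1_norm_def l1_summable_def by (intro sum_le_suminf) auto
  finally show ?thesis using \<rho> by (simp add: power_divide field_simps)
qed

lemma l1_bound:
  assumes "D \<ge> 0" "R > 0" "R * \<rho> \<le> 1 / 2" "\<And>n. norm (fps_nth \<phi> n) \<le> D * R ^ n"
  shows "l1_summable \<rho> \<phi>" "l1_norm \<rho> \<phi> \<le> 2 * D"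
proof -
  have le: "norm (fps_nth \<phi> n) * \<rho> ^ n \<le> D * (1/2) ^ n" for n
  proof -
    have "norm (fps_nth \<phi> n) * \<rho> ^ n \<le> (D * R ^ n) * \<rho> ^ n"
      using assms(4) \<rho> by (intro mult_right_mono) auto
    also have "\<dots> = D * (R * \<rho>) ^ n" by (simp add: power_mult_distrib)
    also have "\<dots> \<le> D * (1/2) ^ n" using assms \<rho> by (intro mult_left_mono power_mono) auto
    finally show ?thesis .
  qed
  have s: "(\<lambda>n. D * (1/2) ^ n) sums (D * 2)"
    using geometric_sums[of "1/2::real"] by (intro sums_mult) simp
  show sm: "l1_summable \<rho> \<phi>" unfolding l1_summable_def
    using le \<rho> by (intro summable_comparison_test[OF _ sums_summable[OF s]]) auto
  have "l1_norm \<rho> \<phi> \<le> (\<Sum>n. D * (1/2) ^ n)"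
    unfolding l1_norm_def using sm le sums_summable[OF s] unfolding l1_summable_def by (intro suminf_le) auto
  then show "l1_norm \<rho> \<phi> \<le> 2 * D" using sums_unique[OF s] by simp
qed

lemma l1_diff:
  assumes "l1_summable \<rho> \<phi>" "l1_summable \<rho> \<psi>"
  shows "l1_summable \<rho> (\<phi> - \<psi>)" "l1_norm \<rho> (\<phi> - \<psi>) \<le> l1_norm \<rho> \<phi> + l1_norm \<rho> \<psi>"
proof -
  have le: "norm (fps_nth (\<phi> - \<psi>) n) * \<rho> ^ n \<le> norm (fps_nth \<phi> n) * \<rho> ^ n + norm (fps_nth \<psi> n) * \<rho> ^ n" for n
    using \<rho> by (simp add: distrib_right[symmetric] norm_triangle_ineq4)
  have s: "summable (\<lambda>n. norm (fps_nth \<phi> n) * \<rho> ^ n + norm (fps_nth \<psi> n) * \<rho> ^ n)"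
    using assms unfolding l1_summable_def by (rule summable_add)
  show sm: "l1_summable \<rho> (\<phi> - \<psi>)" unfolding l1_summable_def
    using le \<rho> by (intro summable_comparison_test[OF _ s]) auto
  have "l1_norm \<rho> (\<phi> - \<psi>) \<le> (\<Sum>n. norm (fps_nth \<phi> n) * \<rho> ^ n + norm (fps_nth \<psi> n) * \<rho> ^ n)"
    unfolding l1_norm_def using sm le s unfolding l1_summable_def by (intro suminf_le) auto
  also have "\<dots> = l1_norm \<rho> \<phi> + l1_norm \<rho> \<psi>"
    using assms unfolding l1_summable_def l1_norm_def by (rule suminf_add[symmetric])
  finally show "l1_norm \<rho> (\<phi> - \<psi>) \<le> l1_norm \<rho> \<phi> + l1_norm \<rho> \<psi>" .
qed

lemma l1_mult:
  assumes "l1_summable \<rho> \<phi>" "l1_summable \<rho> \<psi>"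
  shows "l1_summable \<rho> (\<phi> * \<psi>)" "l1_norm \<rho> (\<phi> * \<psi>) \<le> l1_norm \<rho> \<phi> * l1_norm \<rho> \<psi>"
proof -
  let ?a = "\<lambda>n. norm (fps_nth \<phi> n) * \<rho> ^ n" and ?b = "\<lambda>n. norm (fps_nth \<psi> n) * \<rho> ^ n"
  have s: "summable (\<lambda>n. norm (?a n))" "summable (\<lambda>n. norm (?b n))"
    using assms \<rho> unfolding l1_summable_def by (simp_all add: abs_mult)
  note c = Cauchy_product_sums[OF s]
  have le: "norm (fps_nth (\<phi> * \<psi>) n) * \<rho> ^ n \<le> (\<Sum>i\<le>n. ?a i * ?b (n - i))" for n
  proof -
    have "norm (fps_nth (\<phi> * \<psi>) n) * \<rho> ^ n \<le> (\<Sum>i\<le>n. norm (fps_nth \<phi> i) * norm (fps_nth \<psi> (n - i))) * \<rho> ^ n"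
      using \<rho> unfolding fps_mult_nth atLeast0AtMost
      by (intro mult_right_mono sum_norm_le) (auto simp: norm_mult)
    also have "\<dots> = (\<Sum>i\<le>n. ?a i * ?b (n - i))"
      unfolding sum_distrib_right by (intro sum.cong) (auto simp: mult_ac simp flip: power_add)
    finally show ?thesis .
  qed
  show sm: "l1_summable \<rho> (\<phi> * \<psi>)" unfolding l1_summable_def
    using le \<rho> by (intro summable_comparison_test[OF _ sums_summable[OF c]]) auto
  have "l1_norm \<rho> (\<phi> * \<psi>) \<le> (\<Sum>n. \<Sum>i\<le>n. ?a i * ?b (n - i))"
    unfolding l1_norm_def using sm le sums_summable[OF c] unfolding l1_summable_def by (intro suminf_le) auto
  also have "\<dots> = l1_norm \<rho> \<phi> * l1_norm \<rho> \<psi>"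
    using sums_unique[OF c] unfolding l1_norm_def by simp
  finally show "l1_norm \<rho> (\<phi> * \<psi>) \<le> l1_norm \<rho> \<phi> * l1_norm \<rho> \<psi>" .
qed

lemma l1_sum:
  assumes "finite A" "\<And>a. a \<in> A \<Longrightarrow> l1_summable \<rho> (\<phi> a)"
  shows "l1_summable \<rho> (\<Sum>a\<in>A. \<phi> a)" "l1_norm \<rho> (\<Sum>a\<in>A. \<phi> a) \<le> (\<Sum>a\<in>A. l1_norm \<rho> (\<phi> a))"
proof -
  have "l1_summable \<rho> (\<Sum>a\<in>A. \<phi> a) \<and> l1_norm \<rho> (\<Sum>a\<in>A. \<phi> a) \<le> (\<Sum>a\<in>A. l1_norm \<rho> (\<phi> a))"
    using assms
  proof (induction A rule: finite_induct)
    case empty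
    then show ?case by (simp add: l1_summable_def l1_norm_def)
  next
    case (insert x F)
    let ?S = "\<Sum>a\<in>F. \<phi> a"
    have z: "l1_summable \<rho> 0" "l1_norm \<rho> 0 = 0" by (simp_all add: l1_summable_def l1_norm_def)
    have S: "l1_summable \<rho> ?S" "l1_norm \<rho> ?S \<le> (\<Sum>a\<in>F. l1_norm \<rho> (\<phi> a))" using insert by auto
    \<comment> \<open>The sum \<open>\<phi> x + ?S\<close> is estimated as
      \<open>\<phi> x - (0 - ?S)\<close>, so that \<open>l1_diff\<close> serves for sums
      too.\<close>
    have n: "l1_summable \<rho> (0 - ?S)" "l1_norm \<rho> (0 - ?S) \<le> l1_norm \<rho> ?S"
      using l1_diff[OF z(1) S(1)] z(2) by auto
    have "l1_summable \<rho> (\<phi> x)" using insert by auto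
    from l1_diff[OF this n(1)] n S insert(1,2) show ?case by simp
  qed
  then show "l1_summable \<rho> (\<Sum>a\<in>A. \<phi> a)" "l1_norm \<rho> (\<Sum>a\<in>A. \<phi> a) \<le> (\<Sum>a\<in>A. l1_norm \<rho> (\<phi> a))" by auto
qed

lemma l1_shift:
  assumes "l1_summable \<rho> \<phi>"
  shows "l1_summable \<rho> (fps_shift k \<phi>)" "l1_norm \<rho> (fps_shift k \<phi>) \<le> l1_norm \<rho> \<phi> / \<rho> ^ k"
proof -
  let ?f = "\<lambda>n. norm (fps_nth \<phi> n) * \<rho> ^ n"
  have s: "summable ?f" using assms unfolding l1_summable_def .
  then have s': "summable (\<lambda>n. ?f (n + k))" by (rule summable_ignore_initial_segment)
  have eq: "norm (fps_nth (fps_shift k \<phi>) n) * \<rho> ^ n = ?f (n + k) / \<rho> ^ k" for n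
    using \<rho> by (simp add: power_add)
  show "l1_summable \<rho> (fps_shift k \<phi>)"
    unfolding l1_summable_def eq by (rule summable_divide[OF s'])
  have "l1_norm \<rho> (fps_shift k \<phi>) = (\<Sum>n. ?f (n + k)) / \<rho> ^ k"
    unfolding l1_norm_def eq by (rule suminf_divide[OF s'])
  also have "(\<Sum>n. ?f (n + k)) \<le> l1_norm \<rho> \<phi>"
    using suminf_split_initial_segment[OF s, of k] \<rho> unfolding l1_norm_def
    by (simp add: sum_nonneg)
  finally show "l1_norm \<rho> (fps_shift k \<phi>) \<le> l1_norm \<rho> \<phi> / \<rho> ^ k"
    using \<rho> by (simp add: divide_right_mono)
qed

end

text \<open>
  Dividing \<open>h\<close> by \<open>g\<close>, with \<open>g\<^sub>i, h\<^sub>i\<close> the coefficients of \<open>X\<^sup>i\<close>, \<open>g\<^sub>0 = Y\<^sup>k v\<close> and \<open>w = 1 / v\<close>: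
  the coefficient of \<open>X\<^sup>i\<close> in \<open>h = q g + r\<close> determines \<open>q\<^sub>i\<close> from \<open>q\<^sub>0, \<dots>, q\<^sub>i\<^sub>-\<^sub>1\<close>, because \<open>r\<close> has
  degree less than \<open>k\<close> in \<open>Y\<close>.
\<close>

fun weierstrass_quotient ::
  "complex fps \<Rightarrow> nat \<Rightarrow> (nat \<Rightarrow> complex fps) \<Rightarrow> (nat \<Rightarrow> complex fps) \<Rightarrow> nat \<Rightarrow> complex fps" where
  "weierstrass_quotient w k g h i =
     w * fps_shift k (h i - (\<Sum>a<i. weierstrass_quotient w k g h a * g (i - a)))"

declare weierstrass_quotient.simps [simp del]

text \<open>As R is at most L / 2, the sum is dominated by its last term
  \<open>R * L ^ (i - 1)\<close> up to a factor 2. The extra factor L keeps the exponent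
  \<open>i - 1\<close> out of the case \<open>i = 0\<close>.\<close>

lemma geometric_convolution_le:
  fixes L R :: real
  assumes "R > 0" "2 * R \<le> L"
  shows "L * (\<Sum>a<i. L ^ a * R ^ (i - a)) \<le> 2 * R * L ^ i"
proof (induction i)
  case 0
  then show ?case using assms by simp
next
  case (Suc i)
  have "(\<Sum>a<Suc i. L ^ a * R ^ (Suc i - a)) = R * (\<Sum>a<i. L ^ a * R ^ (i - a)) + L ^ i * R"
    unfolding sum_distrib_left by (auto simp: Suc_diff_le mult_ac intro!: sum.cong)
  then have "L * (\<Sum>a<Suc i. L ^ a * R ^ (Suc i - a)) = R * (L * (\<Sum>a<i. L ^ a * R ^ (i - a))) + R * L ^ Suc i"
    by (simp add: algebra_simps)
  also have "\<dots> \<le> R * (2 * R * L ^ i) + R * L ^ Suc i"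
    using Suc assms by (intro add_right_mono mult_left_mono) auto
  also have "\<dots> = R * ((2 * R) * L ^ i + L ^ Suc i)" by (simp add: algebra_simps)
  also have "\<dots> \<le> R * (L * L ^ i + L ^ Suc i)"
    using assms by (intro mult_left_mono add_right_mono mult_right_mono) auto
  finally show ?case by simp
qed

lemma fps_inverse_bound:
  fixes v :: "complex fps"
  assumes "fps_conv_radius v > 0" "fps_nth v 0 \<noteq> 0"
  shows "fps_conv_radius (inverse v) > 0"
proof -
  have "eval_fps v has_fps_expansion v" using assms(1) by (rule eval_fps_has_fps_expansion)
  then have "(\<lambda>x. inverse (eval_fps v x)) has_fps_expansion inverse v"
    using assms(2) by (rule has_fps_expansion_inverse)
  then show ?thesis unfolding has_fps_expansion_def by blast
qed

text \<open>The recursion is always solvable formally; convergence is the issue. For small \<rho>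
  the norms of \<open>G i\<close> and \<open>H i\<close> grow at most like R^i, and induction keeps
  those of \<open>Q i\<close> below \<open>D * L ^ i\<close>: the term from \<open>H i\<close> and
  the convolution with the earlier \<open>Q a\<close> each take at most half of this bound.\<close>

theorem weierstrass_division:
  assumes low: "\<And>j. j < k \<Longrightarrow> coeff2 g 0 j = 0" and top: "coeff2 g 0 k \<noteq> 0"
  shows "\<exists>q r. h = q * g + r \<and> (\<forall>i j. k \<le> j \<longrightarrow> coeff2 r i j = 0)"
proof -
  define G where "G i = Abs_fps (\<lambda>j. coeff2 g i j)" for i
  define H where "H i = Abs_fps (\<lambda>j. coeff2 h i j)" for i
  define v where "v = fps_shift k (G 0)"
  define w where "w = inverse v"
  define Q where "Q = weierstrass_quotient w k G H"
  have Q: "Q i = w * fps_shift k (H i - (\<Sum>a<i. Q a * G (i - a)))" for i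
    unfolding Q_def by (subst weierstrass_quotient.simps) (rule refl)
  obtain C1 R1 where 1: "C1 \<ge> 0" "R1 > 0" "\<And>i j. norm (coeff2 g i j) \<le> C1 * R1 ^ (i + j)"
    using coeff2_bound[of g] by blast
  obtain C2 R2 where 2: "C2 \<ge> 0" "R2 > 0" "\<And>i j. norm (coeff2 h i j) \<le> C2 * R2 ^ (i + j)"
    using coeff2_bound[of h] by blast
  have v0: "fps_nth v 0 \<noteq> 0" using top by (simp add: v_def G_def)
  have "fps_conv_radius v > 0" unfolding fps_conv_radius_pos_iff_bound
  proof (intro exI conjI allI)
    show "norm (fps_nth v n) \<le> (C1 * R1 ^ k) * R1 ^ n" for n
      using 1(3)[of 0 "n + k"] by (simp add: v_def G_def power_add mult_ac)
  qed (use 1 in auto)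
  then have "fps_conv_radius w > 0" unfolding w_def using v0 by (rule fps_inverse_bound)
  then obtain C3 R3 where 3: "C3 \<ge> 0" "R3 > 0" "\<And>j. norm (fps_nth w j) \<le> C3 * R3 ^ j"
    unfolding fps_conv_radius_pos_iff_bound by blast
  define C where "C = Max {1, C1, C2, C3}"
  define R where "R = Max {1, R1, R2, R3}"
  have C: "C \<ge> 1" "C1 \<le> C" "C2 \<le> C" "C3 \<le> C" and R: "R \<ge> 1" "R1 \<le> R" "R2 \<le> R" "R3 \<le> R"
    unfolding C_def R_def by (intro Max_ge; simp)+
  have bg: "norm (fps_nth (G i) j) \<le> (C * R ^ i) * R ^ j" for i j
  proof -
    have "norm (coeff2 g i j) \<le> C1 * R1 ^ (i + j)" by (rule 1)
    also have "\<dots> \<le> C * R ^ (i + j)" using 1 C R by (intro mult_mono power_mono) auto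
    finally show ?thesis by (simp add: G_def power_add mult_ac)
  qed
  have bh: "norm (fps_nth (H i) j) \<le> (C * R ^ i) * R ^ j" for i j
  proof -
    have "norm (coeff2 h i j) \<le> C2 * R2 ^ (i + j)" by (rule 2)
    also have "\<dots> \<le> C * R ^ (i + j)" using 2 C R by (intro mult_mono power_mono) auto
    finally show ?thesis by (simp add: H_def power_add mult_ac)
  qed
  have bw: "norm (fps_nth w j) \<le> C * R ^ j" for j
  proof -
    have "norm (fps_nth w j) \<le> C3 * R3 ^ j" by (rule 3)
    also have "\<dots> \<le> C * R ^ j" using 3 C R by (intro mult_mono power_mono) auto
    finally show ?thesis .
  qed
  define \<rho> where "\<rho> = 1 / (2 * R)"
  have \<rho>: "\<rho> > 0" "R * \<rho> \<le> 1 / 2" using R(1) by (auto simp: \<rho>_def)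
  have R0: "R > 0" using R(1) by simp
  have CRn: "C * R ^ i \<ge> 0" for i using C(1) R(1) by simp
  note lg = l1_bound[OF \<rho>(1) CRn R0 \<rho>(2) bg] and lh = l1_bound[OF \<rho>(1) CRn R0 \<rho>(2) bh]
    and lw = l1_bound[OF \<rho>(1) _ R0 \<rho>(2) bw]
  \<comment> \<open>\<open>K\<close> bounds the effect of shifting by k and multiplying by w.
    \<open>D = 4 * C * K\<close> makes the contribution of \<open>H i\<close> at most half of
    \<open>D * L ^ i\<close>, and \<open>8 * C * K * R \<le> L\<close> does the same for the
    convolution.\<close>
  define K where "K = 2 * C / \<rho> ^ k"
  define D where "D = 4 * C * K"
  define L where "L = max (2 * R) (8 * C * K * R)"
  have K: "K > 0" using C(1) \<rho> by (simp add: K_def)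
  have D: "D > 0" using C(1) K by (simp add: D_def)
  have L: "2 * R \<le> L" "8 * C * K * R \<le> L" "L > 0" "R \<le> L" using R0 by (auto simp: L_def)
  have bQ: "l1_summable \<rho> (Q i) \<and> l1_norm \<rho> (Q i) \<le> D * L ^ i" for i
  proof (induction i rule: less_induct)
    case (less i)
    have IH: "l1_summable \<rho> (Q a)" "l1_norm \<rho> (Q a) \<le> D * L ^ a" if "a < i" for a
      using less that by auto
    let ?S = "\<Sum>a<i. Q a * G (i - a)"
    have t: "l1_summable \<rho> (Q a * G (i - a))"
      "l1_norm \<rho> (Q a * G (i - a)) \<le> (2 * C * D) * (L ^ a * R ^ (i - a))" if "a < i" for a
    proof -
      note m = l1_mult[OF \<rho>(1) IH(1)[OF that] lg(1)[of "i - a"]]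
      show "l1_summable \<rho> (Q a * G (i - a))" by (rule m)
      have "l1_norm \<rho> (Q a) * l1_norm \<rho> (G (i - a)) \<le> (D * L ^ a) * (2 * (C * R ^ (i - a)))"
        using IH[OF that] lg D L C l1_norm_nonneg[OF \<rho>(1)] by (intro mult_mono) auto
      with m(2) show "l1_norm \<rho> (Q a * G (i - a)) \<le> (2 * C * D) * (L ^ a * R ^ (i - a))"
        by (simp add: mult_ac)
    qed
    have s: "l1_summable \<rho> ?S" "l1_norm \<rho> ?S \<le> (\<Sum>a<i. l1_norm \<rho> (Q a * G (i - a)))"
      by (rule l1_sum[OF \<rho>(1)]; use t in simp)+
    note s(2)
    also have "(\<Sum>a<i. l1_norm \<rho> (Q a * G (i - a))) \<le> (\<Sum>a<i. (2 * C * D) * (L ^ a * R ^ (i - a)))"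
      by (rule sum_mono) (use t in auto)
    also have "\<dots> = (2 * C * D) * (\<Sum>a<i. L ^ a * R ^ (i - a))" by (simp add: sum_distrib_left)
    finally have s2: "l1_norm \<rho> ?S \<le> (2 * C * D) * (\<Sum>a<i. L ^ a * R ^ (i - a))" .
    note d = l1_diff[OF \<rho>(1) lh(1)[of i] s(1)]
    note sh = l1_shift[OF \<rho>(1) d(1), of k]
    note m = l1_mult[OF \<rho>(1) lw(1) sh(1)]
    have C0: "0 \<le> C" using C(1) by simp
    have sm: "l1_summable \<rho> (Q i)" unfolding Q[of i] using m(1) C0 by blast
    have "l1_norm \<rho> (Q i) \<le> l1_norm \<rho> w * l1_norm \<rho> (fps_shift k (H i - ?S))"
      unfolding Q[of i] using m(2) C0 by blast
    also have "\<dots> \<le> (2 * C) * (l1_norm \<rho> (H i - ?S) / \<rho> ^ k)"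
      using lw(2) C0 sh l1_norm_nonneg[OF \<rho>(1)] by (intro mult_mono) auto
    also have "\<dots> = K * l1_norm \<rho> (H i - ?S)" by (simp add: K_def)
    also have "\<dots> \<le> K * (2 * (C * R ^ i) + (2 * C * D) * (\<Sum>a<i. L ^ a * R ^ (i - a)))"
      using K d(2) lh(2)[of i] s2 by (intro mult_left_mono) auto
    also have "\<dots> \<le> D * L ^ i"
    proof -
      let ?T = "\<Sum>a<i. L ^ a * R ^ (i - a)"
      have T: "L * ?T \<le> 2 * R * L ^ i" by (rule geometric_convolution_le[OF R0 L(1)])
      have T0: "?T \<ge> 0" using L(3) R0 by (intro sum_nonneg) auto
      have "2 * R * (4 * C * K * ?T) = (8 * C * K * R) * ?T" by simp
      also have "\<dots> \<le> L * ?T" using L(2) T0 by (intro mult_right_mono) auto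
      also note T
      finally have "4 * C * K * ?T \<le> L ^ i" using R0 by simp
      then have "D * (4 * C * K * ?T) \<le> D * L ^ i" using D by (intro mult_left_mono) auto
      moreover have "D * R ^ i \<le> D * L ^ i" using D R0 L by (intro mult_left_mono power_mono) auto
      ultimately show ?thesis unfolding D_def by (simp add: algebra_simps)
    qed
    finally show ?case using sm by simp
  qed
  have "\<exists>q. \<forall>i j. coeff2 q i j = fps_nth (Q i) j"
  proof (rule exists_cps2[of D L])
    fix i j
    have "norm (fps_nth (Q i) j) \<le> l1_norm \<rho> (Q i) * (1 / \<rho>) ^ j"
      using bQ by (intro norm_nth_le_l1_norm \<rho>) auto
    also have "\<dots> \<le> (D * L ^ i) * L ^ j"
      using bQ D L \<rho> R0 by (intro mult_mono power_mono) (auto simp: \<rho>_def)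
    finally show "norm (fps_nth (Q i) j) \<le> D * L ^ (i + j)" by (simp add: power_add mult_ac)
  qed (use D L in auto)
  then obtain q where q: "\<And>i j. coeff2 q i j = fps_nth (Q i) j" by blast
  \<comment> \<open>\<open>G i\<close>, \<open>Q i\<close> and \<open>v\<close> are series in Y, so
    \<open>fps_X\<close> stands for Y here.\<close>
  have G0: "G 0 = fps_X ^ k * v"
    by (rule fps_ext) (use low in \<open>auto simp: fps_X_power_mult_nth v_def G_def\<close>)
  have wv: "w * v = 1" unfolding w_def using v0 by (rule inverse_mult_eq_1)
  have "coeff2 (h - q * g) i j = 0" if "k \<le> j" for i j
  proof -
    let ?W = "H i - (\<Sum>a<i. Q a * G (i - a))"
    have "coeff2 (q * g) i j = (\<Sum>a\<le>i. fps_nth (Q a * G (i - a)) j)"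
      unfolding coeff2_mult by (simp add: q G_def fps_mult_nth atLeast0AtMost)
    also have "\<dots> = fps_nth ((\<Sum>a<i. Q a * G (i - a)) + Q i * G 0) j"
      by (simp add: fps_sum_nth flip: lessThan_Suc_atMost)
    also have "Q i * G 0 = fps_X ^ k * fps_shift k ?W"
      unfolding Q[of i] G0 using wv by (simp add: mult_ac)
    finally show ?thesis
      using that by (simp add: fps_X_power_mult_nth H_def)
  qed
  then show ?thesis by (intro exI[of _ q] exI[of _ "h - q * g"]) auto
qed

text \<open>Division of 1 by g with \<open>k = 0\<close> leaves no room for a remainder.\<close>

lemma cps2_unit:
  assumes "coeff2 g 0 0 \<noteq> 0"
  shows "g dvd 1"
proof -
  obtain q r where "1 = q * g + r" "\<forall>i j. 0 \<le> j \<longrightarrow> coeff2 r i j = 0"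
    using weierstrass_division[of 0 g 1] assms by blast
  then have "1 = q * g" using cps2_eqI[of r 0] by simp
  then show ?thesis by (metis dvd_triv_right)
qed

text \<open>\<open>R \<ge> 1\<close> is carried through the induction because \<open>pCons\<close>
  raises the exponent of every old coefficient by one.\<close>

lemma poly_coeff_bound:
  "\<exists>C R. C \<ge> 0 \<and> R \<ge> 1 \<and> (\<forall>i j. norm (coeff1 (coeff p j) i) \<le> C * R ^ (i + j))"
proof (induction p)
  case 0
  then show ?case by (intro exI[of _ 0] exI[of _ 1]) auto
next
  case (pCons a p)
  then obtain C R where 1: "C \<ge> 0" "R \<ge> 1" "\<And>i j. norm (coeff1 (coeff p j) i) \<le> C * R ^ (i + j)" by blast
  obtain D S where 2: "D \<ge> 0" "S > 0" "\<And>i. norm (coeff1 a i) \<le> D * S ^ i" using coeff1_bound by blast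
  show ?case
  proof (intro exI conjI allI)
    fix i j
    show "norm (coeff1 (coeff (pCons a p) j) i) \<le> (max C D) * (max R S) ^ (i + j)"
    proof (cases j)
      case 0
      have "D * S ^ i \<le> max C D * max R S ^ i" using 1 2 by (intro mult_mono power_mono) auto
      with 0 2(3)[of i] show ?thesis by simp
    next
      case (Suc l)
      have "C * R ^ (i + l) \<le> max C D * max R S ^ (i + l)" using 1 2 by (intro mult_mono power_mono) auto
      also have "\<dots> \<le> max C D * max R S ^ (i + j)" using 1 2 Suc by (intro mult_left_mono power_increasing) auto
      finally show ?thesis using 1(3)[of l i] Suc by simp
    qed
  qed (use 1 2 in auto)
qed

text \<open>\<open>\<complex>{X}[Y]\<close> inside \<open>\<complex>{X, Y}\<close>.\<close>

definition emb :: "cps1 poly \<Rightarrow> cps2" where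
  "emb p = Abs_cps2 (Abs_fps (\<lambda>j. Abs_fps (\<lambda>i. coeff1 (coeff p j) i)))"

lemma coeff2_emb [simp]: "coeff2 (emb p) i j = coeff1 (coeff p j) i"
proof -
  obtain C R where 1: "C \<ge> 0" "R \<ge> 1" "\<And>i j. norm (coeff1 (coeff p j) i) \<le> C * R ^ (i + j)"
    using poly_coeff_bound by blast
  have "convergent2 (Abs_fps (\<lambda>j. Abs_fps (\<lambda>i. coeff1 (coeff p j) i)))"
    by (rule convergent2I[of C R]) (use 1 in auto)
  then show ?thesis unfolding emb_def coeff2.rep_eq by (simp add: Abs_cps2_inverse)
qed

lemma emb_simps:
  "emb 0 = 0" "emb 1 = 1" "emb (p + q) = emb p + emb q" "emb (p - q) = emb p - emb q"
  "emb (p * q) = emb p * emb q"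
proof -
  show "emb (p * q) = emb p * emb q"
  proof (rule cps2_eqI)
    fix i j
    show "coeff2 (emb (p * q)) i j = coeff2 (emb p * emb q) i j"
      unfolding coeff2_mult by (simp add: coeff_mult coeff1_sum coeff1_mult) (rule sum.swap)
  qed
qed (auto intro!: cps2_eqI simp: coeff_1)

definition weierstrass_poly :: "nat \<Rightarrow> cps1 poly \<Rightarrow> bool" where
  "weierstrass_poly k W \<longleftrightarrow> degree W = k \<and> lead_coeff W = 1 \<and> (\<forall>j<k. coeff1 (coeff W j) 0 = 0)"

text \<open>Divide Y^k by g and take Y^k - r for W. Restricting to X = 0 and comparing coefficients
  up to Y^k shows that q is a unit and that r vanishes there below degree k.\<close>

theorem weierstrass_preparation:
  assumes low: "\<And>j. j < k \<Longrightarrow> coeff2 g 0 j = 0" and top: "coeff2 g 0 k \<noteq> 0"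
  shows "\<exists>W q. weierstrass_poly k W \<and> coeff2 q 0 0 \<noteq> 0 \<and> emb W = q * g"
proof -
  define h where "h = emb (monom 1 k)"
  have h: "coeff2 h i j = (if i = 0 \<and> j = k then 1 else 0)" for i j
    by (auto simp: h_def)
  obtain q r where qr: "h = q * g + r" and r: "\<And>i j. k \<le> j \<Longrightarrow> coeff2 r i j = 0"
    using weierstrass_division[OF assms, of h] by blast
  have q0: "coeff2 (q * g) 0 j = (\<Sum>l\<le>j. coeff2 q 0 l * coeff2 g 0 (j - l))" for j
    by (simp add: coeff2_mult)
  have "(\<Sum>l\<le>k. coeff2 q 0 l * coeff2 g 0 (k - l)) = (\<Sum>l\<le>k. if l = 0 then coeff2 q 0 0 * coeff2 g 0 k else 0)"
    by (intro sum.cong) (auto simp: low)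
  then have "coeff2 (q * g) 0 k = coeff2 q 0 0 * coeff2 g 0 k" by (simp add: q0)
  moreover have "coeff2 (q * g) 0 k = 1"
    using arg_cong[OF qr, of "\<lambda>f. coeff2 f 0 k"] r[of k 0] by (simp add: h)
  ultimately have q00: "coeff2 q 0 0 \<noteq> 0" by auto
  have r0: "coeff2 r 0 j = 0" if "j < k" for j
  proof -
    have "coeff2 (q * g) 0 j = 0" unfolding q0 using that low by (intro sum.neutral) auto
    then show ?thesis using arg_cong[OF qr, of "\<lambda>f. coeff2 f 0 j"] that by (simp add: h)
  qed
  have "\<exists>a. \<forall>i. coeff1 a i = - coeff2 r i j" for j
  proof -
    obtain C R where "C \<ge> 0" "R > 0" "\<And>i j. norm (coeff2 r i j) \<le> C * R ^ (i + j)"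
      using coeff2_bound[of r] by blast
    then show ?thesis by (intro exists_cps1[of "C * R ^ j" R]) (auto simp: power_add mult_ac)
  qed
  then obtain a where a: "\<And>j i. coeff1 (a j) i = - coeff2 r i j" by metis
  define W where "W = monom 1 k + (\<Sum>j<k. monom (a j) j)"
  have cW: "coeff W j = (if j = k then 1 else if j < k then a j else 0)" for j
    by (auto simp: W_def coeff_sum if_distrib[of "\<lambda>x. x = _"] cong: if_cong)
  have "degree W = k"
    by (rule antisym) (auto intro!: degree_le le_degree simp: cW)
  moreover have "emb W = q * g"
  proof -
    have "emb W = h - r" by (rule cps2_eqI) (use r in \<open>auto simp: cW h a\<close>)
    then show ?thesis using qr by simp
  qed
  ultimately show ?thesis using q00 by (intro exI[of _ W] exI[of _ q]) (auto simp: weierstrass_poly_def cW a r0)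
qed

text \<open>The uniqueness behind Weierstrass division: modulo X, W is Y^k, so by induction on the
  power of X the coefficient of Y^(j + k) in the product is that of Y^j in h. In
  \<open>hensel_factor\<close> this shows that a cofactor is a polynomial.\<close>

lemma weierstrass_poly_mult_eq_0:
  assumes W: "weierstrass_poly k W" and r: "\<And>i j. k \<le> j \<Longrightarrow> coeff2 (emb W * h) i j = 0"
  shows "h = 0"
proof -
  have c0: "coeff1 (coeff W l) 0 = (if l = k then 1 else 0)" for l
    using W by (cases l k rule: linorder_cases) (auto simp: weierstrass_poly_def coeff_eq_0)
  have "\<forall>j. coeff2 h i j = 0" for i
  proof (induction i rule: less_induct)
    case (less i)
    show ?case
    proof
      fix j
      have "coeff2 (emb W * h) i (j + k) =
          (\<Sum>a\<le>i. \<Sum>l\<le>j+k. coeff1 (coeff W l) a * coeff2 h (i - a) (j + k - l))"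
        by (simp add: coeff2_mult)
      also have "\<dots> = (\<Sum>a\<le>i. if a = 0 then \<Sum>l\<le>j+k. coeff1 (coeff W l) 0 * coeff2 h i (j + k - l) else 0)"
        by (rule sum.cong) (use less in auto)
      also have "\<dots> = (\<Sum>l\<le>j+k. if l = k then coeff2 h i j else 0)"
        by (simp add: c0 mult_delta_left)
      finally show "coeff2 h i j = 0" using r[of "j + k" i] by simp
    qed
  qed
  then show ?thesis by (intro cps2_eqI) auto
qed

section \<open>Hensel's lemma and the Newton-Puiseux theorem\<close>

text \<open>The substitution \<open>X \<mapsto> X\<^sup>m\<close>, for \<open>m > 0\<close>.\<close>

lift_definition ram :: "nat \<Rightarrow> cps1 \<Rightarrow> cps1" is
  "\<lambda>m a. Abs_fps (\<lambda>i. if m dvd i then fps_nth a (i div m) else 0)"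
proof -
  fix m and a :: "complex fps"
  assume "fps_conv_radius a > 0"
  then obtain C R where CR: "C \<ge> 0" "R > 0" "\<And>k. norm (fps_nth a k) \<le> C * R ^ k"
    unfolding fps_conv_radius_pos_iff_bound by blast
  show "fps_conv_radius (Abs_fps (\<lambda>i. if m dvd i then fps_nth a (i div m) else 0)) > 0"
    unfolding fps_conv_radius_pos_iff_bound
  proof (intro exI conjI allI)
    fix k
    have "C * R ^ (k div m) \<le> C * (max 1 R) ^ (k div m)" using CR by (intro mult_left_mono power_mono) auto
    also have "\<dots> \<le> C * (max 1 R) ^ k" using CR by (intro mult_left_mono power_increasing) auto
    finally show "norm (fps_nth (Abs_fps (\<lambda>i. if m dvd i then fps_nth a (i div m) else 0)) k) \<le> C * (max 1 R) ^ k"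
      using CR(3)[of "k div m"] CR(1) by auto
  qed (use CR in auto)
qed

lemma coeff1_ram: "coeff1 (ram m a) i = (if m dvd i then coeff1 a (i div m) else 0)"
  by transfer simp

lemma coeff1_ram_0 [simp]: "coeff1 (ram m a) 0 = coeff1 a 0"
  by (simp add: coeff1_ram)

lemma ram_add: "ram m (a + b) = ram m a + ram m b"
  and ram_uminus: "ram m (- a) = - ram m a"
  and ram_0 [simp]: "ram m 0 = 0"
  by (rule cps1_eqI; simp add: coeff1_ram)+

lemma ram_1 [simp]: "m > 0 \<Longrightarrow> ram m 1 = 1"
  by (rule cps1_eqI) (auto simp: coeff1_ram)

lemma ram_const1 [simp]: "m > 0 \<Longrightarrow> ram m (const1 c) = const1 c"
  by (rule cps1_eqI) (auto simp: coeff1_ram)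

lemma ram_mult:
  assumes m: "m > 0"
  shows "ram m (a * b) = ram m a * ram m b"
proof (rule cps1_eqI)
  fix i
  show "coeff1 (ram m (a * b)) i = coeff1 (ram m a * ram m b) i"
  proof (cases "m dvd i")
    case False
    then have "coeff1 (ram m a) k * coeff1 (ram m b) (i - k) = 0" if "k \<le> i" for k
      using that by (metis coeff1_ram dvd_diff_nat diff_diff_cancel mult_eq_0_iff dvd_add le_add_diff_inverse)
    then have "coeff1 (ram m a * ram m b) i = 0"
      unfolding coeff1_mult by (intro sum.neutral) auto
    then show ?thesis using False by (simp add: coeff1_ram[of m "a * b"])
  next
    case True
    then obtain n where n: "i = m * n" by (rule dvdE)
    have "(\<Sum>k\<le>i. coeff1 (ram m a) k * coeff1 (ram m b) (i - k)) =
        (\<Sum>k\<in>(\<lambda>l. m * l) ` {..n}. coeff1 (ram m a) k * coeff1 (ram m b) (i - k))"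
    proof (rule sum.mono_neutral_right)
      show "\<forall>k\<in>{..i} - (\<lambda>l. m * l) ` {..n}. coeff1 (ram m a) k * coeff1 (ram m b) (i - k) = 0"
        using m by (auto simp: coeff1_ram n image_iff elim!: dvdE)
    qed (use m n in auto)
    also have "\<dots> = (\<Sum>l\<le>n. coeff1 a l * coeff1 b (n - l))"
      using m by (subst sum.reindex) (auto simp: inj_on_def coeff1_ram n simp flip: diff_mult_distrib2)
    finally show ?thesis using m by (simp add: coeff1_mult coeff1_ram[of m "a * b"] n)
  qed
qed

lemma ram_power: "m > 0 \<Longrightarrow> ram m (a ^ k) = ram m a ^ k"
  by (induction k) (auto simp: ram_mult)

lemma ram_sum: "ram m (sum g A) = (\<Sum>x\<in>A. ram m (g x))"
  by (induction A rule: infinite_finite_induct) (auto simp: ram_add)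

lemma ram_ram:
  assumes "m > 0" "n > 0"
  shows "ram m (ram n a) = ram (m * n) a"
proof (rule cps1_eqI)
  fix i
  show "coeff1 (ram m (ram n a)) i = coeff1 (ram (m * n) a) i"
  proof (cases "m dvd i")
    case True
    then show ?thesis using assms by (auto simp: coeff1_ram div_mult2_eq elim!: dvdE)
  next
    case False
    then have "\<not> m * n dvd i" by (metis dvd_mult_left)
    with False show ?thesis by (simp add: coeff1_ram)
  qed
qed

lemma coeff1_var1_power_mult: "coeff1 (var1 ^ N * a) i = (if i < N then 0 else coeff1 a (i - N))"
proof -
  have "fps_of_cps1 (var1 ^ N) = fps_X ^ N"
    by (induction N) (auto simp: one_cps1.rep_eq times_cps1.rep_eq var1.rep_eq)
  then show ?thesis by (simp add: coeff1.rep_eq times_cps1.rep_eq fps_X_power_mult_nth)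
qed

lemma var1_power_neq_0 [simp]: "var1 ^ N \<noteq> 0"
proof -
  have "var1 \<noteq> 0"
  proof
    assume "var1 = 0"
    from arg_cong[OF this, of "\<lambda>a. coeff1 a 1"] show False by simp
  qed
  then show ?thesis by simp
qed

lemma cps1_factor_var1:
  assumes "\<And>i. i < N \<Longrightarrow> coeff1 a i = 0"
  shows "\<exists>b. a = var1 ^ N * b \<and> coeff1 b 0 = coeff1 a N"
proof -
  obtain C R where CR: "C \<ge> 0" "R > 0" "\<And>k. norm (coeff1 a k) \<le> C * R ^ k"
    using coeff1_bound by blast
  have "\<exists>b. \<forall>i. coeff1 b i = coeff1 a (i + N)"
  proof (rule exists_cps1[of "C * R ^ N" R])
    show "norm (coeff1 a (k + N)) \<le> C * R ^ N * R ^ k" for k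
      using CR(3)[of "k + N"] by (simp add: power_add mult_ac)
  qed (use CR in auto)
  then obtain b where "\<And>i. coeff1 b i = coeff1 a (i + N)" by blast
  with assms show ?thesis
    by (intro exI[of _ b] conjI cps1_eqI) (auto simp: coeff1_var1_power_mult)
qed

abbreviation ramp :: "nat \<Rightarrow> cps1 poly \<Rightarrow> cps1 poly" where
  "ramp m \<equiv> map_poly (ram m)"

lemma coeff_ramp [simp]: "coeff (ramp m p) k = ram m (coeff p k)"
  by (simp add: coeff_map_poly)

lemma ramp_add: "ramp m (p + q) = ramp m p + ramp m q"
  by (rule poly_eqI) (simp add: ram_add)

lemma ramp_mult: "m > 0 \<Longrightarrow> ramp m (p * q) = ramp m p * ramp m q"
  by (rule poly_eqI) (simp add: coeff_mult ram_sum ram_mult)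

lemma ramp_pCons: "ramp m (pCons a p) = pCons (ram m a) (ramp m p)"
  by (rule poly_eqI) (auto simp: coeff_pCons split: nat.split)

lemma ramp_1: "m > 0 \<Longrightarrow> ramp m 1 = 1"
  by (rule poly_eqI) (simp add: coeff_1)

lemma ramp_pcompose: "m > 0 \<Longrightarrow> ramp m (pcompose p q) = pcompose (ramp m p) (ramp m q)"
  by (induction p) (auto simp: pcompose_pCons ramp_pCons ramp_add ramp_mult)

lemma ramp_ramp: "m > 0 \<Longrightarrow> n > 0 \<Longrightarrow> ramp m (ramp n p) = ramp (m * n) p"
  by (rule poly_eqI) (simp add: ram_ram)

lemma degree_ramp:
  assumes "lead_coeff P = 1" "m > 0"
  shows "degree (ramp m P) = degree P"
proof (rule antisym)
  show "degree (ramp m P) \<le> degree P" by (rule degree_le) (auto simp: coeff_eq_0)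
  show "degree P \<le> degree (ramp m P)" using assms by (intro le_degree) simp
qed

section \<open>Polynomials as products of linear factors, shifts and division\<close>

definition root_prod :: "'a :: comm_ring_1 list \<Rightarrow> 'a poly" where
  "root_prod ys = prod_list (map (\<lambda>y. [:- y, 1:]) ys)"

lemma root_prod_simps [simp]:
  "root_prod [] = 1" "root_prod (y # ys) = [:- y, 1:] * root_prod ys"
  by (simp_all add: root_prod_def)

lemma root_prod_append: "root_prod (xs @ ys) = root_prod xs * root_prod ys"
  by (induction xs) (simp_all only: append.simps root_prod_simps mult_1 mult.assoc)

lemma ramp_root_prod: "m > 0 \<Longrightarrow> ramp m (root_prod ys) = root_prod (map (ram m) ys)"
  by (induction ys) (simp_all only: list.map root_prod_simps ramp_mult ramp_pCons ram_uminus ram_1 map_poly_0 ramp_1)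

lemma root_prod_shift: "pcompose (root_prod ys) [:a, 1:] = root_prod (map (\<lambda>y. y - a) ys)"
proof (induction ys)
  case (Cons y ys)
  have "pcompose [:- y, 1:] [:a, 1:] = [:- (y - a), 1:]" by (simp add: pcompose_pCons)
  with Cons show ?case by (simp only: list.map root_prod_simps pcompose_mult)
qed (simp add: one_pCons pcompose_pCons)

lemma degree_root_prod: "degree (root_prod (ys :: 'a :: idom list)) = length ys \<and> lead_coeff (root_prod ys) = 1"
proof (induction ys)
  case (Cons y ys)
  then have "root_prod ys \<noteq> 0" by auto
  then have "degree ([:- y, 1:] * root_prod ys) = degree [:- y, 1:] + degree (root_prod ys)"
    by (intro degree_mult_eq) auto
  then have "degree ([:- y, 1:] * root_prod ys) = length (y # ys)" using Cons by simp
  moreover have "lead_coeff ([:- y, 1:] * root_prod ys) = 1" unfolding lead_coeff_mult using conjunct2[OF Cons.IH] by simp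
  ultimately show ?case unfolding root_prod_simps by blast
qed simp

text \<open>Up to sign the coefficients are elementary symmetric functions of the roots, so this is
  their homogeneity. It undoes the rescaling of Y made in \<open>newton_polygon_slope\<close>
  without dividing by h.\<close>

lemma coeff_root_prod_scale:
  fixes zs :: "'a :: idom list"
  assumes "k \<le> length zs"
  shows "coeff (root_prod (map (\<lambda>z. h * z) zs)) k = h ^ (length zs - k) * coeff (root_prod zs) k"
  using assms
proof (induction zs arbitrary: k)
  case Nil
  then show ?case by simp
next
  case (Cons z zs)
  have c: "coeff ([:- y, 1:] * q) j = - y * coeff q j + (if j = 0 then 0 else coeff q (j - 1))" for y :: 'a and q j
    by (cases j) auto
  show ?case
  proof (cases "k \<le> length zs")
    case True
    then have "Suc (length zs) - k = Suc (length zs - k)" by (simp add: Suc_diff_le)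
    then show ?thesis
      using Cons.IH[of k] Cons.IH[of "k - 1"] True
      by (cases k) (auto simp only: list.map root_prod_simps c, auto simp: algebra_simps)
  next
    case False
    then have k: "k = Suc (length zs)" using Cons.prems by simp
    have "coeff (root_prod (map ((*) h) zs)) (Suc (length zs)) = 0" "coeff (root_prod zs) (Suc (length zs)) = 0"
      using degree_root_prod[of zs] degree_root_prod[of "map ((*) h) zs"] by (auto intro!: coeff_eq_0)
    then show ?thesis using Cons.IH[of "length zs"] k
      by (simp only: list.map root_prod_simps c) simp
  qed
qed

text \<open>The Tschirnhaus shift: a suitable b removes the second highest coefficient.\<close>

lemma coeff_pcompose_shift:
  fixes P :: "'a :: idom poly"
  assumes "degree P = Suc n" "lead_coeff P = 1"
  shows "coeff (pcompose P [:b, 1:]) n = coeff P n + of_nat (Suc n) * b"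
  using assms
proof (induction n arbitrary: P)
  case 0
  then have "P = [:coeff P 0, 1:]"
    by (intro poly_eqI) (auto simp: coeff_pCons coeff_eq_0 split: nat.split)
  then obtain a where "P = [:a, 1:]" by blast
  then show ?case by (simp add: pcompose_pCons)
next
  case (Suc n)
  obtain a Q where P: "P = pCons a Q" by (rule pCons_cases)
  with Suc.prems have Q: "degree Q = Suc n" "lead_coeff Q = 1" by (auto split: if_splits)
  let ?Q = "pcompose Q [:b, 1:]"
  have d: "degree ?Q = Suc n" using Q by (simp add: degree_pcompose)
  have l: "coeff ?Q (Suc n) = 1" using lead_coeff_comp[of "[:b, 1:]" Q] d Q by simp
  have "coeff (pcompose P [:b, 1:]) (Suc n) = b * coeff ?Q (Suc n) + coeff ?Q n"
    unfolding P pcompose_pCons by (simp add: coeff_pCons)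
  then show ?case using Suc.IH[OF Q] l unfolding P by (simp add: algebra_simps)
qed

text \<open>Pseudo-division scales P by a power of the leading coefficient of W, which is 1
  here.\<close>

lemma monic_division:
  fixes P W :: "'a :: comm_ring_1 poly"
  assumes "lead_coeff W = 1"
  shows "\<exists>Q R. P = W * Q + R \<and> (R = 0 \<or> degree R < degree W)"
proof -
  obtain Q R where qr: "pseudo_divmod P W = (Q, R)" by (cases "pseudo_divmod P W")
  have "W \<noteq> 0" using assms by auto
  from pseudo_divmod[OF this qr] assms show ?thesis by auto
qed

lemma emb_eq_iff [simp]: "emb p = emb q \<longleftrightarrow> p = q"
proof
  assume *: "emb p = emb q"
  show "p = q"
  proof (intro poly_eqI cps1_eqI)
    fix j i show "coeff1 (coeff p j) i = coeff1 (coeff q j) i"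
      using arg_cong[OF *, of "\<lambda>f. coeff2 f i j"] by simp
  qed
qed auto

section \<open>Reduction modulo X and Hensel's lemma\<close>

abbreviation at_X0 :: "cps1 poly \<Rightarrow> complex poly" where
  "at_X0 \<equiv> map_poly (\<lambda>a. coeff1 a 0)"

lemma coeff_at_X0 [simp]: "coeff (at_X0 p) k = coeff1 (coeff p k) 0"
  by (simp add: coeff_map_poly)

lemma at_X0_add: "at_X0 (p + q) = at_X0 p + at_X0 q"
  by (rule poly_eqI) simp

lemma at_X0_mult: "at_X0 (p * q) = at_X0 p * at_X0 q"
  by (rule poly_eqI) (simp add: coeff_mult coeff1_sum)

lemma at_X0_pCons: "at_X0 (pCons a p) = pCons (coeff1 a 0) (at_X0 p)"
  by (rule poly_eqI) (auto simp: coeff_pCons split: nat.split)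

lemma at_X0_pcompose: "at_X0 (pcompose p q) = pcompose (at_X0 p) (at_X0 q)"
  by (induction p) (auto simp: pcompose_pCons at_X0_pCons at_X0_add at_X0_mult)

lemma degree_at_X0: "lead_coeff P = 1 \<Longrightarrow> degree (at_X0 P) = degree P"
proof (rule antisym)
  show "degree (at_X0 P) \<le> degree P" by (rule degree_le) (auto simp: coeff_eq_0)
  assume "lead_coeff P = 1"
  then show "degree P \<le> degree (at_X0 P)" by (intro le_degree) simp
qed

lemma pcompose_power: "pcompose (p ^ n) q = pcompose p q ^ n" for p :: "'a :: comm_ring_1 poly"
  by (induction n) (simp_all add: pcompose_1 pcompose_mult)

lemma pcompose_shift_back:
  fixes p :: "'a :: comm_ring_1 poly"
  shows "pcompose (pcompose p [:c, 1:]) [:- c, 1:] = p"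
  by (simp add: pcompose_pCons flip: pcompose_assoc)

text \<open>After shifting c to 0 the preparation theorem applies to the polynomial itself, read as
  a series in two variables; its order in Y at X = 0 is the multiplicity k. So W divides P up to a
  unit of the series ring, and comparison with polynomial division by W shows that the cofactor is a
  polynomial.\<close>

theorem hensel_factor:
  assumes P: "lead_coeff P = 1" and k: "order c (at_X0 P) = k"
  shows "\<exists>W Q. P = W * Q \<and> lead_coeff W = 1 \<and> lead_coeff Q = 1 \<and> degree W = k"
proof -
  define S where "S = pcompose P [:const1 c, 1:]"
  have "coeff (at_X0 P) (degree P) = 1" using P by simp
  then have nz: "at_X0 P \<noteq> 0" by (metis coeff_0 zero_neq_one)
  then obtain R where R: "at_X0 P = [:- c, 1:] ^ k * R" "\<not> [:- c, 1:] dvd R"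
    using order_decomp[OF nz] k by blast
  have "at_X0 S = pcompose (at_X0 P) [:c, 1:]"
    by (simp add: S_def at_X0_pcompose at_X0_pCons)
  also have "\<dots> = pcompose [:- c, 1:] [:c, 1:] ^ k * pcompose R [:c, 1:]"
    by (simp only: R(1) pcompose_mult pcompose_power)
  also have "pcompose [:- c, 1:] [:c, 1:] = monom 1 1"
    by (simp add: pcompose_pCons monom_Suc)
  also have "monom (1::complex) 1 ^ k = monom 1 k" by (simp add: monom_power)
  finally have S: "at_X0 S = monom 1 k * pcompose R [:c, 1:]" .
  have "coeff (pcompose R [:c, 1:]) 0 = poly R c"
    by (metis poly_0_coeff_0 poly_pcompose poly_pCons mult_zero_left add.right_neutral)
  with R(2) have R0: "coeff (pcompose R [:c, 1:]) 0 \<noteq> 0" by (simp add: poly_eq_0_iff_dvd)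
  have cS: "coeff2 (emb S) 0 j = coeff (at_X0 S) j" for j by simp
  have low: "coeff2 (emb S) 0 j = 0" if "j < k" for j
    using that unfolding cS S by (simp add: coeff_monom_mult)
  have top: "coeff2 (emb S) 0 k \<noteq> 0"
    using R0 unfolding cS S by (simp add: coeff_monom_mult)
  obtain W q where W: "weierstrass_poly k W" and q: "coeff2 q 0 0 \<noteq> 0" "emb W = q * emb S"
    using weierstrass_preparation[OF low top] by blast
  obtain u where u: "1 = q * u" using cps2_unit[OF q(1)] by (rule dvdE)
  have Su: "emb S = emb W * u" using q(2) u by (metis mult.assoc mult.commute mult_1)
  have lW: "lead_coeff W = 1" "degree W = k" using W by (auto simp: weierstrass_poly_def)
  obtain Q T where QT: "S = W * Q + T" "T = 0 \<or> degree T < degree W"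
    using monic_division[OF lW(1)] by blast
  have "emb W * (u - emb Q) = emb T"
    using Su QT(1) by (simp add: emb_simps algebra_simps)
  moreover have "coeff2 (emb T) i j = 0" if "k \<le> j" for i j
    using QT(2) lW(2) that by (auto simp: coeff_eq_0)
  ultimately have "u - emb Q = 0" using weierstrass_poly_mult_eq_0[OF W, of "u - emb Q"] by simp
  with Su have "S = W * Q" by (simp flip: emb_eq_iff add: emb_simps)
  then have "pcompose S [:- const1 c, 1:] = pcompose W [:- const1 c, 1:] * pcompose Q [:- const1 c, 1:]"
    by (simp only: pcompose_mult)
  then have PWQ: "P = pcompose W [:- const1 c, 1:] * pcompose Q [:- const1 c, 1:]"
    unfolding S_def pcompose_shift_back .
  have lW': "lead_coeff (pcompose W [:- const1 c, 1:]) = 1"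
    using lead_coeff_comp[of "[:- const1 c, 1:]" W] lW by simp
  then have "lead_coeff (pcompose Q [:- const1 c, 1:]) = 1"
    using P unfolding PWQ lead_coeff_mult by simp
  with PWQ lW' lW(2) show ?thesis
    by (intro exI[of _ "pcompose W [:- const1 c, 1:]"] exI[of _ "pcompose Q [:- const1 c, 1:]"])
      (auto simp: degree_pcompose)
qed

text \<open>A root of full multiplicity would give p = (Y - c)^(n + 1). Its second highest
  coefficient -(n + 1) c vanishes only for c = 0, and then p is a pure power, against
  \<open>coeff p k \<noteq> 0\<close>. This guarantees that Hensel's lemma splits off a proper
  factor.\<close>

lemma shift_root_not_full_order:
  fixes p :: "complex poly"
  assumes p: "degree p = Suc n" "lead_coeff p = 1" "coeff p n = 0" and k: "k \<le> n" "coeff p k \<noteq> 0"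
  shows "\<exists>c. 0 < order c p \<and> order c p \<le> n"
proof -
  have "\<not> constant (poly p)" using p(1) by (simp add: constant_degree)
  then obtain c where c: "poly p c = 0" using fundamental_theorem_of_algebra by blast
  have p0: "p \<noteq> 0" using k by auto
  have "order c p > 0" using c p0 by (simp add: order_root)
  moreover have "order c p \<noteq> Suc n"
  proof
    assume "order c p = Suc n"
    then have "[:- c, 1:] ^ Suc n dvd p" using order_1 by metis
    then obtain q where q: "p = [:- c, 1:] ^ Suc n * q" by (rule dvdE)
    with p0 have "q \<noteq> 0" by auto
    then have "degree p = Suc n + degree q"
      unfolding q by (subst degree_mult_eq) (simp_all add: degree_linear_power del: power_Suc)
    then obtain a where a: "q = [:a:]" using p(1) degree_eq_zeroE by (metis add_cancel_right_right)
    have "lead_coeff p = lead_coeff q"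
      unfolding q lead_coeff_mult lead_coeff_power by simp
    then have "q = 1" using p(2) a by (simp add: one_pCons)
    with q have p': "p = [:- c, 1:] ^ Suc n" by simp
    have "pcompose (monom 1 (Suc n)) [:- c, 1:] = [:- c, 1:] ^ Suc n"
      by (simp add: monom_altdef pcompose_smult pcompose_power pcompose_pCons)
    then have "coeff p n = of_nat (Suc n) * (- c)"
      using coeff_pcompose_shift[of "monom 1 (Suc n)" n "- c"] unfolding p' by (simp add: degree_monom_eq)
    with p(3) have "c = 0" by (simp del: of_nat_Suc)
    then have "p = monom 1 (Suc n)" unfolding p' by (simp add: monom_altdef)
    then show False using k by simp
  qed
  moreover have "order c p \<le> Suc n" using order_degree[OF p0, of c] p(1) by simp
  ultimately show ?thesis by (intro exI[of _ c]) auto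
qed

text \<open>Replace X by X^s and Y by X^r Y, where r / s is the smallest slope. Minimality makes the
  k-th coefficient divisible by X^(r (n + 1 - k)), and at the index l where the minimum is attained
  the quotient keeps a nonzero constant term.\<close>

lemma newton_polygon_slope:
  fixes P :: "cps1 poly"
  assumes P: "degree P = Suc n" "lead_coeff P = 1" "coeff P n = 0" and nt: "P \<noteq> monom 1 (Suc n)"
  shows "\<exists>s r Q. s > 0 \<and> degree Q = Suc n \<and> lead_coeff Q = 1 \<and> coeff Q n = 0 \<and>
           (\<exists>k\<le>n. coeff1 (coeff Q k) 0 \<noteq> 0) \<and>
           (\<forall>k\<le>Suc n. coeff (ramp s P) k = (var1 ^ r) ^ (Suc n - k) * coeff Q k)"
proof -
  \<comment> \<open>The order of the k-th coefficient in X; used only for k in \<open>K\<close>,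
    where the coefficient is nonzero and \<open>LEAST\<close> is meaningful.\<close>
  define v where "v k = (LEAST i. coeff1 (coeff P k) i \<noteq> 0)" for k
  define K where "K = {k. k \<le> n \<and> coeff P k \<noteq> 0}"
  have v: "coeff1 (coeff P k) (v k) \<noteq> 0" "\<And>i. i < v k \<Longrightarrow> coeff1 (coeff P k) i = 0" if "coeff P k \<noteq> 0" for k
  proof -
    have "\<exists>i. coeff1 (coeff P k) i \<noteq> 0" using that by (metis cps1_eqI coeff1_simps(1))
    then show "coeff1 (coeff P k) (v k) \<noteq> 0" unfolding v_def by (rule LeastI_ex)
    show "coeff1 (coeff P k) i = 0" if "i < v k" for i using not_less_Least that unfolding v_def by blast
  qed
  have "K \<noteq> {}"
  proof
    assume "K = {}"
    then have "P = monom 1 (Suc n)"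
    proof (intro poly_eqI)
      fix k
      consider "k \<le> n" | "k = Suc n" | "k > Suc n" by linarith
      then show "coeff P k = coeff (monom 1 (Suc n)) k"
        using P \<open>K = {}\<close> by cases (auto simp: K_def coeff_eq_0)
    qed
    with nt show False by simp
  qed
  moreover have "finite K" by (auto simp: K_def)
  ultimately obtain l where l: "is_arg_min (\<lambda>k. real (v k) / real (Suc n - k)) (\<lambda>k. k \<in> K) l"
    using ex_is_arg_min_if_finite by blast
  define s where "s = Suc n - l"
  define r where "r = v l"
  have lK: "l \<le> n" "coeff P l \<noteq> 0" using l by (auto simp: is_arg_min_def K_def)
  have s: "s > 0" using lK by (simp add: s_def)
  have slope: "r * (Suc n - k) \<le> s * v k" if "k \<in> K" for k
  proof -
    have "real r / real s \<le> real (v k) / real (Suc n - k)"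
      using l that unfolding is_arg_min_def r_def s_def by fastforce
    moreover have "Suc n - k > 0" using that by (auto simp: K_def)
    ultimately have "real r * real (Suc n - k) \<le> real s * real (v k)"
      using s by (simp add: field_simps)
    then show ?thesis by (simp flip: of_nat_mult)
  qed
  have "\<exists>b. ram s (coeff P k) = (var1 ^ r) ^ (Suc n - k) * b \<and> coeff1 b 0 = coeff1 (ram s (coeff P k)) (r * (Suc n - k))"
    if "k \<le> n" for k
    unfolding power_mult[symmetric]
  proof (rule cps1_factor_var1)
    fix i assume i: "i < r * (Suc n - k)"
    show "coeff1 (ram s (coeff P k)) i = 0"
    proof (cases "k \<in> K")
      case True
      then have "coeff P k \<noteq> 0" by (simp add: K_def)
      show ?thesis
      proof (cases "s dvd i")
        case True
        then obtain j where j: "i = s * j" by (rule dvdE)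
        have "s * j < s * v k" using i slope[OF \<open>k \<in> K\<close>] j by linarith
        then have "j < v k" using s by simp
        then show ?thesis using v(2)[OF \<open>coeff P k \<noteq> 0\<close>] s by (simp add: coeff1_ram j)
      qed (simp add: coeff1_ram)
    next
      case False
      then show ?thesis using that by (simp add: K_def)
    qed
  qed
  then obtain b where b: "\<And>k. k \<le> n \<Longrightarrow> ram s (coeff P k) = (var1 ^ r) ^ (Suc n - k) * b k"
    "\<And>k. k \<le> n \<Longrightarrow> coeff1 (b k) 0 = coeff1 (ram s (coeff P k)) (r * (Suc n - k))" by metis
  define Q where "Q = monom 1 (Suc n) + (\<Sum>k\<le>n. monom (b k) k)"
  have cQ: "coeff Q k = (if k = Suc n then 1 else if k \<le> n then b k else 0)" for k
    by (auto simp: Q_def coeff_sum if_distrib[of "\<lambda>x. x = _"] cong: if_cong)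
  have dQ: "degree Q = Suc n"
    by (rule antisym) (auto intro!: degree_le le_degree simp: cQ)
  have "(var1 ^ r) ^ (Suc n - n) * b n = 0" using b(1)[of n] P(3) by simp
  then have "b n = 0" using var1_power_neq_0 by (metis mult_eq_0_iff power_mult)
  then have "coeff Q n = 0" by (simp add: cQ)
  moreover have "coeff1 (coeff Q l) 0 \<noteq> 0"
  proof -
    have e: "r * (Suc n - l) = s * r" by (simp add: s_def)
    have "coeff1 (b l) 0 = coeff1 (coeff P l) r"
      using b(2)[OF lK(1)] s unfolding e by (simp add: coeff1_ram)
    then show ?thesis using lK v(1)[OF lK(2)] by (simp add: cQ r_def)
  qed
  moreover have "coeff (ramp s P) k = (var1 ^ r) ^ (Suc n - k) * coeff Q k" if "k \<le> Suc n" for k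
    using that b(1)[of k] P s by (cases "k = Suc n") (auto simp: cQ)
  ultimately show ?thesis using s dQ lK
    by (intro exI[of _ s] exI[of _ r] exI[of _ Q]) (auto simp: cQ)
qed

text \<open>Induction on the degree. Tschirnhaus shift and Newton polygon rescaling lead either to a
  pure power or to a polynomial whose reduction modulo X has a root of multiplicity strictly between
  0 and the degree; Hensel's lemma then yields two factors of smaller degree. Multiplying their
  ramification indices gives one parameter for both.\<close>

theorem newton_puiseux:
  assumes "lead_coeff P = 1"
  shows "\<exists>m>0. \<exists>ys. ramp m P = root_prod ys"
  using assms
proof (induction "degree P" arbitrary: P rule: less_induct)
  case less
  show ?case
  proof (cases "degree P")
    case 0
    then obtain c where "P = [:c:]" by (rule degree_eq_zeroE)
    with less.prems have "P = 1" by (simp add: one_pCons)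
    then show ?thesis by (intro exI[of _ 1] conjI exI[of _ "[]"]) (simp_all add: ramp_1)
  next
    case (Suc n)
    define a where "a = const1 (1 / of_nat (Suc n)) * coeff P n"
    define P1 where "P1 = pcompose P [:- a, 1:]"
    have P1: "degree P1 = Suc n" "lead_coeff P1 = 1"
      using Suc less.prems lead_coeff_comp[of "[:- a, 1:]" P] by (simp_all add: P1_def degree_pcompose)
    have "of_nat (Suc n) * a = coeff P n"
      by (rule cps1_eqI) (simp add: a_def coeff1_of_nat_mult coeff1_const1_mult del: of_nat_Suc)
    then have c0: "coeff P1 n = 0"
      using coeff_pcompose_shift[OF Suc less.prems, of "- a"] by (simp add: P1_def)
    have "\<exists>m>0. \<exists>ys. ramp m P1 = root_prod ys"
    proof (cases "P1 = monom 1 (Suc n)")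
      case True
      have mon: "monom 1 k = root_prod (replicate k (0 :: cps1))" for k
        by (induction k) (simp_all add: monom_Suc)
      have "ramp 1 P1 = root_prod (map (ram 1) (replicate (Suc n) 0))"
        unfolding True mon by (rule ramp_root_prod) simp
      then show ?thesis by blast
    next
      case False
      obtain s r Q where Q: "s > 0" "degree Q = Suc n" "lead_coeff Q = 1" "coeff Q n = 0"
        "\<exists>k\<le>n. coeff1 (coeff Q k) 0 \<noteq> 0"
        and PQ: "\<And>k. k \<le> Suc n \<Longrightarrow> coeff (ramp s P1) k = (var1 ^ r) ^ (Suc n - k) * coeff Q k"
        using newton_polygon_slope[OF P1 c0 False] by blast
      have d: "degree (at_X0 Q) = Suc n" using degree_at_X0[OF Q(3)] Q(2) by simp
      obtain c where c: "0 < order c (at_X0 Q)" "order c (at_X0 Q) \<le> n"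
        using shift_root_not_full_order[OF d] d Q by auto
      obtain U V where UV: "Q = U * V" "lead_coeff U = 1" "lead_coeff V = 1" "degree U = order c (at_X0 Q)"
        using hensel_factor[OF Q(3) refl] by blast
      have "U \<noteq> 0" "V \<noteq> 0" using UV by auto
      then have dUV: "degree U + degree V = Suc n" using Q(2) UV(1) by (simp add: degree_mult_eq)
      have "degree U < degree P" "degree V < degree P" using dUV c UV(4) Suc by linarith+
      with less.hyps UV obtain m1 m2 ys1 ys2 where m: "m1 > 0" "m2 > 0"
        and ys: "ramp m1 U = root_prod ys1" "ramp m2 V = root_prod ys2" by metis
      define m where "m = m1 * m2"
      have m0: "m > 0" using m by (simp add: m_def)
      have "ramp m U = root_prod (map (ram m2) ys1)" "ramp m V = root_prod (map (ram m1) ys2)"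
        using m ys ramp_ramp[of m2 m1 U] ramp_ramp[of m1 m2 V] ramp_root_prod
        by (simp_all add: m_def mult.commute)
      then obtain zs where zs: "ramp m Q = root_prod zs"
        using m0 by (auto simp: UV ramp_mult simp flip: root_prod_append)
      have "degree (ramp m Q) = Suc n" using Q m0 by (simp add: degree_ramp)
      then have len: "length zs = Suc n" using degree_root_prod[of zs] zs by simp
      define h where "h = ram m (var1 ^ r)"
      have "ramp m (ramp s P1) = root_prod (map (\<lambda>z. h * z) zs)"
      proof (rule poly_eqI)
        fix k
        show "coeff (ramp m (ramp s P1)) k = coeff (root_prod (map (\<lambda>z. h * z) zs)) k"
        proof (cases "k \<le> Suc n")
          case True
          have "coeff (ramp m (ramp s P1)) k = h ^ (Suc n - k) * coeff (ramp m Q) k"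
            using PQ[OF True] m0 by (simp add: h_def ram_mult ram_power)
          then show ?thesis using coeff_root_prod_scale[of k zs h] True len zs by simp
        next
          case False
          then show ?thesis
            using P1 degree_root_prod[of "map (\<lambda>z. h * z) zs"] len by (simp add: coeff_eq_0)
        qed
      qed
      then show ?thesis using m0 Q(1) by (auto simp: ramp_ramp intro!: exI[of _ "m * s"])
    qed
    then obtain m ys where m: "m > 0" "ramp m P1 = root_prod ys" by blast
    have "P = pcompose P1 [:a, 1:]" unfolding P1_def using pcompose_shift_back[of P "- a"] by simp
    then have "ramp m P = pcompose (root_prod ys) [:ram m a, 1:]"
      using m by (simp add: ramp_pcompose ramp_pCons)
    then show ?thesis using m(1) root_prod_shift by metis
  qed
qed

section \<open>Convergent power series as functions\<close>

text \<open>The factor \<open>(1/2) ^ (i + j)\<close> is built in so that on the closed bidisc of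
  radius r the series is dominated, uniformly, by a double geometric series with sum 4 C.\<close>

definition converges_on :: "cps2 \<Rightarrow> real \<Rightarrow> bool" where
  "converges_on f r \<longleftrightarrow> r > 0 \<and> (\<exists>C\<ge>0. \<forall>i j. norm (coeff2 f i j) * r ^ (i + j) \<le> C * (1/2) ^ (i + j))"

lemma converges_on_mono:
  assumes "converges_on f r" "0 < s" "s \<le> r"
  shows "converges_on f s"
proof -
  obtain C where C: "C \<ge> 0" "\<And>i j. norm (coeff2 f i j) * r ^ (i + j) \<le> C * (1/2) ^ (i + j)"
    using assms(1) unfolding converges_on_def by blast
  have "norm (coeff2 f i j) * s ^ (i + j) \<le> norm (coeff2 f i j) * r ^ (i + j)" for i j
    using assms by (intro mult_left_mono power_mono) auto
  with C assms(2) show ?thesis unfolding converges_on_def by (meson order_trans)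
qed

lemma eventually_converges_on: "\<forall>\<^sub>F r in at_right 0. converges_on f r"
proof -
  obtain C R where CR: "C \<ge> 0" "R > 0" "\<And>i j. norm (coeff2 f i j) \<le> C * R ^ (i + j)"
    using coeff2_bound by blast
  have "converges_on f (1 / (2 * R))" unfolding converges_on_def
  proof (intro conjI exI allI)
    fix i j
    have "norm (coeff2 f i j) * (1 / (2 * R)) ^ (i + j) \<le> (C * R ^ (i + j)) * (1 / (2 * R)) ^ (i + j)"
      using CR by (intro mult_right_mono) auto
    also have "\<dots> = C * (R * (1 / (2 * R))) ^ (i + j)" by (simp only: power_mult_distrib mult.assoc)
    also have "R * (1 / (2 * R)) = 1 / 2" using CR by simp
    finally show "norm (coeff2 f i j) * (1 / (2 * R)) ^ (i + j) \<le> C * (1/2) ^ (i + j)" .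
  qed (use CR in auto)
  moreover have "1 / (2 * R) > 0" using CR by simp
  ultimately show ?thesis unfolding eventually_at_right_field
    by (intro exI[of _ "1 / (2 * R)"]) (auto intro: converges_on_mono)
qed

lemma eventually_at_right_0_obtain:
  assumes "\<forall>\<^sub>F r in at_right (0::real). P r"
  obtains r where "r > 0" "P r"
  using assms unfolding eventually_at_right_field by (metis dense)

lemma eventually_nhds_prodI:
  fixes P :: "complex \<times> complex \<Rightarrow> bool"
  assumes "r > 0" "\<And>x y. norm x < r \<Longrightarrow> norm y < r \<Longrightarrow> P (x, y)"
  shows "\<forall>\<^sub>F z in nhds 0. P z"
proof -
  have "\<forall>\<^sub>F z in nhds (0 :: complex \<times> complex). dist z 0 < r"
    using assms(1) eventually_nhds_metric by blast
  then show ?thesis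
  proof eventually_elim
    case (elim z)
    have "norm (fst z) \<le> norm z" "norm (snd z) \<le> norm z"
      using norm_fst_le[of "fst z" "snd z"] norm_snd_le[of "snd z" "fst z"] by simp_all
    with elim assms(2)[of "fst z" "snd z"] show ?case by simp
  qed
qed

lemma eventually_nhds_prodD:
  fixes P :: "complex \<times> complex \<Rightarrow> bool"
  assumes "\<forall>\<^sub>F z in nhds 0. P z"
  obtains r where "r > 0" "\<And>x y. norm x < r \<Longrightarrow> norm y < r \<Longrightarrow> P (x, y)"
proof -
  obtain e where e: "e > 0" "\<And>z. dist z 0 < e \<Longrightarrow> P z"
    using assms unfolding eventually_nhds_metric by blast
  show thesis
  proof (rule that[of "e / 2"])
    fix x y :: complex assume "norm x < e / 2" "norm y < e / 2"
    moreover have "norm (x, y) \<le> norm x + norm y" by (rule norm_Pair_le)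
    ultimately show "P (x, y)" using e(2)[of "(x, y)"] by simp
  qed (use e in simp)
qed

lemma geometric2_has_sum:
  "((\<lambda>(i, j). C * (1/2 :: real) ^ (i + j)) has_sum (4 * C)) UNIV"
proof -
  have s: "((\<lambda>n. (1/2 :: real) ^ n) has_sum 2) UNIV"
    using geometric_sums[of "1/2 :: real"] by (intro norm_summable_imp_has_sum) (auto simp: summable_geometric)
  have "((\<lambda>(i, j). C * (1/2 :: real) ^ (i + j)) has_sum (4 * C)) (UNIV \<times> UNIV)"
    if C: "C \<ge> 0" for C
  proof (rule has_sum_SigmaI)
    show "((\<lambda>j. case (i, j) of (i, j) \<Rightarrow> C * (1/2 :: real) ^ (i + j)) has_sum (2 * C * (1/2) ^ i)) UNIV" for i
      using has_sum_cmult_right[OF s, of "C * (1/2) ^ i"] by (simp add: power_add mult_ac)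
    show "((\<lambda>i. 2 * C * (1/2) ^ i) has_sum (4 * C)) UNIV"
      using has_sum_cmult_right[OF s, of "2 * C"] by (simp add: mult_ac)
    show "(\<lambda>(i, j). C * (1/2 :: real) ^ (i + j)) summable_on (UNIV \<times> UNIV)"
    proof (rule summable_on_SigmaI)
      show "((\<lambda>j. case (i, j) of (i, j) \<Rightarrow> C * (1/2 :: real) ^ (i + j)) has_sum (2 * C * (1/2) ^ i)) UNIV" for i
        using has_sum_cmult_right[OF s, of "C * (1/2) ^ i"] by (simp add: power_add mult_ac)
      show "(\<lambda>i. 2 * C * (1/2) ^ i) summable_on UNIV"
        using has_sum_cmult_right[OF s, of "2 * C"] by (auto simp: mult_ac summable_on_def)
    qed (use C in auto)
  qed
  from has_sum_cmult_right[OF this[of 1], of C] show ?thesis by (simp add: case_prod_unfold mult_ac)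
qed

lemma monomial_le:
  assumes "converges_on f r" "norm x \<le> r" "norm y \<le> r"
  shows "norm (coeff2 f i j * x ^ i * y ^ j) \<le> norm (coeff2 f i j) * r ^ (i + j)"
proof -
  have "norm x ^ i * norm y ^ j \<le> r ^ i * r ^ j"
    using assms by (intro mult_mono power_mono) (auto simp: converges_on_def)
  then show ?thesis by (simp add: norm_mult norm_power power_add mult.assoc mult_left_mono)
qed

text \<open>For fixed x the value of f is an ordinary power series in y with these coefficients, so
  theorems on one variable apply.\<close>

definition row_sum :: "cps2 \<Rightarrow> complex \<Rightarrow> nat \<Rightarrow> complex" where
  "row_sum f x j = (\<Sum>i. coeff2 f i j * x ^ i)"

context
  fixes f :: cps2 and r :: real and x y :: complex
  assumes conv: "converges_on f r" and x: "norm x \<le> r" and y: "norm y \<le> r"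
begin

lemma eval2_abs_summable: "(\<lambda>p. norm (case p of (i, j) \<Rightarrow> coeff2 f i j * x ^ i * y ^ j)) summable_on UNIV"
proof -
  obtain C where C: "C \<ge> 0" "\<And>i j. norm (coeff2 f i j) * r ^ (i + j) \<le> C * (1/2) ^ (i + j)"
    using conv unfolding converges_on_def by blast
  show ?thesis
  proof (rule Infinite_Sum.abs_summable_on_comparison_test')
    show "(\<lambda>(i, j). C * (1/2 :: real) ^ (i + j)) summable_on UNIV"
      using geometric2_has_sum by (auto simp: summable_on_def)
    fix p :: "nat \<times> nat"
    show "norm (case p of (i, j) \<Rightarrow> coeff2 f i j * x ^ i * y ^ j) \<le> (case p of (i, j) \<Rightarrow> C * (1/2) ^ (i + j))"
      using order_trans[OF monomial_le[OF conv x y] C(2)] by (auto split: prod.split)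
  qed
qed

lemma eval2_summable: "(\<lambda>(i, j). coeff2 f i j * x ^ i * y ^ j) summable_on UNIV"
  using eval2_abs_summable by (rule abs_summable_summable)

lemma row_summable: "summable (\<lambda>i. norm (coeff2 f i j * x ^ i))"
proof -
  have r: "r > 0" using conv by (simp add: converges_on_def)
  obtain C where C: "C \<ge> 0" "\<And>i j. norm (coeff2 f i j) * r ^ (i + j) \<le> C * (1/2) ^ (i + j)"
    using conv unfolding converges_on_def by blast
  have "norm (coeff2 f i j * x ^ i) \<le> (C / r ^ j) * (1/2) ^ i" for i
  proof -
    have "norm (coeff2 f i j * x ^ i) \<le> norm (coeff2 f i j) * r ^ i"
      using power_mono[of "norm x" r i] x by (auto simp: norm_mult norm_power intro!: mult_left_mono)
    moreover have "norm (coeff2 f i j) * r ^ i * r ^ j \<le> C * (1/2) ^ i"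
      using order_trans[OF C(2)[of i j], of "C * (1/2) ^ i"] C(1)
      by (simp add: power_add mult.assoc mult_left_mono power_le_one mult_left_le)
    then have "norm (coeff2 f i j) * r ^ i \<le> (C * (1/2) ^ i) / r ^ j" using r by (simp add: pos_le_divide_eq)
    ultimately show ?thesis by simp
  qed
  note le = this
  have "summable (\<lambda>i. (C / r ^ j) * (1/2 :: real) ^ i)"
    by (intro summable_mult summable_geometric) simp
  then show ?thesis
  proof (rule summable_comparison_test'[where N = 0])
    show "norm (norm (coeff2 f i j * x ^ i)) \<le> (C / r ^ j) * (1/2) ^ i" for i
      unfolding real_norm_def abs_norm_cancel by (rule le)
  qed
qed

lemma eval2_swap_sum: "eval2 f (x, y) = (\<Sum>\<^sub>\<infinity>j. \<Sum>\<^sub>\<infinity>i. coeff2 f i j * x ^ i * y ^ j)"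
proof -
  have s: "(\<lambda>(i, j). coeff2 f i j * x ^ i * y ^ j) summable_on UNIV \<times> UNIV" using eval2_summable by simp
  have "eval2 f (x, y) = (\<Sum>\<^sub>\<infinity>(i, j)\<in>UNIV \<times> UNIV. coeff2 f i j * x ^ i * y ^ j)" by (simp add: eval2_def)
  also have "\<dots> = (\<Sum>\<^sub>\<infinity>i. \<Sum>\<^sub>\<infinity>j. coeff2 f i j * x ^ i * y ^ j)" by (rule infsum_Sigma'_banach[OF s, symmetric])
  also have "\<dots> = (\<Sum>\<^sub>\<infinity>j. \<Sum>\<^sub>\<infinity>i. coeff2 f i j * x ^ i * y ^ j)" by (rule infsum_swap_banach[OF s])
  finally show ?thesis .
qed

lemma row_sum_infsum: "(\<Sum>\<^sub>\<infinity>i. coeff2 f i j * x ^ i * y ^ j) = row_sum f x j * y ^ j"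
proof -
  have "((\<lambda>i. coeff2 f i j * x ^ i) has_sum row_sum f x j) UNIV"
    unfolding row_sum_def
    by (rule norm_summable_imp_has_sum[OF row_summable summable_sums]) (rule summable_norm_cancel[OF row_summable])
  from has_sum_cmult_left[OF this, of "y ^ j"] show ?thesis by (rule infsumI)
qed

lemma row_sum_has_sum: "((\<lambda>j. row_sum f x j * y ^ j) has_sum eval2 f (x, y)) UNIV"
proof -
  have s: "(\<lambda>(i, j). coeff2 f i j * x ^ i * y ^ j) summable_on UNIV \<times> UNIV" using eval2_summable by simp
  then have "(\<lambda>(j, i). coeff2 f i j * x ^ i * y ^ j) summable_on UNIV \<times> UNIV"
    using summable_on_swap[of "\<lambda>(i, j). coeff2 f i j * x ^ i * y ^ j" UNIV UNIV]  by (simp add: case_prod_unfold)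
  then have "(\<lambda>j. \<Sum>\<^sub>\<infinity>i. coeff2 f i j * x ^ i * y ^ j) summable_on UNIV"
    using summable_on_Sigma_banach[of "\<lambda>j i. coeff2 f i j * x ^ i * y ^ j" UNIV "\<lambda>_. UNIV"] by simp
  then show ?thesis unfolding eval2_swap_sum row_sum_infsum by (rule has_sum_infsum)
qed

lemma row_sum_sums: "(\<lambda>j. row_sum f x j * y ^ j) sums eval2 f (x, y)"
  using row_sum_has_sum by (rule has_sum_imp_sums)

lemma row_sum_summable_norm: "summable (\<lambda>j. norm (row_sum f x j * y ^ j))"
  using row_sum_has_sum
  by (metis summable_on_iff_abs_summable_on_complex summable_on_imp_summable summable_on_def)

end

lemma powser_mult:
  fixes a b :: "nat \<Rightarrow> complex"
  assumes "summable (\<lambda>n. norm (a n * x ^ n))" "summable (\<lambda>n. norm (b n * x ^ n))"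
  shows "(\<Sum>n. a n * x ^ n) * (\<Sum>n. b n * x ^ n) = (\<Sum>n. (\<Sum>k\<le>n. a k * b (n - k)) * x ^ n)"
proof -
  have "(\<Sum>k\<le>n. a k * x ^ k * (b (n - k) * x ^ (n - k))) = (\<Sum>k\<le>n. a k * b (n - k)) * x ^ n" for n
    unfolding sum_distrib_right by (intro sum.cong) (auto simp: mult_ac simp flip: power_add)
  then show ?thesis using Cauchy_product[OF assms] by simp
qed

lemma row_sum_mult:
  assumes "converges_on f r" "converges_on g r" "norm x \<le> r"
  shows "row_sum (f * g) x j = (\<Sum>k\<le>j. row_sum f x k * row_sum g x (j - k))"
proof -
  note sf = row_summable[OF assms(1) assms(3) assms(3)] and sg = row_summable[OF assms(2) assms(3) assms(3)]
  have "(\<Sum>k\<le>j. row_sum f x k * row_sum g x (j - k)) =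
      (\<Sum>k\<le>j. \<Sum>n. (\<Sum>l\<le>n. coeff2 f l k * coeff2 g (n - l) (j - k)) * x ^ n)"
    unfolding row_sum_def by (intro sum.cong refl powser_mult sf sg)
  also have "\<dots> = (\<Sum>n. \<Sum>k\<le>j. (\<Sum>l\<le>n. coeff2 f l k * coeff2 g (n - l) (j - k)) * x ^ n)"
  proof (rule suminf_sum[symmetric])
    fix k
    have eq: "(\<Sum>l\<le>n. coeff2 f l k * x ^ l * (coeff2 g (n - l) (j - k) * x ^ (n - l))) =
        (\<Sum>l\<le>n. coeff2 f l k * coeff2 g (n - l) (j - k)) * x ^ n" for n
      unfolding sum_distrib_right by (intro sum.cong) (auto simp: mult_ac simp flip: power_add)
    then show "summable (\<lambda>n. (\<Sum>l\<le>n. coeff2 f l k * coeff2 g (n - l) (j - k)) * x ^ n)"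
      using summable_Cauchy_product[OF sf[of k] sg[of "j - k"]] by (subst (asm) eq)
  qed
  also have "\<dots> = row_sum (f * g) x j"
    unfolding row_sum_def coeff2_mult
    by (intro suminf_cong) (subst sum.swap, simp add: sum_distrib_right)
  finally show ?thesis ..
qed

text \<open>An identity of germs: where a series does not converge absolutely, \<open>infsum\<close>
  has the default value 0.\<close>

lemma eval2_mult: "\<forall>\<^sub>F z in nhds 0. eval2 (f * g) z = eval2 f z * eval2 g z"
proof -
  have "\<forall>\<^sub>F r in at_right 0. converges_on f r \<and> converges_on g r \<and> converges_on (f * g) r"
    by (intro eventually_conj eventually_converges_on)
  then obtain r where r: "r > 0" "converges_on f r" "converges_on g r" "converges_on (f * g) r"
    using eventually_at_right_0_obtain by blast
  show ?thesis
  proof (rule eventually_nhds_prodI[OF r(1)])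
    fix x y :: complex assume "norm x < r" "norm y < r"
    then have xy: "norm x \<le> r" "norm y \<le> r" by auto
    show "eval2 (f * g) (x, y) = eval2 f (x, y) * eval2 g (x, y)"
      using row_sum_sums[OF r(2) xy] row_sum_sums[OF r(3) xy] row_sum_sums[OF r(4) xy]
        powser_mult[OF row_sum_summable_norm[OF r(2) xy] row_sum_summable_norm[OF r(3) xy]]
      by (simp add: sums_iff row_sum_mult[OF r(2,3) xy(1)])
  qed
qed

lemma eval2_add: "\<forall>\<^sub>F z in nhds 0. eval2 (f + g) z = eval2 f z + eval2 g z"
proof -
  have "\<forall>\<^sub>F r in at_right 0. converges_on f r \<and> converges_on g r"
    by (intro eventually_conj eventually_converges_on)
  then obtain r where r: "r > 0" "converges_on f r" "converges_on g r"
    using eventually_at_right_0_obtain by blast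
  show ?thesis
  proof (rule eventually_nhds_prodI[OF r(1)])
    fix x y :: complex assume "norm x < r" "norm y < r"
    then have xy: "norm x \<le> r" "norm y \<le> r" by auto
    show "eval2 (f + g) (x, y) = eval2 f (x, y) + eval2 g (x, y)"
      using infsum_add[OF eval2_summable[OF r(2) xy] eval2_summable[OF r(3) xy]]
      by (simp add: eval2_def case_prod_unfold algebra_simps)
  qed
qed

lemma eval2_uminus: "eval2 (- f) z = - eval2 f z"
  by (simp add: eval2_def case_prod_unfold flip: infsum_uminus)

lemma eval2_diff: "\<forall>\<^sub>F z in nhds 0. eval2 (f - g) z = eval2 f z - eval2 g z"
  using eval2_add[of f "- g"] by (simp add: eval2_uminus)

lemma eval2_0 [simp]: "eval2 0 z = 0"
  by (simp add: eval2_def case_prod_unfold)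

lemma eval2_at_0 [simp]: "eval2 f 0 = coeff2 f 0 0"
proof -
  have "eval2 f 0 = (\<Sum>\<^sub>\<infinity>p\<in>UNIV. if p = (0 :: nat, 0 :: nat) then coeff2 f 0 0 else 0)"
    unfolding eval2_def by (intro infsum_cong) (auto split: prod.split)
  also have "\<dots> = (\<Sum>\<^sub>\<infinity>p\<in>{(0 :: nat, 0 :: nat)}. coeff2 f 0 0)"
    by (rule infsum_cong_neutral) auto
  finally show ?thesis by simp
qed

section \<open>Differentiability, continuity and the identity theorem for evaluation\<close>

lemma eval2_deriv_Y:
  "\<exists>r>0. \<forall>x y. norm x < r \<longrightarrow> norm y < r \<longrightarrow>
     ((\<lambda>y. eval2 f (x, y)) has_field_derivative eval2 (deriv_Y f) (x, y)) (at y)"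
proof -
  have "\<forall>\<^sub>F r in at_right 0. converges_on f r \<and> converges_on (deriv_Y f) r"
    by (intro eventually_conj eventually_converges_on)
  then obtain r where r: "r > 0" "converges_on f r" "converges_on (deriv_Y f) r"
    using eventually_at_right_0_obtain by blast
  show ?thesis
  proof (intro exI[of _ r] conjI allI impI r(1))
    fix x y :: complex assume x: "norm x < r" and y: "norm y < r"
    have s: "(\<lambda>j. row_sum f x j * w ^ j) sums eval2 f (x, w)" if "norm w < r" for w
      using row_sum_sums[OF r(2)] x that by simp
    have "((\<lambda>w. \<Sum>j. row_sum f x j * w ^ j) has_field_derivative (\<Sum>j. diffs (row_sum f x) j * y ^ j)) (at y)"
      by (rule termdiffs_strong'[OF _ y]) (use s in \<open>auto simp: sums_iff\<close>)
    moreover have "diffs (row_sum f x) j = row_sum (deriv_Y f) x j" for j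
      using suminf_mult[OF summable_norm_cancel[OF row_summable[OF r(2)]], of x y "of_nat (Suc j)" "Suc j"] x y
      by (simp add: diffs_def row_sum_def coeff2_deriv_Y mult.assoc)
    moreover have "(\<Sum>j. row_sum (deriv_Y f) x j * y ^ j) = eval2 (deriv_Y f) (x, y)"
      using row_sum_sums[OF r(3), of x y] x y by (simp add: sums_iff)
    ultimately have "((\<lambda>w. \<Sum>j. row_sum f x j * w ^ j) has_field_derivative eval2 (deriv_Y f) (x, y)) (at y)"
      by simp
    then show "((\<lambda>y. eval2 f (x, y)) has_field_derivative eval2 (deriv_Y f) (x, y)) (at y)"
    proof (rule DERIV_cong_ev[THEN iffD1, rotated -1])
      have "\<forall>\<^sub>F w in nhds y. w \<in> ball 0 r" using y by (intro eventually_nhds_in_open) auto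
      then show "\<forall>\<^sub>F w in nhds y. (\<Sum>j. row_sum f x j * w ^ j) = eval2 f (x, w)"
        by eventually_elim (use s in \<open>auto simp: sums_iff\<close>)
    qed auto
  qed
qed

text \<open>Exchanging the variables lets the X-derivative follow from the Y-derivative.\<close>

lemma exists_transpose: "\<exists>g. \<forall>i j. coeff2 g i j = coeff2 f j i"
proof -
  obtain C R where CR: "C \<ge> 0" "R > 0" "\<And>i j. norm (coeff2 f i j) \<le> C * R ^ (i + j)"
    using coeff2_bound by blast
  have "norm (coeff2 f j i) \<le> C * R ^ (i + j)" for i j using CR(3)[of j i] by (simp only: add.commute)
  from exists_cps2[OF CR(1,2) this] show ?thesis .
qed

lemma eval2_transpose:
  assumes "\<And>i j. coeff2 g i j = coeff2 f j i"
  shows "eval2 g (y, x) = eval2 f (x, y)"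
proof -
  have "eval2 g (y, x) = (\<Sum>\<^sub>\<infinity>p\<in>UNIV. (\<lambda>(i, j). coeff2 f i j * x ^ i * y ^ j) (prod.swap p))"
    unfolding eval2_def by (intro infsum_cong) (auto simp: assms)
  also have "\<dots> = eval2 f (x, y)"
    unfolding eval2_def by (subst infsum_reindex_bij_betw) (auto simp: bij_swap)
  finally show ?thesis .
qed

lemma eval2_deriv_X:
  "\<exists>r>0. \<forall>x y. norm x < r \<longrightarrow> norm y < r \<longrightarrow>
     ((\<lambda>x. eval2 f (x, y)) has_field_derivative eval2 (deriv_X f) (x, y)) (at x)"
proof -
  obtain g where g: "\<And>i j. coeff2 g i j = coeff2 f j i" using exists_transpose by blast
  have d: "coeff2 (deriv_Y g) i j = coeff2 (deriv_X f) j i" for i j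
    by (simp add: coeff2_deriv_X coeff2_deriv_Y g)
  show ?thesis
    using eval2_deriv_Y[of g] unfolding eval2_transpose[of g f, OF g] eval2_transpose[of "deriv_Y g" "deriv_X f", OF d] by blast
qed

lemma eval2_continuous: "\<exists>r>0. continuous_on (cball 0 r \<times> cball 0 r) (eval2 f)"
proof -
  obtain r where r: "r > 0" "converges_on f r"
    using eventually_at_right_0_obtain[OF eventually_converges_on] by blast
  obtain C where C: "C \<ge> 0" "\<And>i j. norm (coeff2 f i j) * r ^ (i + j) \<le> C * (1/2) ^ (i + j)"
    using r(2) unfolding converges_on_def by blast
  have "uniform_limit (cball 0 r \<times> cball 0 r)
      (\<lambda>P z. \<Sum>p\<in>P. case p of (i, j) \<Rightarrow> coeff2 f i j * fst z ^ i * snd z ^ j)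
      (\<lambda>z. \<Sum>\<^sub>\<infinity>p\<in>UNIV. case p of (i, j) \<Rightarrow> coeff2 f i j * fst z ^ i * snd z ^ j) (finite_subsets_at_top UNIV)"
  proof (rule Weierstrass_m_test_general[where M = "\<lambda>(i, j). C * (1/2) ^ (i + j)"])
    fix p :: "nat \<times> nat" and z :: "complex \<times> complex"
    assume "z \<in> cball 0 r \<times> cball 0 r"
    then show "norm (case p of (i, j) \<Rightarrow> coeff2 f i j * fst z ^ i * snd z ^ j) \<le> (case p of (i, j) \<Rightarrow> C * (1/2) ^ (i + j))"
      using order_trans[OF monomial_le[OF r(2), of "fst z" "snd z"] C(2)] by (auto split: prod.split)
  qed (use geometric2_has_sum in \<open>auto simp: summable_on_def\<close>)
  then have "uniform_limit (cball 0 r \<times> cball 0 r)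
      (\<lambda>P z. \<Sum>p\<in>P. case p of (i, j) \<Rightarrow> coeff2 f i j * fst z ^ i * snd z ^ j) (eval2 f) (finite_subsets_at_top UNIV)"
    by (simp add: eval2_def[abs_def])
  then have "continuous_on (cball 0 r \<times> cball 0 r) (eval2 f)"
    by (rule uniform_limit_theorem[rotated])
       (auto intro!: always_eventually continuous_intros simp: case_prod_unfold)
  then show ?thesis using r(1) by blast
qed

lemma eval2_order_bound:
  assumes "\<And>i j. i + j < N \<Longrightarrow> coeff2 f i j = 0"
  shows "\<exists>C\<ge>0. \<forall>\<^sub>F z in nhds 0. norm (eval2 f z) \<le> C * norm z ^ N"
proof -
  obtain C R where CR: "C \<ge> 0" "R > 0" "\<And>i j. norm (coeff2 f i j) \<le> C * R ^ (i + j)"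
    using coeff2_bound by blast
  obtain r where r: "r > 0" "converges_on f r"
    using eventually_at_right_0_obtain[OF eventually_converges_on] by blast
  have "\<forall>\<^sub>F z in nhds (0 :: complex \<times> complex). dist z 0 < min r (1 / (2 * R))"
    using CR(2) r(1) by (intro eventually_nhds_metric[THEN iffD2]) (auto intro!: exI[of _ "min r (1 / (2 * R))"])
  then have "\<forall>\<^sub>F z in nhds 0. norm (eval2 f z) \<le> (4 * (C * (2 * R) ^ N)) * norm z ^ N"
  proof eventually_elim
    case (elim z)
    \<comment> \<open>As \<open>q \<le> 1\<close>, the power \<open>q ^ (i + j)\<close> may be
      lowered to \<open>q ^ N\<close> on the nonzero terms, while the remaining factors
      \<open>(1/2) ^ (i + j)\<close> make the sum converge.\<close>
    define q where "q = 2 * R * norm z"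
    have q: "0 \<le> q" "q \<le> 1" using elim CR(2) by (auto simp: q_def field_simps)
    have b: "norm (coeff2 f i j * fst z ^ i * snd z ^ j) \<le> (C * q ^ N) * (1/2) ^ (i + j)" for i j
    proof (cases "i + j < N")
      case True
      then show ?thesis using assms q CR by simp
    next
      case False
      have le: "norm (fst z) ^ i * norm (snd z) ^ j \<le> norm z ^ i * norm z ^ j"
        by (intro mult_mono power_mono) (use norm_fst_le[of "fst z" "snd z"] norm_snd_le[of "snd z" "fst z"] in auto)
      then have "norm (coeff2 f i j * fst z ^ i * snd z ^ j) \<le> (C * R ^ (i + j)) * norm z ^ (i + j)"
      proof -
        have "norm (coeff2 f i j) * (norm (fst z) ^ i * norm (snd z) ^ j)
            \<le> (C * R ^ (i + j)) * (norm z ^ i * norm z ^ j)"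
          by (rule mult_mono[OF CR(3) le]) (use CR(1,2) in auto)
        then show ?thesis by (simp only: norm_mult norm_power power_add mult.assoc)
      qed
      also have "\<dots> = C * (R * norm z) ^ (i + j)" by (simp only: power_mult_distrib mult.assoc)
      also have "R * norm z = q * (1/2)" by (simp add: q_def)
      also have "C * (q * (1/2)) ^ (i + j) = C * q ^ (i + j) * (1/2) ^ (i + j)" by (simp only: power_mult_distrib mult.assoc)
      also have "\<dots> \<le> C * q ^ N * (1/2) ^ (i + j)"
        using False q CR by (intro mult_left_mono mult_right_mono power_decreasing) auto
      finally show ?thesis .
    qed
    have b': "norm (case p of (i, j) \<Rightarrow> coeff2 f i j * fst z ^ i * snd z ^ j) \<le>
        (case p of (i, j) \<Rightarrow> (C * q ^ N) * (1/2) ^ (i + j))" for p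
      using b by (cases p) (simp only: prod.case)
    have s: "((\<lambda>(i, j). (C * q ^ N) * (1/2 :: real) ^ (i + j)) has_sum (4 * (C * q ^ N))) UNIV"
      by (rule geometric2_has_sum)
    have "norm (eval2 f z) \<le> 4 * (C * q ^ N)"
      unfolding eval2_def
    proof (rule norm_infsum_le)
      show "((\<lambda>(i, j). (C * q ^ N) * (1/2 :: real) ^ (i + j)) has_sum (4 * (C * q ^ N))) UNIV" by (rule s)
      have "norm (fst z) \<le> r" "norm (snd z) \<le> r"
        using elim norm_fst_le[of "fst z" "snd z"] norm_snd_le[of "snd z" "fst z"] by simp_all
      from eval2_summable[OF r(2) this]
      show "((\<lambda>(i, j). coeff2 f i j * fst z ^ i * snd z ^ j) has_sum
          (\<Sum>\<^sub>\<infinity>(i, j). coeff2 f i j * fst z ^ i * snd z ^ j)) UNIV"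
        by (rule has_sum_infsum)
    next
      show "norm (case p of (i, j) \<Rightarrow> coeff2 f i j * fst z ^ i * snd z ^ j) \<le>
        (case p of (i, j) \<Rightarrow> (C * q ^ N) * (1/2) ^ (i + j))" for p using b'[of p] .
    qed
    then show ?case by (simp add: q_def power_mult_distrib mult_ac)
  qed
  then show ?thesis using CR by (intro exI[of _ "4 * (C * (2 * R) ^ N)"]) auto
qed

lemma powser_0_imp_coeff_0:
  fixes a :: "nat \<Rightarrow> complex"
  assumes "r > 0" "\<And>w. norm w < r \<Longrightarrow> (\<lambda>n. a n * w ^ n) sums 0"
  shows "a n = 0"
proof -
  have "fps_conv_radius (Abs_fps a) \<ge> r"
    unfolding fps_conv_radius_def
    using assms by (intro conv_radius_geI_ex') (auto simp: sums_iff)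
  then have "fps_conv_radius (Abs_fps a) > 0" using assms(1) by (metis ereal_less(2) order.strict_trans2)
  moreover have "\<forall>\<^sub>F w in nhds 0. eval_fps (Abs_fps a) w = 0"
  proof -
    have "\<forall>\<^sub>F w in nhds (0::complex). w \<in> ball 0 r" using assms(1) by (intro eventually_nhds_in_open) auto
    then show ?thesis by eventually_elim (use assms(2) in \<open>auto simp: eval_fps_def sums_iff\<close>)
  qed
  ultimately have "(\<lambda>_. 0) has_fps_expansion Abs_fps a" unfolding has_fps_expansion_def by blast
  then have "Abs_fps a = 0" using fps_expansion_unique_complex has_fps_expansion_0 by blast
  then show ?thesis by (metis fps_nth_Abs_fps fps_zero_nth)
qed

text \<open>The identity theorem used twice: in y for fixed x it makes all row sums vanish, then in
  x all coefficients. This turns identities of functions near 0 into identities in the ring.\<close>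

lemma eval2_eq_0_imp:
  assumes "\<forall>\<^sub>F z in nhds 0. eval2 f z = 0"
  shows "f = 0"
proof -
  obtain r1 where r1: "r1 > 0" "\<And>x y. norm x < r1 \<Longrightarrow> norm y < r1 \<Longrightarrow> eval2 f (x, y) = 0"
    using eventually_nhds_prodD[OF assms] by blast
  obtain r2 where r2: "r2 > 0" "converges_on f r2"
    using eventually_at_right_0_obtain[OF eventually_converges_on] by blast
  define r where "r = min r1 r2"
  have r: "r > 0" "converges_on f r" using r1 r2 by (auto simp: r_def intro: converges_on_mono)
  have "row_sum f x j = 0" if "norm x < r" for x j
  proof (rule powser_0_imp_coeff_0[OF r(1)])
    fix w :: complex assume "norm w < r"
    then show "(\<lambda>j. row_sum f x j * w ^ j) sums 0"
      using row_sum_sums[OF r(2), of x w] r1(2)[of x w] that by (simp add: r_def)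
  qed
  then have "(\<lambda>i. coeff2 f i j * x ^ i) sums 0" if "norm x < r" for x j
    using summable_norm_cancel[OF row_summable[OF r(2), of x 0 j]] that r(1)
    by (simp add: row_sum_def sums_iff)
  then have "coeff2 f i j = 0" for i j
    using powser_0_imp_coeff_0[OF r(1), of "\<lambda>i. coeff2 f i j"] by blast
  then show ?thesis by (intro cps2_eqI) simp
qed

lemma eval2_eq_imp:
  assumes "\<forall>\<^sub>F z in nhds 0. eval2 f z = eval2 g z"
  shows "f = g"
proof -
  have "\<forall>\<^sub>F z in nhds 0. eval2 (f - g) z = 0" using assms eval2_diff[of f g] by eventually_elim simp
  then show ?thesis using eval2_eq_0_imp[of "f - g"] by simp
qed

lemma eval2_continuous_at_0: "isCont (eval2 f) 0"
proof -
  obtain r where r: "r > 0" "continuous_on (cball 0 r \<times> cball 0 r) (eval2 f)"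
    using eval2_continuous by blast
  have "continuous_on (ball 0 r \<times> ball 0 r) (eval2 f)"
    by (rule continuous_on_subset[OF r(2)]) auto
  moreover have "open (ball (0::complex) r \<times> ball (0::complex) r)" by (intro open_Times) auto
  ultimately show ?thesis using r(1) by (auto simp: continuous_on_eq_continuous_at zero_prod_def)
qed

text \<open>Total differentiability from the X-derivative at the point and a Y-derivative that is
  continuous nearby.\<close>

lemma eval2_has_derivative:
  "\<exists>r>0. \<forall>x y. norm x < r \<longrightarrow> norm y < r \<longrightarrow>
     (eval2 f has_derivative (\<lambda>(h, k). eval2 (deriv_X f) (x, y) * h + eval2 (deriv_Y f) (x, y) * k)) (at (x, y))"
proof -
  obtain r1 where r1: "r1 > 0" "\<And>x y. norm x < r1 \<Longrightarrow> norm y < r1 \<Longrightarrow>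
     ((\<lambda>x. eval2 f (x, y)) has_field_derivative eval2 (deriv_X f) (x, y)) (at x)"
    using eval2_deriv_X by blast
  obtain r2 where r2: "r2 > 0" "\<And>x y. norm x < r2 \<Longrightarrow> norm y < r2 \<Longrightarrow>
     ((\<lambda>y. eval2 f (x, y)) has_field_derivative eval2 (deriv_Y f) (x, y)) (at y)"
    using eval2_deriv_Y by blast
  obtain r3 where r3: "r3 > 0" "continuous_on (cball 0 r3 \<times> cball 0 r3) (eval2 (deriv_Y f))"
    using eval2_continuous by blast
  define r where "r = min r1 (min r2 r3)"
  have r: "r > 0" "r \<le> r1" "r \<le> r2" "r \<le> r3" using r1 r2 r3 by (auto simp: r_def)
  show ?thesis
  proof (intro exI[of _ r] conjI allI impI r(1))
    fix x y :: complex assume xy: "norm x < r" "norm y < r"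
    let ?B = "ball (0 :: complex) r"
    have D: "((\<lambda>(x, y). eval2 f (x, y)) has_derivative
        (\<lambda>(h, k). eval2 (deriv_X f) (x, y) * h + blinfun_apply (blinfun_mult_right (eval2 (deriv_Y f) (x, y))) k))
        (at (x, y) within ?B \<times> ?B)"
    proof (rule has_derivative_partialsI)
      show "((\<lambda>x. eval2 f (x, y)) has_derivative (*) (eval2 (deriv_X f) (x, y))) (at x within ?B)"
        using r1(2)[of x y] xy r has_derivative_at_withinI by (auto simp: has_field_derivative_def)
      show "((\<lambda>y. eval2 f (u, y)) has_derivative blinfun_apply (blinfun_mult_right (eval2 (deriv_Y f) (u, v)))) (at v within ?B)"
        if "u \<in> ?B" "v \<in> ?B" for u v
        using r2(2)[of u v] that r has_derivative_at_withinI by (auto simp: has_field_derivative_def)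
      have "continuous_on (?B \<times> ?B) (\<lambda>z. blinfun_mult_right (eval2 (deriv_Y f) z))"
        by (rule bounded_linear.continuous_on[OF bounded_linear_blinfun_mult_right continuous_on_subset[OF r3(2)]])
           (use r in auto)
      then show "continuous (at (x, y) within ?B \<times> ?B) (\<lambda>(x, y). blinfun_mult_right (eval2 (deriv_Y f) (x, y)))"
        using xy by (auto simp: continuous_on_eq_continuous_within case_prod_unfold)
    qed (use xy in auto)
    have "open (?B \<times> ?B)" "(x, y) \<in> ?B \<times> ?B" using xy by (auto intro: open_Times)
    then have w: "at (x, y) within ?B \<times> ?B = at (x, y)" by (rule at_within_open[rotated])
    show "(eval2 f has_derivative
        (\<lambda>(h, k). eval2 (deriv_X f) (x, y) * h + eval2 (deriv_Y f) (x, y) * k)) (at (x, y))"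
      using D unfolding w blinfun_mult_right.rep_eq case_prod_eta .
  qed
qed

lemma eval2_chain:
  "\<exists>r>0. \<forall>a b a' b' t. norm (a t) < r \<longrightarrow> norm (b t) < r \<longrightarrow>
     (a has_field_derivative a') (at t) \<longrightarrow> (b has_field_derivative b') (at t) \<longrightarrow>
     ((\<lambda>t. eval2 f (a t, b t)) has_field_derivative
        eval2 (deriv_X f) (a t, b t) * a' + eval2 (deriv_Y f) (a t, b t) * b') (at t)"
proof -
  obtain r where r: "r > 0" "\<And>x y. norm x < r \<Longrightarrow> norm y < r \<Longrightarrow>
     (eval2 f has_derivative (\<lambda>(h, k). eval2 (deriv_X f) (x, y) * h + eval2 (deriv_Y f) (x, y) * k)) (at (x, y))"
    using eval2_has_derivative by blast
  show ?thesis
  proof (intro exI[of _ r] conjI allI impI r(1))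
    fix a b :: "complex \<Rightarrow> complex" and a' b' t
    assume s: "norm (a t) < r" "norm (b t) < r"
      and d: "(a has_field_derivative a') (at t)" "(b has_field_derivative b') (at t)"
    have "((\<lambda>t. (a t, b t)) has_derivative (\<lambda>h. (a' * h, b' * h))) (at t)"
      using d unfolding has_field_derivative_def by (rule has_derivative_Pair)
    from has_derivative_compose[OF this r(2)[OF s]]
    show "((\<lambda>t. eval2 f (a t, b t)) has_field_derivative
        eval2 (deriv_X f) (a t, b t) * a' + eval2 (deriv_Y f) (a t, b t) * b') (at t)"
      unfolding has_field_derivative_def
      by (rule has_derivative_eq_rhs) (auto simp: fun_eq_iff algebra_simps)
  qed
qed

section \<open>Analytic curves through the origin\<close>

lemma analytic_at_0D:
  fixes a :: "complex \<Rightarrow> complex"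
  assumes "a analytic_on {0}"
  shows "isCont a 0" "\<forall>\<^sub>F t in nhds 0. (a has_field_derivative deriv a t) (at t)"
proof -
  obtain S where S: "open S" "0 \<in> S" "a holomorphic_on S" using assms analytic_at by blast
  show "isCont a 0" using S holomorphic_on_imp_continuous_on continuous_on_eq_continuous_at by blast
  have "\<forall>\<^sub>F t in nhds 0. t \<in> S" using S by (intro eventually_nhds_in_open) auto
  then show "\<forall>\<^sub>F t in nhds 0. (a has_field_derivative deriv a t) (at t)"
    by eventually_elim (use S holomorphic_derivI in blast)
qed

lemma analytic_at_0I:
  fixes h :: "complex \<Rightarrow> complex"
  assumes "\<forall>\<^sub>F t in nhds 0. (h has_field_derivative h' t) (at t)"
  shows "h analytic_on {0}"
proof -
  obtain S where S: "open S" "0 \<in> S" "\<forall>t\<in>S. (h has_field_derivative h' t) (at t)"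
    using assms unfolding eventually_nhds by blast
  then have "h holomorphic_on S" by (metis holomorphic_on_open)
  with S show ?thesis using analytic_at by blast
qed

lemma isCont_tendsto_nhds: "isCont f a \<Longrightarrow> (f \<longlongrightarrow> f a) (nhds a)"
  by (simp add: isCont_def tendsto_at_iff_tendsto_nhds)

lemma eventually_small:
  fixes a :: "complex \<Rightarrow> 'a :: real_normed_vector"
  assumes "isCont a 0" "a 0 = 0" "r > 0"
  shows "\<forall>\<^sub>F t in nhds 0. norm (a t) < r"
proof -
  have "((\<lambda>t. norm (a t)) \<longlongrightarrow> 0) (nhds 0)"
    using assms(1,2) by (metis isCont_def tendsto_at_iff_tendsto_nhds tendsto_norm_zero)
  then show ?thesis using assms(3) by (rule order_tendstoD)
qed

lemma filterlim_curve:
  fixes a b :: "complex \<Rightarrow> complex"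
  assumes "isCont a 0" "a 0 = 0" "isCont b 0" "b 0 = 0"
  shows "filterlim (\<lambda>t. (a t, b t)) (nhds 0) (nhds 0)"
proof -
  have "(a \<longlongrightarrow> 0) (nhds 0)" "(b \<longlongrightarrow> 0) (nhds 0)"
    using assms isCont_tendsto_nhds by metis+
  then have "((\<lambda>t. (a t, b t)) \<longlongrightarrow> (0, 0)) (nhds 0)" by (rule tendsto_Pair)
  then show ?thesis by (simp add: zero_prod_def)
qed

lemma eventually_curve:
  fixes a b :: "complex \<Rightarrow> complex"
  assumes "\<forall>\<^sub>F z in nhds 0. P z" "isCont a 0" "a 0 = 0" "isCont b 0" "b 0 = 0"
  shows "\<forall>\<^sub>F t in nhds 0. P (a t, b t)"
  using eventually_compose_filterlim[OF assms(1) filterlim_curve[OF assms(2-5)]] .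

lemma eval2_curve_analytic:
  assumes a: "a analytic_on {0}" "a 0 = 0" and b: "b analytic_on {0}" "b 0 = 0"
  shows "(\<lambda>t. eval2 f (a t, b t)) analytic_on {0}"
    "\<forall>\<^sub>F t in nhds 0. ((\<lambda>t. eval2 f (a t, b t)) has_field_derivative
       eval2 (deriv_X f) (a t, b t) * deriv a t + eval2 (deriv_Y f) (a t, b t) * deriv b t) (at t)"
proof -
  obtain r where r: "r > 0" "\<And>a b a' b' t. norm (a t) < r \<Longrightarrow> norm (b t) < r \<Longrightarrow>
     (a has_field_derivative a') (at t) \<Longrightarrow> (b has_field_derivative b') (at t) \<Longrightarrow>
     ((\<lambda>t. eval2 f (a t, b t)) has_field_derivative
        eval2 (deriv_X f) (a t, b t) * a' + eval2 (deriv_Y f) (a t, b t) * b') (at t)"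
    using eval2_chain[of f] by blast
  show *: "\<forall>\<^sub>F t in nhds 0. ((\<lambda>t. eval2 f (a t, b t)) has_field_derivative
       eval2 (deriv_X f) (a t, b t) * deriv a t + eval2 (deriv_Y f) (a t, b t) * deriv b t) (at t)"
    using eventually_small[OF analytic_at_0D(1)[OF a(1)] a(2) r(1)]
      eventually_small[OF analytic_at_0D(1)[OF b(1)] b(2) r(1)]
      analytic_at_0D(2)[OF a(1)] analytic_at_0D(2)[OF b(1)]
    by eventually_elim (rule r(2))
  then show "(\<lambda>t. eval2 f (a t, b t)) analytic_on {0}" by (rule analytic_at_0I)
qed

section \<open>Evaluation of series in X and of polynomials over them\<close>

definition eval1 :: "cps1 \<Rightarrow> complex \<Rightarrow> complex" where
  "eval1 a = eval_fps (fps_of_cps1 a)"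

lemma eval1_has_fps_expansion: "eval1 a has_fps_expansion fps_of_cps1 a"
  using fps_of_cps1[of a] unfolding eval1_def by (intro eval_fps_has_fps_expansion) simp

lemma eval1_analytic: "eval1 a analytic_on {0}"
  by (rule has_fps_expansion_imp_analytic_0[OF eval1_has_fps_expansion])

lemma eval1_isCont [simp]: "isCont (eval1 a) 0"
  by (rule analytic_at_0D(1)[OF eval1_analytic])

lemma eval1_at_0 [simp]: "eval1 a 0 = coeff1 a 0"
  by (simp add: eval1_def eval_fps_at_0 coeff1.rep_eq)

lemma eval1_suminf: "eval1 a x = (\<Sum>i. coeff1 a i * x ^ i)"
  by (simp add: eval1_def eval_fps_def coeff1.rep_eq)

lemma eval1_simps [simp]:
  "eval1 0 x = 0" "eval1 1 x = 1" "eval1 (const1 c) x = c" "eval1 var1 x = x"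
  by (simp_all add: eval1_def zero_cps1.rep_eq one_cps1.rep_eq const1.rep_eq var1.rep_eq)

lemma has_fps_expansion_unique_ev:
  fixes f g :: "complex \<Rightarrow> complex"
  assumes "f has_fps_expansion F" "g has_fps_expansion F"
  shows "\<forall>\<^sub>F x in nhds 0. f x = g x"
  using assms unfolding has_fps_expansion_def by (auto elim: eventually_elim2)

lemma eval1_add: "\<forall>\<^sub>F x in nhds 0. eval1 (a + b) x = eval1 a x + eval1 b x"
  by (rule has_fps_expansion_unique_ev[OF eval1_has_fps_expansion])
     (simp add: plus_cps1.rep_eq, intro has_fps_expansion_add eval1_has_fps_expansion)

lemma eval1_mult: "\<forall>\<^sub>F x in nhds 0. eval1 (a * b) x = eval1 a x * eval1 b x"
  by (rule has_fps_expansion_unique_ev[OF eval1_has_fps_expansion])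
     (simp add: times_cps1.rep_eq, intro has_fps_expansion_mult eval1_has_fps_expansion)

lemma eval1_eq_0_imp:
  assumes "\<forall>\<^sub>F x in nhds 0. eval1 a x = 0"
  shows "a = 0"
proof -
  have "(\<lambda>_. 0) has_fps_expansion fps_of_cps1 a"
    using eval1_has_fps_expansion[of a] assms by (subst (asm) has_fps_expansion_cong[OF _ refl]) auto
  then have "fps_of_cps1 a = 0" using fps_expansion_unique_complex has_fps_expansion_0 by blast
  then show ?thesis by (metis fps_of_cps1_inject zero_cps1.rep_eq)
qed

lemma eval1_ram:
  assumes "m > 0"
  shows "\<forall>\<^sub>F x in nhds 0. eval1 (ram m a) x = eval1 a (x ^ m)"
proof -
  have "(eval1 a \<circ> (\<lambda>x. x ^ m)) has_fps_expansion (fps_of_cps1 a oo fps_X ^ m)"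
    using assms by (intro has_fps_expansion_compose eval1_has_fps_expansion fps_expansion_intros) auto
  moreover have "fps_of_cps1 a oo fps_X ^ m = fps_of_cps1 (ram m a)"
    using assms by (auto simp: fps_eq_iff ram.rep_eq fps_nth_compose_X_power)
  ultimately have "(\<lambda>x. eval1 a (x ^ m)) has_fps_expansion fps_of_cps1 (ram m a)" by (simp add: o_def)
  from has_fps_expansion_unique_ev[OF eval1_has_fps_expansion this] show ?thesis .
qed

lemma eval2_emb:
  "\<forall>\<^sub>F z in nhds 0. eval2 (emb p) z = (\<Sum>j\<le>degree p. eval1 (coeff p j) (fst z) * snd z ^ j)"
proof -
  obtain r where r: "r > 0" "converges_on (emb p) r"
    using eventually_at_right_0_obtain[OF eventually_converges_on] by blast
  show ?thesis
  proof (rule eventually_nhds_prodI[OF r(1)])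
    fix x y :: complex assume xy: "norm x < r" "norm y < r"
    have rs: "row_sum (emb p) x j = eval1 (coeff p j) x" for j
      by (simp add: row_sum_def eval1_suminf)
    have "(\<lambda>j. row_sum (emb p) x j * y ^ j) sums (\<Sum>j\<le>degree p. row_sum (emb p) x j * y ^ j)"
      by (rule sums_finite) (auto simp: rs coeff_eq_0)
    moreover have "(\<lambda>j. row_sum (emb p) x j * y ^ j) sums eval2 (emb p) (x, y)"
      using row_sum_sums[OF r(2)] xy by simp
    ultimately show "eval2 (emb p) (x, y) = (\<Sum>j\<le>degree p. eval1 (coeff p j) (fst (x, y)) * snd (x, y) ^ j)"
      by (simp add: sums_iff rs)
  qed
qed

lemma eval2_emb_linear: "\<forall>\<^sub>F z in nhds 0. eval2 (emb [:a, 1:]) z = eval1 a (fst z) + snd z"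
  and eval2_emb_const: "\<forall>\<^sub>F z in nhds 0. eval2 (emb [:a:]) z = eval1 a (fst z)"
  using eval2_emb[of "[:a, 1:]"] eval2_emb[of "[:a:]"] by simp_all

lemma eval2_emb_root: "\<forall>\<^sub>F z in nhds 0. eval2 (emb [:- a, 1:]) z = snd z - eval1 a (fst z)"
proof -
  have e: "emb [:- a, 1:] = emb [:0, 1:] - emb [:a:]" by (simp flip: emb_simps)
  show ?thesis
    using eval2_emb_linear[of 0] eval2_emb_const[of a] eval2_diff[of "emb [:0, 1:]" "emb [:a:]"]
    unfolding e by eventually_elim simp
qed

lemma eval2_root_prod:
  "\<forall>\<^sub>F z in nhds 0. eval2 (emb (root_prod ys)) z = (\<Prod>i<length ys. snd z - eval1 (ys ! i) (fst z))"
proof (induction ys)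
  case Nil
  then show ?case using eval2_emb_const[of 1] by (simp add: one_pCons)
next
  case (Cons y ys)
  have e: "emb (root_prod (y # ys)) = emb [:- y, 1:] * emb (root_prod ys)"
    by (simp only: root_prod_simps emb_simps)
  show ?case
    using Cons eval2_emb_root[of y] eval2_mult[of "emb [:- y, 1:]" "emb (root_prod ys)"] unfolding e
    by eventually_elim (simp add: prod.lessThan_Suc_shift del: prod.lessThan_Suc)
qed

lemma fst_tendsto: "filterlim fst (nhds (0 :: complex)) (nhds (0 :: complex \<times> complex))"
  using isCont_tendsto_nhds[of "0 :: complex \<times> complex" fst] by (simp add: continuous_fst)

lemma power_fst_tendsto:
  assumes "m > 0"
  shows "filterlim (\<lambda>z :: complex \<times> complex. (fst z ^ m, snd z)) (nhds 0) (nhds 0)"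
proof -
  have "isCont (\<lambda>z :: complex \<times> complex. (fst z ^ m, snd z)) 0" by (intro continuous_intros)
  from isCont_tendsto_nhds[OF this] show ?thesis using assms by (simp add: zero_prod_def zero_power)
qed

lemma eval2_puiseux_curve:
  assumes "m > 0"
  shows "\<forall>\<^sub>F z in nhds 0. eval2 (emb P) (fst z ^ m, snd z) = eval2 (emb (ramp m P)) z"
proof -
  note lim = power_fst_tendsto[OF assms]
  have "\<forall>\<^sub>F x in nhds 0. \<forall>j\<le>degree P. eval1 (ram m (coeff P j)) x = eval1 (coeff P j) (x ^ m)"
    using eval1_ram[OF assms] by (simp add: eventually_ball_finite_distrib flip: atMost_iff Ball_def)
  then have E: "\<forall>\<^sub>F z in nhds (0 :: complex \<times> complex). \<forall>j\<le>degree P. eval1 (ram m (coeff P j)) (fst z) = eval1 (coeff P j) (fst z ^ m)"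
    using eventually_compose_filterlim[OF _ fst_tendsto] by blast
  have "degree (ramp m P) \<le> degree P" by (rule degree_le) (auto simp: coeff_eq_0)
  then have d: "(\<Sum>j\<le>degree (ramp m P). eval1 (coeff (ramp m P) j) x * y ^ j) =
      (\<Sum>j\<le>degree P. eval1 (coeff (ramp m P) j) x * y ^ j)" for x y
    by (intro sum.mono_neutral_left) (auto simp: coeff_eq_0 simp del: coeff_ramp)
  show ?thesis
    using eventually_compose_filterlim[OF eval2_emb[of P] lim] eval2_emb[of "ramp m P"] E
    by eventually_elim (simp add: d[unfolded coeff_ramp])
qed

section \<open>Reducedness and common roots\<close>

lemma deriv_Y_mult: "deriv_Y (f * g) = deriv_Y f * g + f * deriv_Y g"
  by transfer (simp add: fps_deriv_mult)

lemma deriv_Y_emb: "deriv_Y (emb p) = emb (pderiv p)"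
  by (rule cps2_eqI) (simp add: coeff2_deriv_Y coeff_pderiv coeff1_of_nat_mult del: of_nat_Suc)

lemma coeff2_mult_order:
  assumes "\<And>i j. i + j < N \<Longrightarrow> coeff2 f i j = 0" "coeff2 g 0 0 = 0" "i + j \<le> N"
  shows "coeff2 (f * g) i j = 0"
  unfolding coeff2_mult
proof (intro sum.neutral ballI)
  fix k l assume kl: "k \<in> {..i}" "l \<in> {..j}"
  show "coeff2 f k l * coeff2 g (i - k) (j - l) = 0"
  proof (cases "k = i \<and> l = j")
    case False
    with kl assms(3) have "k + l < N" by auto
    then show ?thesis using assms(1) by simp
  qed (use assms(2) in simp)
qed

lemma cps2_dvd_1_iff: "g dvd 1 \<longleftrightarrow> coeff2 g 0 0 \<noteq> 0" for g :: cps2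
proof
  assume "g dvd 1"
  then obtain h where "1 = g * h" by (rule dvdE)
  then have "coeff2 (g * h) 0 0 = 1" by (metis coeff2_simps(2))
  then show "coeff2 g 0 0 \<noteq> 0" by auto
qed (rule cps2_unit)

text \<open>If b has no constant term, the coefficients of a * b vanish up to and including the
  order of a. So the order drops when a product of non-units is replaced by a factor, and the
  splitting stops.\<close>

lemma cps2_irreducible_factor:
  assumes "g \<noteq> 0" "coeff2 g 0 0 = 0"
  shows "\<exists>p. irreducible p \<and> p dvd g"
proof -
  define o2 where "o2 g = (LEAST n. \<exists>i j. i + j = n \<and> coeff2 g i j \<noteq> 0)" for g
  have o2: "\<exists>i j. i + j = o2 h \<and> coeff2 h i j \<noteq> 0" if nz: "h \<noteq> 0" for h
  proof -
    have "\<exists>i j. coeff2 h i j \<noteq> 0" using nz cps2_eqI[of h 0] by auto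
    then have "\<exists>n i j. i + j = n \<and> coeff2 h i j \<noteq> 0" by blast
    then show ?thesis unfolding o2_def by (rule LeastI_ex)
  qed
  have o2_low: "coeff2 h i j = 0" if "i + j < o2 h" for h i j
    using not_less_Least that unfolding o2_def by blast
  show ?thesis using assms
  proof (induction "o2 g" arbitrary: g rule: less_induct)
    case less
    show ?case
    proof (cases "irreducible g")
      case False
      then obtain a b where ab: "g = a * b" "\<not> a dvd 1" "\<not> b dvd 1"
        using less.prems by (auto simp: irreducible_def cps2_dvd_1_iff)
      then have nz: "a \<noteq> 0" and c0: "coeff2 a 0 0 = 0" "coeff2 b 0 0 = 0"
        using less.prems by (auto simp: cps2_dvd_1_iff)
      have "coeff2 g i j = 0" if "i + j \<le> o2 a" for i j
        unfolding ab(1) using o2_low c0(2) that by (rule coeff2_mult_order)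
      then have "o2 a < o2 g" using o2[OF less.prems(1)] by (metis not_less)
      then obtain p where "irreducible p" "p dvd a" using less.hyps nz c0(1) by blast
      then show ?thesis using ab(1) by (meson dvd_mult2)
    qed auto
  qed
qed

section \<open>Restriction of polynomials to a Puiseux curve\<close>

context
  fixes m :: nat and \<gamma> :: cps1
  assumes m: "m > 0" and \<gamma>0: "coeff1 \<gamma> 0 = 0"
begin

lemma eventually_on_curve:
  assumes "\<forall>\<^sub>F z in nhds 0. P z"
  shows "\<forall>\<^sub>F t in nhds 0. P (t ^ m, eval1 \<gamma> t)"
  using m \<gamma>0 by (intro eventually_curve assms) (auto simp: zero_power)

text \<open>The value of p at X = t^m, Y = \<gamma>(t), taken algebraically: a ring homomorphism
  into the domain \<open>cps1\<close>, so its kernel is a prime ideal.\<close>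

definition on_curve :: "cps1 poly \<Rightarrow> cps1" where
  "on_curve p = poly (ramp m p) \<gamma>"

lemma on_curve_simps:
  "on_curve 0 = 0" "on_curve 1 = 1" "on_curve (p + q) = on_curve p + on_curve q"
  "on_curve (p * q) = on_curve p * on_curve q"
  "on_curve (pCons a p) = ram m a + \<gamma> * on_curve p"
  using m by (simp_all add: on_curve_def ramp_1 ramp_add ramp_mult ramp_pCons)

lemma eval1_on_curve:
  "\<forall>\<^sub>F t in nhds 0. eval1 (on_curve p) t = eval2 (emb p) (t ^ m, eval1 \<gamma> t)"
proof (induction p)
  case 0
  then show ?case by (simp add: on_curve_simps emb_simps)
next
  case (pCons a p)
  have pc: "pCons a p = [:a:] + [:0, 1:] * p" by simp
  have e: "emb (pCons a p) = emb [:a:] + emb [:0, 1:] * emb p"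
    unfolding emb_simps[symmetric] by (subst pc) (rule refl)
  show ?case
    using pCons.IH eval1_add[of "ram m a" "\<gamma> * on_curve p"] eval1_mult[of \<gamma> "on_curve p"] eval1_ram[OF m, of a]
      eventually_on_curve[OF eval2_add[of "emb [:a:]" "emb [:0, 1:] * emb p"]] eventually_on_curve[OF eval2_mult[of "emb [:0, 1:]" "emb p"]]
      eventually_on_curve[OF eval2_emb_linear[of 0]] eventually_on_curve[OF eval2_emb_const[of a]]
    unfolding e on_curve_simps
    by eventually_elim simp
qed

lemma on_curve_eq_0_iff:
  "on_curve p = 0 \<longleftrightarrow> (\<forall>\<^sub>F t in nhds 0. eval2 (emb p) (t ^ m, eval1 \<gamma> t) = 0)"
proof
  assume "on_curve p = 0"
  with eval1_on_curve[of p] show "\<forall>\<^sub>F t in nhds 0. eval2 (emb p) (t ^ m, eval1 \<gamma> t) = 0" by simp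
next
  assume "\<forall>\<^sub>F t in nhds 0. eval2 (emb p) (t ^ m, eval1 \<gamma> t) = 0"
  with eval1_on_curve[of p] have "\<forall>\<^sub>F t in nhds 0. eval1 (on_curve p) t = 0"
    by eventually_elim simp
  then show "on_curve p = 0" by (rule eval1_eq_0_imp)
qed

lemma ram_eq_0_iff: "ram m a = 0 \<longleftrightarrow> a = 0"
proof
  assume *: "ram m a = 0"
  have "coeff1 a i = 0" for i
    using arg_cong[OF *, of "\<lambda>b. coeff1 b (m * i)"] m by (simp add: coeff1_ram)
  then show "a = 0" by (intro cps1_eqI) simp
qed simp

text \<open>Dividing out the largest power of X leaves a coefficient that is nonzero at X = 0, which
  the preparation theorem requires.\<close>

lemma remove_X_content:
  fixes r :: "cps1 poly"
  assumes "r \<noteq> 0"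
  shows "\<exists>a r'. r = smult (var1 ^ a) r' \<and> (\<exists>j\<le>degree r. coeff1 (coeff r' j) 0 \<noteq> 0)"
proof -
  define a where "a = (LEAST i. \<exists>j. coeff1 (coeff r j) i \<noteq> 0)"
  have "\<exists>i j. coeff1 (coeff r j) i \<noteq> 0"
  proof (rule ccontr)
    assume "\<not> ?thesis"
    then have "r = 0" by (intro poly_eqI cps1_eqI) auto
    with assms show False by simp
  qed
  then have "\<exists>j. coeff1 (coeff r j) a \<noteq> 0" unfolding a_def by (rule LeastI_ex)
  then obtain l where l: "coeff1 (coeff r l) a \<noteq> 0" by blast
  have low: "coeff1 (coeff r j) i = 0" if "i < a" for i j
    using not_less_Least that unfolding a_def by blast
  have "\<exists>b. coeff r j = var1 ^ a * b \<and> coeff1 b 0 = coeff1 (coeff r j) a" for j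
    by (rule cps1_factor_var1) (rule low)
  then obtain b where b: "\<And>j. coeff r j = var1 ^ a * b j" "\<And>j. coeff1 (b j) 0 = coeff1 (coeff r j) a"
    by metis
  define r' where "r' = (\<Sum>j\<le>degree r. monom (b j) j)"
  have cr: "coeff r' j = (if j \<le> degree r then b j else 0)" for j
    by (auto simp: r'_def coeff_sum if_distrib[of "\<lambda>x. x = _"] cong: if_cong)
  have ld: "l \<le> degree r" using l by (metis coeff1_simps(1) coeff_eq_0 not_less)
  have "r = smult (var1 ^ a) r'"
    by (rule poly_eqI) (auto simp: cr b(1)[symmetric] coeff_eq_0)
  moreover have "coeff1 (coeff r' l) 0 \<noteq> 0" using l ld b(2) by (simp add: cr)
  ultimately show ?thesis using ld by blast
qed

text \<open>
  The polynomials vanishing on the curve form a prime ideal, generated by the monic one of least degree: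
  a nonzero remainder of smaller degree would, after removing a power of \<open>X\<close> and applying the
  preparation theorem, yield a monic element of smaller degree.
\<close>

lemma on_curve_kernel:
  assumes "lead_coeff P = 1" "on_curve P = 0"
  shows "\<exists>A. lead_coeff A = 1 \<and> on_curve A = 0 \<and> (\<forall>p. on_curve p = 0 \<longrightarrow> A dvd p)"
proof -
  define N where "N = (LEAST n. \<exists>A. degree A = n \<and> lead_coeff A = 1 \<and> on_curve A = 0)"
  have "\<exists>n A. degree A = n \<and> lead_coeff A = 1 \<and> on_curve A = 0" using assms by blast
  then have "\<exists>A. degree A = N \<and> lead_coeff A = 1 \<and> on_curve A = 0" unfolding N_def by (rule LeastI_ex)
  then obtain A where A: "degree A = N" "lead_coeff A = 1" "on_curve A = 0" by blast
  have least: "N \<le> degree W" if "lead_coeff W = 1" "on_curve W = 0" for W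
    unfolding N_def by (rule Least_le) (use that in blast)
  have "A dvd p" if p: "on_curve p = 0" for p
  proof -
    obtain q r where qr: "p = A * q + r" "r = 0 \<or> degree r < degree A"
      using monic_division[OF A(2)] by blast
    have r0: "on_curve r = 0" using p A(3) by (simp add: qr(1) on_curve_simps)
    have "r = 0"
    proof (rule ccontr)
      assume nz: "r \<noteq> 0"
      obtain a r' where r': "r = smult (var1 ^ a) r'" "\<exists>j\<le>degree r. coeff1 (coeff r' j) 0 \<noteq> 0"
        using remove_X_content[OF nz] by blast
      have "r = [:var1 ^ a:] * r'" using r'(1) by simp
      then have "ram m (var1 ^ a) * on_curve r' = 0" using r0 by (simp only: on_curve_simps) (simp add: on_curve_simps)
      moreover have "ram m (var1 ^ a) \<noteq> 0" using ram_eq_0_iff var1_power_neq_0 by blast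
      ultimately have or': "on_curve r' = 0" by (metis mult_eq_0_iff)
      define k where "k = (LEAST j. coeff1 (coeff r' j) 0 \<noteq> 0)"
      have k: "coeff1 (coeff r' k) 0 \<noteq> 0" "\<And>j. j < k \<Longrightarrow> coeff1 (coeff r' j) 0 = 0"
        using LeastI_ex[of "\<lambda>j. coeff1 (coeff r' j) 0 \<noteq> 0"] r'(2) not_less_Least unfolding k_def by blast+
      have "k \<le> degree r" using r'(2) unfolding k_def by (meson Least_le order_trans)
      with nz qr(2) A(1) have kN: "k < N" by auto
      obtain W u where W: "weierstrass_poly k W" "emb W = u * emb r'"
        using weierstrass_preparation[of k "emb r'"] k by auto
      have "\<forall>\<^sub>F t in nhds 0. eval2 (emb W) (t ^ m, eval1 \<gamma> t) = 0"
        using or'[unfolded on_curve_eq_0_iff] eventually_on_curve[OF eval2_mult[of u "emb r'"]]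
        unfolding W(2) by eventually_elim simp
      then have "on_curve W = 0" by (simp add: on_curve_eq_0_iff)
      then have "N \<le> degree W" using W(1) unfolding weierstrass_poly_def by (intro least) auto
      then show False using kN W(1) by (simp add: weierstrass_poly_def)
    qed
    then show ?thesis using qr(1) by simp
  qed
  with A show ?thesis by blast
qed

text \<open>Let A generate the ideal of the curve and P = A q. On the curve the derivative of P
  restricts to A' q. In characteristic 0, A' is nonzero of smaller degree than A, so it is not in
  the ideal; since the ideal is prime, q is, and A divides P twice.\<close>

theorem double_root_square_factor:
  assumes "lead_coeff P = 1" "on_curve P = 0" "on_curve (pderiv P) = 0"
  shows "\<exists>A. A ^ 2 dvd P \<and> emb A \<noteq> 0 \<and> coeff2 (emb A) 0 0 = 0"
proof -
  obtain A where A: "lead_coeff A = 1" "on_curve A = 0" and ker: "\<And>p. on_curve p = 0 \<Longrightarrow> A dvd p"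
    using on_curve_kernel[OF assms(1,2)] by blast
  have dA: "degree A > 0"
  proof (rule ccontr)
    assume "\<not> degree A > 0"
    then have "A = 1" using A(1) by (auto simp: one_pCons elim!: degree_eq_zeroE)
    with A(2) show False by (simp add: on_curve_simps)
  qed
  obtain q where q: "P = A * q" using ker[OF assms(2)] by (rule dvdE)
  have nA: "on_curve (pderiv A) \<noteq> 0"
  proof
    assume "on_curve (pderiv A) = 0"
    then have dv: "A dvd pderiv A" by (rule ker)
    have "of_nat (degree A) \<noteq> (0 :: cps1)"
    proof
      assume "of_nat (degree A) = (0 :: cps1)"
      from arg_cong[OF this, of "\<lambda>a. coeff1 a 0"] show False using dA by (simp add: of_nat_cps1)
    qed
    moreover have "coeff (pderiv A) (degree A - 1) = of_nat (degree A)"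
      using dA A(1) by (simp add: coeff_pderiv)
    ultimately have "pderiv A \<noteq> 0" by (metis coeff_0)
    from dvd_imp_degree_le[OF dv this] have "degree A \<le> degree (pderiv A)" .
    also have "\<dots> \<le> degree A - 1" by (rule degree_le) (auto simp: coeff_pderiv coeff_eq_0)
    finally show False using dA by simp
  qed
  have "on_curve (pderiv A) * on_curve q = 0"
    using assms(3) A(2) by (simp add: q pderiv_mult on_curve_simps mult.commute)
  with nA have "on_curve q = 0" by simp
  then have "A dvd q" by (rule ker)
  then have "A ^ 2 dvd P" unfolding q power2_eq_square by (rule mult_dvd_mono[OF dvd_refl])
  moreover have "A \<noteq> 0" using A(1) by auto
  then have "emb A \<noteq> 0" by (metis emb_eq_iff emb_simps(1))
  moreover have "coeff2 (emb A) 0 0 = 0"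
  proof -
    have "\<forall>\<^sub>F t in nhds 0. eval2 (emb A) (t ^ m, eval1 \<gamma> t) = 0" using A(2) by (simp add: on_curve_eq_0_iff)
    then have "eval2 (emb A) (0 ^ m, eval1 \<gamma> 0) = 0" by (rule eventually_nhds_x_imp_x)
    then have "eval2 (emb A) 0 = 0" using m \<gamma>0 by (simp add: zero_power zero_prod_def)
    then show ?thesis by simp
  qed
  ultimately show ?thesis by blast
qed

text \<open>The factor A is found in polynomials over series in X. As a nonzero non-unit of the
  two-variable ring it has an irreducible factor there, whose square divides F.\<close>

theorem reduced_no_double_root_poly:
  assumes red: "reduced2 F" and F: "F = V * emb P" and P: "lead_coeff P = 1"
    and 1: "on_curve P = 0" and 2: "on_curve (pderiv P) = 0"
  shows False
proof -
  obtain A where A: "A ^ 2 dvd P" "emb A \<noteq> 0" "coeff2 (emb A) 0 0 = 0"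
    using double_root_square_factor[OF P 1 2] by blast
  obtain p where p: "irreducible p" "p dvd emb A" using cps2_irreducible_factor[OF A(2,3)] by blast
  obtain B where B: "P = A ^ 2 * B" using A(1) by (rule dvdE)
  have "p ^ 2 dvd emb A ^ 2" using p(2) by (rule dvd_power_same)
  then have "p ^ 2 dvd F" unfolding F B by (simp add: emb_simps power2_eq_square dvd_mult dvd_mult2)
  then show False using red p(1) by (auto simp: reduced2_def)
qed

text \<open>P is a unit times F, and by the product rule P and its Y-derivative vanish wherever F
  and its Y-derivative both do.\<close>

theorem reduced_no_double_root:
  assumes red: "reduced2 F" and F: "F = V * emb P" and V: "coeff2 V 0 0 \<noteq> 0" and P: "lead_coeff P = 1"
    and z: "\<forall>\<^sub>F t in nhds 0. eval2 F (t ^ m, eval1 \<gamma> t) = 0"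
    and zY: "\<forall>\<^sub>F t in nhds 0. eval2 (deriv_Y F) (t ^ m, eval1 \<gamma> t) = 0"
  shows False
proof -
  obtain u where u: "1 = V * u" using cps2_unit[OF V] by (rule dvdE)
  have P1: "emb P = u * F" using u by (simp add: F mult.assoc[symmetric] mult.commute)
  have P2: "emb (pderiv P) = deriv_Y u * F + u * deriv_Y F"
    using arg_cong[OF P1, of deriv_Y] by (simp add: deriv_Y_emb deriv_Y_mult)
  have 1: "on_curve P = 0" unfolding on_curve_eq_0_iff P1
    using z eventually_on_curve[OF eval2_mult[of u F]] by eventually_elim simp
  have 2: "on_curve (pderiv P) = 0" unfolding on_curve_eq_0_iff P2
    using z zY eventually_on_curve[OF eval2_add[of "deriv_Y u * F" "u * deriv_Y F"]] eventually_on_curve[OF eval2_mult[of "deriv_Y u" F]]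
      eventually_on_curve[OF eval2_mult[of u "deriv_Y F"]] by eventually_elim simp
  from reduced_no_double_root_poly[OF red F P 1 2] show False .
qed

end

section \<open>Germs of analytic functions in one variable\<close>

lemma analytic_factor_at_0:
  fixes h :: "complex \<Rightarrow> complex"
  assumes "h analytic_on {0}"
  shows "(\<forall>\<^sub>F t in nhds 0. h t = 0) \<or>
    (\<exists>N g. g analytic_on {0} \<and> g 0 \<noteq> 0 \<and> (\<forall>\<^sub>F t in nhds 0. h t = t ^ N * g t))"
proof -
  define H where "H = fps_expansion h 0"
  have H: "h has_fps_expansion H" unfolding H_def using assms by (rule analytic_at_imp_has_fps_expansion_0)
  show ?thesis
  proof (cases "H = 0")
    case True
    then show ?thesis using has_fps_expansion_unique_ev[OF H, of "\<lambda>_. 0"] by simp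
  next
    case False
    define N where "N = subdegree H"
    define G where "G = fps_shift N H"
    have "fps_conv_radius G > 0" using H by (simp add: G_def has_fps_expansion_def)
    then have G: "eval_fps G has_fps_expansion G" by (rule eval_fps_has_fps_expansion)
    have HG: "H = fps_X ^ N * G" unfolding G_def N_def
      by (metis subdegree_decompose mult.commute)
    have "(\<lambda>t. t ^ N * eval_fps G t) has_fps_expansion H"
      unfolding HG by (intro has_fps_expansion_mult G fps_expansion_intros)
    then have "\<forall>\<^sub>F t in nhds 0. h t = t ^ N * eval_fps G t" by (rule has_fps_expansion_unique_ev[OF H])
    moreover have "eval_fps G 0 \<noteq> 0" using False by (simp add: eval_fps_at_0 G_def N_def)
    moreover have "eval_fps G analytic_on {0}" by (rule has_fps_expansion_imp_analytic_0[OF G])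
    ultimately show ?thesis by blast
  qed
qed

section \<open>Orders of vanishing expressed by O-classes at the origin\<close>

lemma isCont_bigtheta_1:
  fixes g :: "complex \<Rightarrow> complex"
  assumes "isCont g 0" "g 0 \<noteq> 0"
  shows "g \<in> \<Theta>[at 0](\<lambda>_. 1)"
proof (rule bigthetaI)
  have t: "((\<lambda>x. g x / 1) \<longlongrightarrow> g 0) (at 0)" using assms(1) by (simp add: isCont_def)
  show "g \<in> O[at 0](\<lambda>_. 1)" by (rule bigoI_tendsto[OF t]) simp
  show "g \<in> \<Omega>[at 0](\<lambda>_. 1)" unfolding bigomega_iff_bigo
  proof (rule bigoI_tendsto)
    show "((\<lambda>x. 1 / g x) \<longlongrightarrow> 1 / g 0) (at 0)"
      using assms by (intro tendsto_intros) (auto simp: isCont_def)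
    show "\<forall>\<^sub>F x in at 0. g x \<noteq> 0"
      using assms tendsto_imp_eventually_ne unfolding isCont_def by blast
  qed
qed

lemma bigo_power_mono:
  assumes "M \<le> N"
  shows "(\<lambda>t :: complex. t ^ N) \<in> O[at 0](\<lambda>t. t ^ M)"
proof (rule bigoI[of _ 1])
  have "\<forall>\<^sub>F t in at (0 :: complex). t \<in> ball 0 1 - {0}" by (rule eventually_at_in_open) auto
  then show "\<forall>\<^sub>F t in at (0 :: complex). norm (t ^ N) \<le> 1 * norm (t ^ M)"
    by eventually_elim (use assms in \<open>auto simp: norm_power intro: power_decreasing\<close>)
qed

lemma eventually_nhds_imp_at: "\<forall>\<^sub>F t in nhds a. P t \<Longrightarrow> \<forall>\<^sub>F t in at a. P t"
  by (simp add: eventually_at_filter eventually_mono)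

lemma analytic_order_at_0:
  fixes h :: "complex \<Rightarrow> complex"
  assumes "h analytic_on {0}"
  obtains "\<forall>\<^sub>F t in nhds 0. h t = 0"
  | N where "h \<in> \<Theta>[at 0](\<lambda>t. t ^ N)" "\<forall>\<^sub>F t in at 0. h t \<noteq> 0"
proof -
  consider "\<forall>\<^sub>F t in nhds 0. h t = 0" | N g where "g analytic_on {0}" "g 0 \<noteq> 0" "\<forall>\<^sub>F t in nhds 0. h t = t ^ N * g t"
    using analytic_factor_at_0[OF assms] by blast
  then show thesis
  proof cases
    case (2 N g)
    have g: "g \<in> \<Theta>[at 0](\<lambda>_. 1)" using analytic_at_0D(1)[OF 2(1)] 2(2) by (rule isCont_bigtheta_1)
    have "(\<lambda>t. t ^ N * g t) \<in> \<Theta>[at 0](\<lambda>t. t ^ N * 1)"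
      by (intro landau_theta.mult bigtheta_refl g)
    moreover have "\<forall>\<^sub>F t in at 0. h t = t ^ N * g t" using 2(3) by (rule eventually_nhds_imp_at)
    ultimately have "h \<in> \<Theta>[at 0](\<lambda>t. t ^ N)" by (simp add: landau_theta.in_cong)
    moreover have "\<forall>\<^sub>F t in at 0. h t \<noteq> 0"
    proof -
      have "\<forall>\<^sub>F t in nhds 0. g t \<noteq> 0"
        using isCont_tendsto_nhds[OF analytic_at_0D(1)[OF 2(1)]] 2(2) tendsto_imp_eventually_ne by blast
      then have "\<forall>\<^sub>F t in at 0. g t \<noteq> 0" by (rule eventually_nhds_imp_at)
      moreover have "\<forall>\<^sub>F t in at (0::complex). t \<noteq> 0" by (simp add: eventually_at_filter)
      ultimately show ?thesis using \<open>\<forall>\<^sub>F t in at 0. h t = t ^ N * g t\<close> by eventually_elim simp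
    qed
    ultimately show thesis using that(2) by blast
  qed (use that in blast)
qed

lemma eventually_0_imp_bigo: "\<forall>\<^sub>F t in F. h t = 0 \<Longrightarrow> h \<in> O[F](g)"
  by (rule bigoI[of _ 0]) (auto elim: eventually_mono)

text \<open>Orders are integers: either the order of a is at least that of b, or the order of b is
  at least one more than that of a. In terms of O-classes this also covers functions that vanish
  identically, whose order is infinite.\<close>

lemma bigo_dichotomy:
  fixes a b :: "complex \<Rightarrow> complex"
  assumes a: "a analytic_on {0}" and b: "b analytic_on {0}"
  shows "a \<in> O[at 0](b) \<or> b \<in> O[at 0](\<lambda>t. t * a t)"
proof (cases rule: analytic_order_at_0[OF a])
  case 1
  then show ?thesis by (auto intro!: eventually_0_imp_bigo eventually_nhds_imp_at)
next
  case (2 N)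
  note aN = this
  show ?thesis
  proof (cases rule: analytic_order_at_0[OF b])
    case 1
    then show ?thesis by (auto intro!: eventually_0_imp_bigo eventually_nhds_imp_at)
  next
    case (2 M)
    show ?thesis
    proof (cases "M \<le> N")
      case True
      have "a \<in> O[at 0](\<lambda>t. t ^ N)" using aN(1) by (rule bigthetaD1)
      also have "(\<lambda>t. t ^ N) \<in> O[at 0](\<lambda>t::complex. t ^ M)" using True by (rule bigo_power_mono)
      also have "(\<lambda>t. t ^ M) \<in> O[at 0](b)" using 2(1) by (simp add: bigtheta_def bigomega_iff_bigo)
      finally show ?thesis ..
    next
      case False
      have "b \<in> O[at 0](\<lambda>t. t ^ M)" using 2(1) by (rule bigthetaD1)
      also have "(\<lambda>t. t ^ M) \<in> O[at 0](\<lambda>t::complex. t * t ^ N)"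
        using bigo_power_mono[of "Suc N" M] False by simp
      also have "(\<lambda>t. t * t ^ N) \<in> O[at 0](\<lambda>t. t * a t)"
        using aN(1) by (intro landau_o.big.mult landau_o.big_refl) (simp add: bigtheta_def bigomega_iff_bigo)
      finally show ?thesis ..
    qed
  qed
qed

lemma bigo_t_mult: "(\<lambda>t :: complex. t * a t) \<in> O[at 0](a)"
proof -
  have "(\<lambda>t :: complex. t * a t) \<in> O[at 0](\<lambda>t. 1 * a t)"
    using bigo_power_mono[of 0 1] by (intro landau_o.big.mult landau_o.big_refl) simp
  then show ?thesis by simp
qed

text \<open>By the dichotomy, O is a total preorder on analytic germs. Applied to the differences
  between a branch and the roots, this picks the closest and the second closest root.\<close>

lemma bigo_minimum:
  fixes f :: "'i \<Rightarrow> complex \<Rightarrow> complex"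
  assumes "finite A" "A \<noteq> {}" "\<And>i. i \<in> A \<Longrightarrow> f i analytic_on {0}"
  shows "\<exists>l\<in>A. \<forall>i\<in>A. f l \<in> O[at 0](f i)"
  using assms
proof (induction A rule: finite_ne_induct)
  case (singleton x)
  then show ?case by auto
next
  case (insert x A)
  then obtain l where l: "l \<in> A" "\<And>i. i \<in> A \<Longrightarrow> f l \<in> O[at 0](f i)" by auto
  have "f x \<in> O[at 0](f l) \<or> f l \<in> O[at 0](f x)"
    using bigo_dichotomy[of "f x" "f l"] insert.prems l(1) landau_o.big_trans[OF _ bigo_t_mult] by blast
  then show ?case
  proof
    assume *: "f x \<in> O[at 0](f l)"
    then have "\<forall>i\<in>insert x A. f x \<in> O[at 0](f i)" using l(2) landau_o.big_trans[OF *] by auto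
    then show ?thesis by blast
  next
    assume "f l \<in> O[at 0](f x)"
    then show ?thesis using l by blast
  qed
qed

lemma deriv_eventually_eq:
  fixes f g :: "complex \<Rightarrow> complex"
  assumes "\<forall>\<^sub>F t in nhds 0. f t = g t" "\<forall>\<^sub>F t in nhds 0. (g has_field_derivative g' t) (at t)"
  shows "\<forall>\<^sub>F t in nhds 0. deriv f t = g' t"
proof -
  have "\<forall>\<^sub>F t in nhds 0. \<forall>\<^sub>F u in nhds t. f u = g u" using assms(1) by (simp add: eventually_eventually)
  then show ?thesis using assms(2)
    by eventually_elim (metis DERIV_imp_deriv deriv_cong_ev)
qed

text \<open>The factor t keeps the exponent N, where plain differentiation would lead to N - 1 and a
  special case for N = 0.\<close>

lemma analytic_deriv_factor:
  fixes h :: "complex \<Rightarrow> complex"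
  assumes g: "g analytic_on {0}" and h: "\<forall>\<^sub>F t in nhds 0. h t = t ^ N * g t"
  shows "\<exists>k. isCont k 0 \<and> k 0 = of_nat N * g 0 \<and> (\<forall>\<^sub>F t in nhds 0. t * deriv h t = t ^ N * k t)"
proof (intro exI conjI)
  define k where "k t = of_nat N * g t + t * deriv g t" for t
  have "deriv g analytic_on {0}" using g by (rule analytic_deriv)
  then show "isCont k 0" unfolding k_def[abs_def]
    using analytic_at_0D(1) g by (intro continuous_intros) auto
  show "k 0 = of_nat N * g 0" by (simp add: k_def)
  have "\<forall>\<^sub>F t in nhds 0. ((\<lambda>t. t ^ N * g t) has_field_derivative
      of_nat N * t ^ (N - 1) * g t + t ^ N * deriv g t) (at t)"
    using analytic_at_0D(2)[OF g]
    by eventually_elim (auto intro!: derivative_eq_intros)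
  from deriv_eventually_eq[OF h this] show "\<forall>\<^sub>F t in nhds 0. t * deriv h t = t ^ N * k t"
  proof eventually_elim
    case (elim t)
    have e: "t * (of_nat N * t ^ (N - 1)) = of_nat N * t ^ N" by (cases N) auto
    have "t * (of_nat N * t ^ (N - 1) * g t + t ^ N * deriv g t) =
        (t * (of_nat N * t ^ (N - 1))) * g t + t * t ^ N * deriv g t"
      by (simp only: distrib_left mult.assoc)
    also have "\<dots> = t ^ N * k t" unfolding e k_def by (simp add: algebra_simps)
    finally show ?case unfolding elim .
  qed
qed

text \<open>The operator t d/dt multiplies the leading term of order N by N. It never lowers the
  order, and it preserves the order when N > 0, that is, when h vanishes at 0.\<close>

lemma bigo_t_deriv:
  fixes h :: "complex \<Rightarrow> complex"
  assumes h: "h analytic_on {0}"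
  shows "(\<lambda>t. t * deriv h t) \<in> O[at 0](h)" "h 0 = 0 \<Longrightarrow> h \<in> O[at 0](\<lambda>t. t * deriv h t)"
proof -
  have "(\<lambda>t. t * deriv h t) \<in> O[at 0](h) \<and> (h 0 = 0 \<longrightarrow> h \<in> O[at 0](\<lambda>t. t * deriv h t))"
    using analytic_factor_at_0[OF h]
  proof (elim disjE exE conjE)
    assume z: "\<forall>\<^sub>F t in nhds 0. h t = 0"
    have "\<forall>\<^sub>F t in nhds 0. deriv h t = 0" by (rule deriv_eventually_eq[OF z]) simp
    from eventually_nhds_imp_at[OF this] have "\<forall>\<^sub>F t in at 0. t * deriv h t = 0" by eventually_elim simp
    from eventually_0_imp_bigo[OF this] eventually_0_imp_bigo[OF eventually_nhds_imp_at[OF z]]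
    show ?thesis by blast
  next
    fix N g assume g: "g analytic_on {0}" "g 0 \<noteq> 0" and hg: "\<forall>\<^sub>F t in nhds 0. h t = t ^ N * g t"
    obtain k where k: "isCont k 0" "k 0 = of_nat N * g 0" "\<forall>\<^sub>F t in nhds 0. t * deriv h t = t ^ N * k t"
      using analytic_deriv_factor[OF g(1) hg] by blast
    have gT: "g \<in> \<Theta>[at 0](\<lambda>_. 1)" using analytic_at_0D(1)[OF g(1)] g(2) by (rule isCont_bigtheta_1)
    have hT: "h \<in> \<Theta>[at 0](\<lambda>t. t ^ N)"
      using landau_theta.mult[OF bigtheta_refl gT, of "\<lambda>t. t ^ N"] eventually_nhds_imp_at[OF hg]
      by (simp add: landau_theta.in_cong)
    have kO: "k \<in> O[at 0](\<lambda>_. 1)"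
      using k(1) by (intro bigoI_tendsto[of _ _ "k 0"]) (auto simp: isCont_def)
    have dO: "(\<lambda>t. t * deriv h t) \<in> O[at 0](\<lambda>t. t ^ N)"
      using landau_o.big.mult[OF landau_o.big_refl kO, of "\<lambda>t. t ^ N"] eventually_nhds_imp_at[OF k(3)]
      by (simp add: landau_o.big.in_cong)
    have tO: "(\<lambda>t. t ^ N) \<in> O[at 0](h)" using hT by (simp add: bigtheta_def bigomega_iff_bigo)
    have "h \<in> O[at 0](\<lambda>t. t * deriv h t)" if h0: "h 0 = 0"
    proof -
      have "N > 0" using eventually_nhds_x_imp_x[OF hg] h0 g(2) by (cases N) auto
      then have "k \<in> \<Theta>[at 0](\<lambda>_. 1)" using k(1,2) g(2) by (intro isCont_bigtheta_1) auto
      from landau_theta.mult[OF bigtheta_refl this, of "\<lambda>t. t ^ N"] eventually_nhds_imp_at[OF k(3)]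
      have "(\<lambda>t. t * deriv h t) \<in> \<Theta>[at 0](\<lambda>t. t ^ N)" by (simp add: landau_theta.in_cong)
      then have "(\<lambda>t. t ^ N) \<in> O[at 0](\<lambda>t. t * deriv h t)" by (simp add: bigtheta_def bigomega_iff_bigo)
      with bigthetaD1[OF hT] show ?thesis by (rule landau_o.big_trans)
    qed
    with landau_o.big_trans[OF dO tO] show ?thesis by blast
  qed
  then show "(\<lambda>t. t * deriv h t) \<in> O[at 0](h)" "h 0 = 0 \<Longrightarrow> h \<in> O[at 0](\<lambda>t. t * deriv h t)" by auto
qed

text \<open>The perturbation e is smaller than R by a factor t, so it cannot cancel the unit
  multiple V R.\<close>

lemma bigo_absorb:
  fixes R e V :: "complex \<Rightarrow> complex"
  assumes e: "e \<in> O[at 0](\<lambda>t. t * R t)" and V: "isCont V 0" "V 0 \<noteq> 0"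
  shows "R \<in> O[at 0](\<lambda>t. V t * R t + e t)"
proof -
  obtain K where K: "K > 0" "\<forall>\<^sub>F t in at 0. norm (e t) \<le> K * norm (t * R t)"
    using e by (rule landau_o.bigE)
  define v where "v = norm (V 0)"
  have v: "v > 0" using V(2) by (simp add: v_def)
  have "((\<lambda>t. norm (V t)) \<longlongrightarrow> v) (at 0)"
    using V(1) unfolding v_def isCont_def by (rule tendsto_norm)
  then have "\<forall>\<^sub>F t in at 0. norm (V t) > v / 2" using v by (intro order_tendstoD) auto
  \<comment> \<open>This radius gives |e| \<le> v/4 |R|, against |V R| \<ge> v/2 |R|.\<close>
  moreover have "\<forall>\<^sub>F t in at (0 :: complex). norm t < v / (4 * K)"
    using eventually_nhds_imp_at[OF eventually_small[of "\<lambda>t. t :: complex" "v / (4 * K)"]] v K(1) by simp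
  ultimately have "\<forall>\<^sub>F t in at 0. norm (R t) \<le> (4 / v) * norm (V t * R t + e t)"
    using K(2)
  proof eventually_elim
    case (elim t)
    have "K * norm t \<le> v / 4" using elim(2) K(1) by (simp add: field_simps)
    then have "norm (e t) \<le> v / 4 * norm (R t)"
      using elim(3) mult_right_mono[of "K * norm t" "v / 4" "norm (R t)"] by (simp add: norm_mult mult.assoc)
    moreover have "norm (V t * R t) \<ge> v / 2 * norm (R t)"
      using elim(1) mult_right_mono[of "v / 2" "norm (V t)" "norm (R t)"] by (simp add: norm_mult)
    moreover have "norm (V t * R t) \<le> norm (V t * R t + e t) + norm (e t)"
      using norm_triangle_ineq4[of "V t * R t + e t" "e t"] by simp
    ultimately have "v / 4 * norm (R t) \<le> norm (V t * R t + e t)" by simp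
    then show ?case using v by (simp add: field_simps)
  qed
  then show ?thesis by (rule bigoI)
qed

section \<open>Puiseux roots of a series, and lower bounds on cones\<close>

lemma map_coeff1_0_root_prod: "at_X0 (root_prod ys) = root_prod (map (\<lambda>y. coeff1 y 0) ys)"
proof (induction ys)
  case Nil
  show ?case by (rule poly_eqI) (simp add: coeff_1)
next
  case (Cons y ys)
  have "at_X0 [:- y, 1:] = [:- coeff1 y 0, 1:]" by (simp add: at_X0_pCons)
  with Cons show ?case by (simp only: list.map root_prod_simps at_X0_mult)
qed

lemma poly_root_prod: "poly (root_prod ys) a = (\<Prod>y\<leftarrow>ys. a - y)"
  by (induction ys) (simp_all add: algebra_simps)

theorem puiseux_roots:
  assumes low: "\<And>j. j < k \<Longrightarrow> coeff2 g 0 j = 0" and top: "coeff2 g 0 k \<noteq> 0"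
  shows "\<exists>W V m0. lead_coeff W = 1 \<and> coeff2 V 0 0 \<noteq> 0 \<and> g = V * emb W \<and> m0 > 0 \<and>
    (\<forall>m. m > 0 \<longrightarrow> m0 dvd m \<longrightarrow> (\<exists>ys. length ys = k \<and> (\<forall>y\<in>set ys. coeff1 y 0 = 0) \<and> ramp m W = root_prod ys \<and>
      (\<forall>\<^sub>F z in nhds 0. eval2 g (fst z ^ m, snd z) =
         eval2 V (fst z ^ m, snd z) * (\<Prod>i<k. snd z - eval1 (ys ! i) (fst z)))))"
proof -
  obtain W q where W: "weierstrass_poly k W" and q: "coeff2 q 0 0 \<noteq> 0" "emb W = q * g"
    using weierstrass_preparation[OF assms] by blast
  obtain V where V: "1 = q * V" using cps2_unit[OF q(1)] by (rule dvdE)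
  have gV: "g = V * emb W" using q(2) V by (metis mult.assoc mult.commute mult_1)
  have "coeff2 q 0 0 * coeff2 V 0 0 = 1" using arg_cong[OF V, of "\<lambda>f. coeff2 f 0 0"] by simp
  then have V0: "coeff2 V 0 0 \<noteq> 0" by auto
  have W1: "lead_coeff W = 1" "degree W = k" using W by (auto simp: weierstrass_poly_def)
  obtain m0 ys0 where m0: "m0 > 0" "ramp m0 W = root_prod ys0" using newton_puiseux[OF W1(1)] by blast
  have "\<exists>ys. length ys = k \<and> (\<forall>y\<in>set ys. coeff1 y 0 = 0) \<and> ramp m W = root_prod ys \<and>
      (\<forall>\<^sub>F z in nhds 0. eval2 g (fst z ^ m, snd z) =
         eval2 V (fst z ^ m, snd z) * (\<Prod>i<k. snd z - eval1 (ys ! i) (fst z)))"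
    if m: "m > 0" "m0 dvd m" for m
  proof -
    obtain l where l: "m = l * m0" using m(2) by (metis dvdE mult.commute)
    have l0: "l > 0" using m(1) l by simp
    define ys where "ys = map (ram l) ys0"
    have R: "ramp m W = root_prod ys"
      unfolding l ys_def ramp_root_prod[OF l0, symmetric] m0(2)[symmetric] ramp_ramp[OF l0 m0(1)] ..
    have "degree (ramp m W) = k" using W1 m(1) by (simp add: degree_ramp)
    then have len: "length ys = k" using degree_root_prod[of ys] R by simp
    have X0: "at_X0 (ramp m W) = monom 1 k"
    proof (rule poly_eqI)
      fix j
      consider "j < k" | "j = k" | "j > k" by linarith
      then show "coeff (at_X0 (ramp m W)) j = coeff (monom 1 k) j"
        using W by cases (auto simp: weierstrass_poly_def coeff_eq_0)
    qed
    have y0: "coeff1 y 0 = 0" if "y \<in> set ys" for y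
    proof -
      have "poly (at_X0 (ramp m W)) (coeff1 y 0) = 0"
        unfolding R map_coeff1_0_root_prod poly_root_prod using that by (auto simp: prod_list_zero_iff)
      then show ?thesis by (simp add: X0 poly_monom)
    qed
    note lim = power_fst_tendsto[OF m(1)]
    have "\<forall>\<^sub>F z in nhds 0. eval2 g (fst z ^ m, snd z) =
         eval2 V (fst z ^ m, snd z) * (\<Prod>i<k. snd z - eval1 (ys ! i) (fst z))"
      using eventually_compose_filterlim[OF eval2_mult[of V "emb W"] lim] eval2_puiseux_curve[OF m(1), of W] eval2_root_prod[of ys]
      unfolding gV R len by eventually_elim simp
    with len y0 R show ?thesis by blast
  qed
  with W1 V0 gV m0(1) show ?thesis by blast
qed

lemma eval2_emb_monom: "\<forall>\<^sub>F z in nhds 0. eval2 (emb (monom (const1 a) k)) z = a * snd z ^ k"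
proof (cases "a = 0")
  case True
  have "const1 0 = 0" by (rule cps1_eqI) simp
  with True show ?thesis by (simp add: emb_simps)
next
  case False
  then have "const1 a \<noteq> 0" by (metis coeff1_simps(1,6))
  then show ?thesis using eval2_emb[of "monom (const1 a) k"]
    by (auto elim!: eventually_mono simp: degree_monom_eq if_distrib[of "\<lambda>b. eval1 b _"] mult_delta_left cong: if_cong)
qed

text \<open>The initial form of g is a Y^k. On the cone |x| \<le> K |y| the norm of the point is
  comparable to |y|, so the remainder, of order at least k + 1, is negligible against it.\<close>

lemma eval2_cone_lower_bound:
  assumes low: "\<And>i j. i + j < k \<Longrightarrow> coeff2 g i j = 0" and tan: "\<And>i j. i + j = k \<Longrightarrow> i > 0 \<Longrightarrow> coeff2 g i j = 0"
    and top: "coeff2 g 0 k \<noteq> 0" and K: "K \<ge> 0"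
  shows "\<exists>c>0. \<forall>\<^sub>F z in nhds 0. norm (fst z) \<le> K * norm (snd z) \<longrightarrow> norm (eval2 g z) \<ge> c * norm (snd z) ^ k"
proof -
  define a where "a = coeff2 g 0 k"
  define M where "M = emb (monom (const1 a) k)"
  have "coeff2 (g - M) i j = 0" if "i + j < Suc k" for i j
  proof -
    have "coeff2 M i j = (if i = 0 \<and> j = k then a else 0)" by (auto simp: M_def)
    with that low[of i j] tan[of i j] show ?thesis by (cases "i + j = k") (auto simp: a_def)
  qed
  from eval2_order_bound[OF this] obtain C where C: "C \<ge> 0"
    "\<forall>\<^sub>F z in nhds 0. norm (eval2 (g - M) z) \<le> C * norm z ^ Suc k" by blast
  \<comment> \<open>On the cone the norm of z is at most (K + 1) |y|, whence this power; the summand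
    1 keeps \<open>B\<close> positive.\<close>
  define B where "B = C * (K + 1) ^ Suc k + 1"
  have B: "B > 0" using C K by (simp add: B_def add_nonneg_pos)
  have a: "norm a > 0" using top by (simp add: a_def)
  have "\<forall>\<^sub>F z in nhds (0 :: complex \<times> complex). dist z 0 < norm a / (2 * B)"
    using a B by (intro eventually_nhds_metric[THEN iffD2]) (auto intro!: exI[of _ "norm a / (2 * B)"])
  then have "\<forall>\<^sub>F z in nhds 0. norm (fst z) \<le> K * norm (snd z) \<longrightarrow> norm (eval2 g z) \<ge> (norm a / 2) * norm (snd z) ^ k"
    using C(2) eval2_emb_monom[of a k] eval2_diff[of g M]
  proof eventually_elim
    case (elim z)
    show ?case
    proof
      assume cone: "norm (fst z) \<le> K * norm (snd z)"
      let ?y = "norm (snd z)"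
      have "norm z \<le> norm (fst z) + ?y" using norm_Pair_le[of "fst z" "snd z"] by simp
      also have "\<dots> \<le> (K + 1) * ?y" using cone by (simp add: algebra_simps)
      finally have "norm z ^ Suc k \<le> ((K + 1) * ?y) ^ Suc k" by (intro power_mono) auto
      then have "norm (eval2 (g - M) z) \<le> C * ((K + 1) * ?y) ^ Suc k"
        using elim(2) C(1) by (meson mult_left_mono order_trans)
      also have "\<dots> = (C * (K + 1) ^ Suc k) * ?y * ?y ^ k" by (simp add: power_mult_distrib mult_ac)
      also have "\<dots> \<le> B * ?y * ?y ^ k" by (intro mult_right_mono) (auto simp: B_def)
      also have "\<dots> \<le> norm a / 2 * ?y ^ k"
      proof (rule mult_right_mono)
        have "?y \<le> norm z" using norm_snd_le[of "snd z" "fst z"] by simp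
        then have "?y \<le> norm a / (2 * B)" using elim(1) by simp
        then show "B * ?y \<le> norm a / 2" using B by (simp add: field_simps)
      qed simp
      finally have r: "norm (eval2 (g - M) z) \<le> norm a / 2 * ?y ^ k" .
      have "a * snd z ^ k = eval2 g z - eval2 (g - M) z" using elim(3,4) by (simp add: M_def)
      then have "norm a * ?y ^ k \<le> norm (eval2 g z) + norm (eval2 (g - M) z)"
        using norm_triangle_ineq4[of "eval2 g z" "eval2 (g - M) z"] by (simp add: norm_mult norm_power flip: \<open>a * snd z ^ k = _\<close>)
      with r show "norm (eval2 g z) \<ge> (norm a / 2) * norm (snd z) ^ k" by simp
    qed
  qed
  then show ?thesis using a by (intro exI[of _ "norm a / 2"]) auto
qed

section \<open>Series with initial form \<open>Y\<^sup>n\<close>\<close>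

definition lojasiewicz_exponent :: "cps2 \<Rightarrow> (complex \<times> complex) set \<Rightarrow> real \<Rightarrow> bool" where
  "lojasiewicz_exponent f A \<theta> \<longleftrightarrow> \<theta> \<ge> 0 \<and>
     (\<exists>c>0. \<forall>\<^sub>F z in nhds 0. z \<in> A \<longrightarrow> norm (grad2 f z) \<ge> c * norm z powr \<theta>)"

lemma lojasiewicz_on_eq: "lojasiewicz_on f A = Inf (ereal ` {\<theta>. lojasiewicz_exponent f A \<theta>})"
  unfolding lojasiewicz_on_def lojasiewicz_exponent_def by (rule arg_cong[of _ _ Inf]) auto

lemma power_analytic: "(\<lambda>t :: complex. t ^ m) analytic_on {0}"
  by (intro analytic_intros)

text \<open>Puiseux curves are parametrised as \<open>(t\<^sup>m, h t)\<close>, with one ramification index \<open>m\<close> for all of them.\<close>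

definition along :: "nat \<Rightarrow> cps2 \<Rightarrow> (complex \<Rightarrow> complex) \<Rightarrow> complex \<Rightarrow> complex" where
  "along m g h t = eval2 g (t ^ m, h t)"

context
  fixes m :: nat and h :: "complex \<Rightarrow> complex"
  assumes m: "m > 0" and h: "h analytic_on {0}" and h0: "h 0 = 0"
begin

lemma eventually_along: "\<forall>\<^sub>F z in nhds 0. P z \<Longrightarrow> \<forall>\<^sub>F t in nhds 0. P (t ^ m, h t)"
  using m analytic_at_0D(1)[OF h] h0 by (intro eventually_curve) (auto simp: zero_power)

lemma along_analytic: "along m g h analytic_on {0}"
  unfolding along_def[abs_def] using m
  by (intro eval2_curve_analytic power_analytic h h0) (simp add: zero_power)

lemma along_at_0: "along m g h 0 = coeff2 g 0 0"
  using m h0 by (simp add: along_def zero_power flip: zero_prod_def)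

lemma along_isCont: "isCont (along m g h) 0"
  by (rule analytic_at_0D(1)[OF along_analytic])

lemma along_bounded: "along m g h \<in> O[at 0](\<lambda>_. 1)"
  by (rule bigoI_tendsto[of _ _ "coeff2 g 0 0"]) (use along_isCont[of g] in \<open>auto simp: isCont_def along_at_0\<close>)

lemma along_unit: "coeff2 g 0 0 \<noteq> 0 \<Longrightarrow> along m g h \<in> \<Theta>[at 0](\<lambda>_. 1)"
  using along_isCont[of g] by (intro isCont_bigtheta_1) (auto simp: along_at_0)

lemma along_deriv:
  "\<forall>\<^sub>F t in nhds 0. deriv (along m g h) t =
     along m (deriv_X g) h t * (of_nat m * t ^ (m - 1)) + along m (deriv_Y g) h t * deriv h t"
proof -
  have d: "deriv (\<lambda>t :: complex. t ^ m) t = of_nat m * t ^ (m - 1)" for t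
    by (rule DERIV_imp_deriv) (auto intro!: derivative_eq_intros)
  have z: "(0 :: complex) ^ m = 0" using m by (simp add: zero_power)
  from eval2_curve_analytic(2)[OF power_analytic z h h0, of g]
  show ?thesis unfolding d by eventually_elim (auto simp: along_def[abs_def] intro!: DERIV_imp_deriv)
qed

lemma along_t_deriv:
  "\<forall>\<^sub>F t in nhds 0. t * deriv (along m g h) t =
     of_nat m * (t ^ m * along m (deriv_X g) h t) + along m (deriv_Y g) h t * (t * deriv h t)"
  using along_deriv[of g]
proof eventually_elim
  case (elim t)
  have "t * t ^ (m - 1) = t ^ m" using m by (cases m) auto
  moreover have "t * (a * (c * u) + b * d) = c * ((t * u) * a) + b * (t * d)" for a b c d u :: complex
    by (simp add: algebra_simps)
  ultimately show ?case unfolding elim by simp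
qed

end

text \<open>By the dichotomy h has order greater than m, or the curve stays in a cone around the
  Y-axis. There g does not vanish off the origin, so the second case is impossible: all roots are
  tangent to Y = 0.\<close>

lemma cone_root_bound:
  assumes m: "m > 0" and h: "h analytic_on {0}" "h 0 = 0"
    and low: "\<And>i j. i + j < k \<Longrightarrow> coeff2 g i j = 0" and tan: "\<And>i j. i + j = k \<Longrightarrow> i > 0 \<Longrightarrow> coeff2 g i j = 0"
    and top: "coeff2 g 0 k \<noteq> 0"
    and z: "\<forall>\<^sub>F t in nhds 0. along m g h t = 0"
  shows "h \<in> O[at 0](\<lambda>t. t ^ Suc m)"
proof -
  have "(\<lambda>t. t ^ m) \<in> O[at 0](h) \<or> h \<in> O[at 0](\<lambda>t. t * t ^ m)"
    using bigo_dichotomy[OF power_analytic h(1)] .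
  moreover have False if "(\<lambda>t. t ^ m) \<in> O[at 0](h)"
  proof -
    obtain K where K: "K > 0" "\<forall>\<^sub>F t in at 0. norm (t ^ m) \<le> K * norm (h t)"
      using \<open>(\<lambda>t. t ^ m) \<in> O[at 0](h)\<close> by (rule landau_o.bigE)
    obtain c where c: "c > 0" "\<forall>\<^sub>F z in nhds 0. norm (fst z) \<le> K * norm (snd z) \<longrightarrow> norm (eval2 g z) \<ge> c * norm (snd z) ^ k"
      using eval2_cone_lower_bound[OF low tan top, of K] K(1) by auto
    have "\<forall>\<^sub>F t in at (0 :: complex). t \<noteq> 0" by (simp add: eventually_at_filter)
    then have "\<forall>\<^sub>F t in at (0 :: complex). False"
      using K(2) eventually_nhds_imp_at[OF z] eventually_nhds_imp_at[OF eventually_along[OF m h c(2)]]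
    proof eventually_elim
      case (elim t)
      then have "c * norm (h t) ^ k \<le> 0" by (simp add: along_def)
      then have "h t = 0"
      proof (rule contrapos_pp)
        assume "h t \<noteq> 0"
        then have "0 < c * norm (h t) ^ k" using c(1) by simp
        then show "\<not> c * norm (h t) ^ k \<le> 0" by simp
      qed
      with elim(1,2) show False by simp
    qed
    then show False by simp
  qed
  ultimately show ?thesis by auto
qed

locale unitangent_normal =
  fixes F :: cps2 and n :: nat
  assumes red: "reduced2 F" and n2: "2 \<le> n"
    and low: "\<And>i j. i + j < n \<Longrightarrow> coeff2 F i j = 0"
    and tan: "\<And>i j. i + j = n \<Longrightarrow> i > 0 \<Longrightarrow> coeff2 F i j = 0"
    and top: "coeff2 F 0 n \<noteq> 0"
begin

abbreviation "FX \<equiv> deriv_X F"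
abbreviation "FY \<equiv> deriv_Y F"

text \<open>The initial form of F is free of X, so the X-derivative has order at least n, one more
  than the Y-derivative. This gap decides the case of a polar branch not tangent to Y = 0.\<close>

lemma FX_order: "i + j < n \<Longrightarrow> coeff2 FX i j = 0"
  using low[of "Suc i" j] tan[of "Suc i" j] by (cases "Suc i + j = n") (auto simp: coeff2_deriv_X)

lemma FY_low: "i + j < n - 1 \<Longrightarrow> coeff2 FY i j = 0"
  using low[of i "Suc j"] by (simp add: coeff2_deriv_Y)

lemma FY_tan: "i + j = n - 1 \<Longrightarrow> i > 0 \<Longrightarrow> coeff2 FY i j = 0"
  using tan[of i "Suc j"] n2 by (simp add: coeff2_deriv_Y)

lemma FY_top: "coeff2 FY 0 (n - 1) \<noteq> 0"
  using top n2 by (simp add: coeff2_deriv_Y del: of_nat_Suc)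

text \<open>
  The constant \<open>c\<close> makes the coefficient of \<open>Y\<^sup>n\<close> in the Jacobian of \<open>\<lambda> = Y + c X Y\<close> and \<open>F\<close> equal to 1;
  for \<open>\<lambda> = Y\<close> the polar curve could contain the axis \<open>X = 0\<close>.
\<close>

definition slope :: complex where
  "slope = (coeff2 F 1 n + 1) / (of_nat n * coeff2 F 0 n)"

definition param :: cps2 where
  "param = emb [:0, 1 + const1 slope * var1:]"

definition J :: cps2 where
  "J = jacobian2 param F"

lemma coeff2_param: "coeff2 param i j = (if j = 1 then if i = 0 then 1 else if i = 1 then slope else 0 else 0)"
  by (auto simp: param_def coeff_pCons coeff1_const1_mult split: nat.split)

lemma deriv_X_param: "deriv_X param = emb [:0, const1 slope:]"
  by (rule cps2_eqI) (auto simp: coeff2_deriv_X coeff2_param coeff_pCons split: nat.split)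

lemma deriv_Y_param: "deriv_Y param = emb [:1 + const1 slope * var1:]"
  by (rule cps2_eqI) (auto simp: coeff2_deriv_Y coeff2_param coeff_pCons coeff1_const1_mult split: nat.split)

text \<open>The restriction to X = 0, from which the hypotheses of \<open>puiseux_roots\<close> for
  \<open>J\<close> are read off.\<close>

lemma coeff2_J: "coeff2 J 0 j = slope * of_nat j * coeff2 F 0 j - coeff2 F 1 j"
proof -
  have "coeff2 (deriv_X param * FY) 0 j = (\<Sum>l\<le>j. coeff2 (deriv_X param) 0 l * coeff2 FY 0 (j - l))"
    by (simp add: coeff2_mult)
  also have "\<dots> = (\<Sum>l\<le>j. if l = 1 then slope * coeff2 FY 0 (j - 1) else 0)"
    by (intro sum.cong) (auto simp: coeff2_deriv_X coeff2_param)
  also have "\<dots> = slope * of_nat j * coeff2 F 0 j"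
    by (cases j) (simp_all add: coeff2_deriv_Y)
  finally have 1: "coeff2 (deriv_X param * FY) 0 j = slope * of_nat j * coeff2 F 0 j" .
  have "coeff2 (deriv_Y param * FX) 0 j = (\<Sum>l\<le>j. coeff2 (deriv_Y param) 0 l * coeff2 FX 0 (j - l))"
    by (simp add: coeff2_mult)
  also have "\<dots> = (\<Sum>l\<le>j. if l = 0 then coeff2 FX 0 j else 0)"
    by (intro sum.cong) (auto simp: coeff2_deriv_Y coeff2_param)
  finally show ?thesis using 1 by (simp add: J_def jacobian2_def coeff2_deriv_X)
qed

lemma J_low: "j < n \<Longrightarrow> coeff2 J 0 j = 0"
  using low[of 0 j] low[of 1 j] tan[of 1 j] by (cases "Suc j = n") (auto simp: coeff2_J)

lemma J_top: "coeff2 J 0 n \<noteq> 0"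
  using top n2 by (simp add: coeff2_J slope_def field_simps)

lemma eval2_J:
  "\<forall>\<^sub>F z in nhds 0. eval2 J z = slope * snd z * eval2 FY z - (1 + slope * fst z) * eval2 FX z"
proof -
  have "\<forall>\<^sub>F x in nhds 0. eval1 (1 + const1 slope * var1) x = 1 + slope * x"
    using eval1_add[of 1 "const1 slope * var1"] eval1_mult[of "const1 slope" var1]
    by eventually_elim simp
  from eventually_compose_filterlim[OF this fst_tendsto]
  show ?thesis
    using eval2_diff[of "deriv_X param * FY" "deriv_Y param * FX"] eval2_mult[of "deriv_X param" FY]
      eval2_mult[of "deriv_Y param" FX] eval2_emb[of "[:0, const1 slope:]"] eval2_emb[of "[:1 + const1 slope * var1:]"]
    unfolding J_def jacobian2_def deriv_X_param deriv_Y_param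
  proof eventually_elim
    case (elim z)
    \<comment> \<open>For \<open>slope = 0\<close> the polynomial collapses to 0 and the sum over
      its degree loses the linear term; comparing constant coefficients settles this case.\<close>
    have "eval2 (emb [:0, const1 slope:]) z = slope * snd z"
      unfolding elim(5) by (auto dest: arg_cong[of _ _ "\<lambda>a. coeff1 a 0"])
    moreover have "eval2 (emb [:1 + const1 slope * var1:]) z = 1 + slope * fst z"
      unfolding elim(6) using elim(1) by simp
    ultimately show ?case using elim(2-4) by simp
  qed
qed

end

text \<open>The lists \<open>ys\<close>, \<open>ds\<close>, \<open>gs\<close> are the roots of \<open>F\<close>, \<open>\<partial>F/\<partial>Y\<close> and the Jacobian, as series in \<open>t\<close> with \<open>X = t\<^sup>m\<close>.\<close>

locale puiseux_data = unitangent_normal +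
  fixes m :: nat and ys ds gs :: "cps1 list" and W :: "cps1 poly" and V VD VG :: cps2
  assumes m0: "m > 0"
    and W: "lead_coeff W = 1" "F = V * emb W" "ramp m W = root_prod ys"
    and V0: "coeff2 V 0 0 \<noteq> 0" "coeff2 VD 0 0 \<noteq> 0" "coeff2 VG 0 0 \<noteq> 0"
    and len: "length ys = n" "length ds = n - 1" "length gs = n"
    and zero: "\<And>y. y \<in> set ys \<Longrightarrow> coeff1 y 0 = 0" "\<And>y. y \<in> set ds \<Longrightarrow> coeff1 y 0 = 0" "\<And>y. y \<in> set gs \<Longrightarrow> coeff1 y 0 = 0"
    and prodF: "\<forall>\<^sub>F z in nhds 0. eval2 F (fst z ^ m, snd z) = eval2 V (fst z ^ m, snd z) * (\<Prod>i<n. snd z - eval1 (ys ! i) (fst z))"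
    and prodFY: "\<forall>\<^sub>F z in nhds 0. eval2 FY (fst z ^ m, snd z) = eval2 VD (fst z ^ m, snd z) * (\<Prod>i<n-1. snd z - eval1 (ds ! i) (fst z))"
    and prodJ: "\<forall>\<^sub>F z in nhds 0. eval2 J (fst z ^ m, snd z) = eval2 VG (fst z ^ m, snd z) * (\<Prod>i<n. snd z - eval1 (gs ! i) (fst z))"
begin

abbreviation "Y i \<equiv> eval1 (ys ! i)"
abbreviation "D j \<equiv> eval1 (ds ! j)"

lemma root_zero: "i < n \<Longrightarrow> Y i 0 = 0" "j < n - 1 \<Longrightarrow> D j 0 = 0"
  using zero len by simp_all

lemma along_prod:
  assumes h: "h analytic_on {0}" "h 0 = 0"
  shows "\<forall>\<^sub>F t in nhds 0. along m F h t = along m V h t * (\<Prod>i<n. h t - Y i t)"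
    "\<forall>\<^sub>F t in nhds 0. along m FY h t = along m VD h t * (\<Prod>i<n-1. h t - D i t)"
    "\<forall>\<^sub>F t in nhds 0. along m J h t = along m VG h t * (\<Prod>i<n. h t - eval1 (gs ! i) t)"
proof -
  have c: "isCont (\<lambda>t :: complex. t) 0" "(0 :: complex) = 0" "isCont h 0" "h 0 = 0"
    using analytic_at_0D(1)[OF h(1)] h(2) by auto
  show "\<forall>\<^sub>F t in nhds 0. along m F h t = along m V h t * (\<Prod>i<n. h t - Y i t)"
    "\<forall>\<^sub>F t in nhds 0. along m FY h t = along m VD h t * (\<Prod>i<n-1. h t - D i t)"
    "\<forall>\<^sub>F t in nhds 0. along m J h t = along m VG h t * (\<Prod>i<n. h t - eval1 (gs ! i) t)"
    using eventually_curve[OF prodF c] eventually_curve[OF prodFY c] eventually_curve[OF prodJ c]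
    by (simp_all add: along_def)
qed

lemma along_F_root:
  assumes "i < n"
  shows "\<forall>\<^sub>F t in nhds 0. along m F (Y i) t = 0"
  using along_prod(1)[OF eval1_analytic root_zero(1)[OF assms]]
  by eventually_elim (use assms in auto)

lemma along_FY_root:
  assumes "j < n - 1"
  shows "\<forall>\<^sub>F t in nhds 0. along m FY (D j) t = 0"
  using along_prod(2)[OF eval1_analytic root_zero(2)[OF assms]]
  by eventually_elim (use assms in auto)

lemma along_J_root:
  assumes "g \<in> set gs"
  shows "\<forall>\<^sub>F t in nhds 0. along m J (eval1 g) t = 0"
proof -
  obtain k where k: "k < n" "g = gs ! k" using assms len(3) by (auto simp: in_set_conv_nth)
  have "eval1 g 0 = 0" using zero(3)[OF assms] by simp
  from along_prod(3)[OF eval1_analytic this] show ?thesis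
    by eventually_elim (use k in auto)
qed

lemma Y_bound: "i < n \<Longrightarrow> Y i \<in> O[at 0](\<lambda>t. t ^ Suc m)"
  by (rule cone_root_bound[OF m0 eval1_analytic root_zero(1) low tan top along_F_root])

lemma D_bound: "j < n - 1 \<Longrightarrow> D j \<in> O[at 0](\<lambda>t. t ^ Suc m)"
  by (rule cone_root_bound[OF m0 eval1_analytic root_zero(2) FY_low FY_tan FY_top along_FY_root])

text \<open>A repeated root a would make W and its Y-derivative vanish along Y = a(t), which
  reducedness excludes.\<close>

lemma distinct_roots: "distinct ys"
proof (rule ccontr)
  assume "\<not> distinct ys"
  then obtain as bs cs a where ys: "ys = as @ [a] @ bs @ [a] @ cs" using not_distinct_decomp by blast
  define R where "R = root_prod as * root_prod bs * root_prod cs"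
  have "root_prod ys = root_prod as * ([:- a, 1:] * (root_prod bs * ([:- a, 1:] * root_prod cs)))"
    unfolding ys by (simp only: root_prod_append root_prod_simps append.simps mult_1)
  then have R: "root_prod ys = [:- a, 1:] * ([:- a, 1:] * R)" unfolding R_def by (simp only: mult_ac)
  have "a \<in> set ys" by (simp add: ys)
  then have a0: "coeff1 a 0 = 0" by (rule zero)
  have 1: "on_curve m a W = 0"
    unfolding on_curve_def[OF m0 a0] W(3) R by simp
  have "ramp m (pderiv W) = pderiv (ramp m W)"
    by (rule poly_eqI) (use m0 in \<open>simp add: coeff_pderiv ram_mult of_nat_cps1 del: of_nat_Suc\<close>)
  then have 2: "on_curve m a (pderiv W) = 0"
    unfolding on_curve_def[OF m0 a0] W(3) R by (simp add: pderiv_mult pderiv_pCons del: mult_pCons_left)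
  from reduced_no_double_root_poly[OF m0 a0 red W(2,1) 1 2] show False .
qed

lemma eval1_diff: "\<forall>\<^sub>F x in nhds 0. eval1 (a - b) x = eval1 a x - eval1 b x"
  using eval1_add[of "a - b" b] by eventually_elim (simp add: algebra_simps)

lemma roots_differ:
  assumes "i < n" "i' < n" "i \<noteq> i'"
  shows "\<forall>\<^sub>F t in at 0. Y i' t - Y i t \<noteq> 0"
proof (cases rule: analytic_order_at_0[of "\<lambda>t. Y i' t - Y i t"])
  show "(\<lambda>t. Y i' t - Y i t) analytic_on {0}" by (intro analytic_intros eval1_analytic)
next
  assume "\<forall>\<^sub>F t in nhds 0. Y i' t - Y i t = 0"
  then have "\<forall>\<^sub>F t in nhds 0. eval1 (ys ! i' - ys ! i) t = 0"
    using eval1_diff[of "ys ! i'" "ys ! i"] by eventually_elim simp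
  then have "ys ! i' - ys ! i = 0" by (rule eval1_eq_0_imp)
  then show ?thesis using distinct_roots assms len(1) by (simp add: nth_eq_iff_index_eq)
qed

text \<open>A complex Rolle theorem: otherwise \<open>\<partial>F/\<partial>Y\<close> would be nearly constant on the segment between the two roots.\<close>

lemma rolle:
  assumes i: "i < n" "i' < n" "i \<noteq> i'" and \<gamma>: "\<gamma> analytic_on {0}" "\<gamma> 0 = 0" and R: "R analytic_on {0}"
    and b: "(\<lambda>t. \<gamma> t - Y i t) \<in> O[at 0](R)" "(\<lambda>t. \<gamma> t - Y i' t) \<in> O[at 0](R)"
  shows "\<exists>j<n-1. (\<lambda>t. \<gamma> t - D j t) \<in> O[at 0](R)"
proof (rule ccontr)
  assume no: "\<not> ?thesis"
  have an: "(\<lambda>t. \<gamma> t - D j t) analytic_on {0}" for j by (intro analytic_intros \<gamma> eval1_analytic)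
  \<comment> \<open>If no \<open>D j\<close> is within O(R) of \<gamma>, the dichotomy makes R
    smaller than every \<gamma> - D j by a factor t. Seen from the roots of the Y-derivative, the
    two roots of F and \<gamma> then almost coincide.\<close>
  have RO: "R \<in> O[at 0](\<lambda>t. t * (\<gamma> t - D j t))" if "j < n - 1" for j
    using bigo_dichotomy[OF an R, of j] no that by blast
  define v where "v = coeff2 VD 0 0"
  have v: "norm v > 0" using V0 by (simp add: v_def)
  \<comment> \<open>So small that n - 1 factors, each within \<epsilon> of 1, have a product within
    1/4 of 1.\<close>
  obtain \<epsilon> :: real where \<epsilon>: "\<epsilon> > 0" "(1 + \<epsilon>) ^ (n - 1) - 1 < 1 / 4"
  proof -
    have "((\<lambda>e :: real. (1 + e) ^ (n - 1) - 1) \<longlongrightarrow> (1 + 0) ^ (n - 1) - 1) (at_right 0)"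
      by (intro tendsto_intros)
    then have "\<forall>\<^sub>F e in at_right (0 :: real). (1 + e) ^ (n - 1) - 1 < 1 / 4"
      by (rule order_tendstoD) simp
    then show thesis using eventually_at_right_0_obtain that by blast
  qed
  have close: "\<forall>\<^sub>F t in at 0. norm (\<gamma> t - Y l t) \<le> \<epsilon> * norm (\<gamma> t - D j t)"
    if "j < n - 1" and l: "(\<lambda>t. \<gamma> t - Y l t) \<in> O[at 0](R)" for j l
  proof -
    from landau_o.big_trans[OF l RO[OF that(1)]]
    obtain K where K: "K > 0" "\<forall>\<^sub>F t in at 0. norm (\<gamma> t - Y l t) \<le> K * norm (t * (\<gamma> t - D j t))"
      by (rule landau_o.bigE)
    have "\<forall>\<^sub>F t in at (0 :: complex). norm t < \<epsilon> / K"
      using eventually_nhds_imp_at[OF eventually_small[of "\<lambda>t. t :: complex" "\<epsilon> / K"]] \<epsilon>(1) K(1) by simp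
    with K(2) show ?thesis
    proof eventually_elim
      case (elim t)
      have "K * norm t \<le> \<epsilon>" using elim(2) K(1) by (simp add: field_simps)
      then have "(K * norm t) * norm (\<gamma> t - D j t) \<le> \<epsilon> * norm (\<gamma> t - D j t)" by (intro mult_right_mono) auto
      with elim(1) show ?case by (simp add: norm_mult mult.assoc)
    qed
  qed
  have E1: "\<forall>\<^sub>F t in at 0. \<forall>j\<in>{..<n-1}. norm (\<gamma> t - Y i t) \<le> \<epsilon> * norm (\<gamma> t - D j t) \<and>
      norm (\<gamma> t - Y i' t) \<le> \<epsilon> * norm (\<gamma> t - D j t)"
    by (rule eventually_ball_finite) (auto intro!: eventually_conj close b)
  obtain r1 where r1: "r1 > 0" "\<And>x y. norm x < r1 \<Longrightarrow> norm y < r1 \<Longrightarrow>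
      eval2 FY (x ^ m, y) = eval2 VD (x ^ m, y) * (\<Prod>i<n-1. y - D i x)"
    using eventually_nhds_prodD[OF prodFY] by auto
  have "\<forall>\<^sub>F z in nhds 0. norm (eval2 VD z - v) < norm v / 4"
  proof -
    have "((\<lambda>z. eval2 VD z - v) \<longlongrightarrow> v - v) (nhds 0)"
      using isCont_tendsto_nhds[OF eval2_continuous_at_0[of VD]] unfolding v_def eval2_at_0
      by (intro tendsto_intros)
    then have "((\<lambda>z. norm (eval2 VD z - v)) \<longlongrightarrow> 0) (nhds 0)" by (simp add: tendsto_norm_zero)
    then show ?thesis by (rule order_tendstoD) (use v in simp)
  qed
  then obtain r2 where r2: "r2 > 0" "\<And>x y. norm x < r2 \<Longrightarrow> norm y < r2 \<Longrightarrow> norm (eval2 VD (x, y) - v) < norm v / 4"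
    using eventually_nhds_prodD by blast
  obtain r3 where r3: "r3 > 0" "\<And>a b a' b' t. norm (a t) < r3 \<Longrightarrow> norm (b t) < r3 \<Longrightarrow>
     (a has_field_derivative a') (at t) \<Longrightarrow> (b has_field_derivative b') (at t) \<Longrightarrow>
     ((\<lambda>t. eval2 F (a t, b t)) has_field_derivative eval2 FX (a t, b t) * a' + eval2 FY (a t, b t) * b') (at t)"
    using eval2_chain[of F] by blast
  define r where "r = min r1 (min r2 r3)"
  have r: "r > 0" "r \<le> r1" "r \<le> r2" "r \<le> r3" using r1 r2 r3 by (auto simp: r_def)
  have small: "\<forall>\<^sub>F t in at 0. norm (Y l t) < r" if "l < n" for l
    by (rule eventually_nhds_imp_at, rule eventually_small) (use r(1) root_zero(1)[OF that] in auto)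
  have tm: "\<forall>\<^sub>F t in at (0 :: complex). norm (t ^ m) < r"
    by (rule eventually_nhds_imp_at, rule eventually_small) (use r(1) m0 in \<open>auto simp: zero_power\<close>)
  have t1: "\<forall>\<^sub>F t in at (0 :: complex). norm t < r"
    by (rule eventually_nhds_imp_at, rule eventually_small) (use r(1) in auto)
  \<comment> \<open>A \<open>D j\<close> that coincides with \<gamma> as a germ would already
    satisfy the claim.\<close>
  have "\<forall>\<^sub>F t in at 0. \<gamma> t - D j t \<noteq> 0" if "j < n - 1" for j
  proof (cases rule: analytic_order_at_0[OF an[of j]])
    case 1
    then have "(\<lambda>t. \<gamma> t - D j t) \<in> O[at 0](R)" by (intro eventually_0_imp_bigo eventually_nhds_imp_at)
    with no that show ?thesis by blast
  qed
  then have E2: "\<forall>\<^sub>F t in at 0. \<forall>j\<in>{..<n-1}. \<gamma> t - D j t \<noteq> 0" by (intro eventually_ball_finite) auto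
  have "\<forall>\<^sub>F t in at (0 :: complex). False"
    using E1 E2 small[OF i(1)] small[OF i(2)] tm t1 roots_differ[OF i]
      eventually_nhds_imp_at[OF along_F_root[OF i(1)]] eventually_nhds_imp_at[OF along_F_root[OF i(2)]]
  proof eventually_elim
    case (elim t)
    define d where "d = Y i' t - Y i t"
    define P where "P = (\<Prod>j<n-1. \<gamma> t - D j t)"
    \<comment> \<open>For s in [0, 1] this runs through the segment from \<open>Y i t\<close> to
      \<open>Y i' t\<close>; \<open>v * P\<close> is the value from which the Y-derivative hardly
      deviates on it.\<close>
    define w where "w s = Y i t + s * d" for s
    have nz: "d \<noteq> 0" "P \<noteq> 0" using elim(2,7) by (auto simp: d_def P_def)
    let ?S = "closed_segment (0 :: complex) 1"
    have seg: "norm (w s) < r \<and> (\<forall>j<n-1. norm (w s - \<gamma> t) \<le> \<epsilon> * norm (\<gamma> t - D j t))" if s: "s \<in> ?S" for s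
    proof -
      obtain u where u: "s = of_real u" "0 \<le> u" "u \<le> 1" using s by (auto simp: in_segment scaleR_conv_of_real)
      have conv: "norm (of_real (1 - u) * a + of_real u * b) \<le> B" if "norm a \<le> B" "norm b \<le> B" for a b :: complex and B
      proof -
        have "norm (of_real (1 - u) * a + of_real u * b) \<le> (1 - u) * norm a + u * norm b"
          using norm_triangle_ineq[of "of_real (1 - u) * a" "of_real u * b"] u
          by (simp only: norm_mult norm_of_real)
        also have "\<dots> \<le> (1 - u) * B + u * B" using that u by (intro add_mono mult_left_mono) auto
        finally show ?thesis by (simp add: algebra_simps)
      qed
      have w1: "w s = of_real (1 - u) * Y i t + of_real u * Y i' t"
        unfolding w_def u d_def by (simp add: algebra_simps)
      have w2: "w s - \<gamma> t = of_real (1 - u) * (Y i t - \<gamma> t) + of_real u * (Y i' t - \<gamma> t)"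
        unfolding w1 by (simp add: algebra_simps)
      have "norm (w s) \<le> max (norm (Y i t)) (norm (Y i' t))" unfolding w1 by (rule conv) auto
      then have "norm (w s) < r" using elim(3,4) by linarith
      moreover have "norm (w s - \<gamma> t) \<le> \<epsilon> * norm (\<gamma> t - D j t)" if "j < n - 1" for j
        unfolding w2 using elim(1) that by (intro conv) (auto simp: norm_minus_commute)
      ultimately show ?thesis by blast
    qed
    \<comment> \<open>The unit deviates from v by at most a quarter of |v|, and q from 1 by at most
      1/4; together this gives 1/4 * 5/4 + 1/4 = 9/16, and only a bound below 1 matters.\<close>
    have dev: "norm (eval2 FY (t ^ m, w s) - v * P) \<le> 9 / 16 * norm (v * P)" if s: "s \<in> ?S" for s
    proof -
      define e where "e j = (w s - \<gamma> t) / (\<gamma> t - D j t)" for j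
      have e: "norm (e j) \<le> \<epsilon>" if "j < n - 1" for j
        using seg[OF s] that elim(2) by (auto simp: e_def norm_divide field_simps)
      define q where "q = (\<Prod>j<n-1. 1 + e j)"
      have fac: "w s - D j t = (\<gamma> t - D j t) * (1 + e j)" if "j < n - 1" for j
      proof -
        have "\<gamma> t - D j t \<noteq> 0" using elim(2) that by blast
        then have "(\<gamma> t - D j t) * e j = w s - \<gamma> t" by (simp add: e_def)
        then show ?thesis by (simp add: distrib_left)
      qed
      have "(\<Prod>j<n-1. w s - D j t) = P * q"
        unfolding P_def q_def prod.distrib[symmetric] by (intro prod.cong) (auto simp: fac)
      then have FYs: "eval2 FY (t ^ m, w s) = eval2 VD (t ^ m, w s) * (P * q)"
        using r1(2)[of t "w s"] elim(6) seg[OF s] r by simp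
      have "norm (q - 1) \<le> (\<Prod>j<n-1. 1 + norm (e j)) - 1"
        unfolding q_def by (rule norm_prod_minus1_le_prod_minus1)
      also have "(\<Prod>j<n-1. 1 + norm (e j)) \<le> (\<Prod>j<n-1. 1 + \<epsilon>)"
        by (rule prod_mono) (use e in auto)
      finally have q1: "norm (q - 1) \<le> 1 / 4" using \<epsilon>(2) by simp
      then have q2: "norm q \<le> 5 / 4" using norm_triangle_sub[of q 1] by simp
      have vd: "norm (eval2 VD (t ^ m, w s) - v) \<le> norm v / 4"
        using r2(2)[of "t ^ m" "w s"] elim(5) seg[OF s] r by simp
      have "eval2 VD (t ^ m, w s) * q - v = (eval2 VD (t ^ m, w s) - v) * q + v * (q - 1)"
        by (simp add: algebra_simps)
      then have "norm (eval2 VD (t ^ m, w s) * q - v) \<le> norm (eval2 VD (t ^ m, w s) - v) * norm q + norm v * norm (q - 1)"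
        by (metis norm_mult norm_triangle_ineq)
      also have "\<dots> \<le> (norm v / 4) * (5 / 4) + norm v * (1 / 4)"
        using vd q1 q2 by (intro add_mono mult_mono) auto
      finally have le: "norm (eval2 VD (t ^ m, w s) * q - v) \<le> 9 / 16 * norm v" by simp
      have "eval2 FY (t ^ m, w s) - v * P = (eval2 VD (t ^ m, w s) * q - v) * P"
        unfolding FYs by (simp add: algebra_simps)
      then have "norm (eval2 FY (t ^ m, w s) - v * P) = norm (eval2 VD (t ^ m, w s) * q - v) * norm P"
        by (simp add: norm_mult)
      also have "\<dots> \<le> (9 / 16 * norm v) * norm P" using le by (rule mult_right_mono) simp
      finally show ?thesis by (simp add: norm_mult)
    qed
    \<comment> \<open>With the linear function of slope d v P subtracted, the derivative is d times
      the deviation above. Since F vanishes at both ends of the segment, |d v P| is at most 9/16 of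
      itself, which is absurd as d, v and P are nonzero.\<close>
    have "norm ((\<lambda>s. eval2 F (t ^ m, w s) - s * (d * (v * P))) 1 - (\<lambda>s. eval2 F (t ^ m, w s) - s * (d * (v * P))) 0)
        \<le> (norm d * (9 / 16 * norm (v * P))) * norm ((1 :: complex) - 0)"
    proof (rule field_differentiable_bound[where S = ?S and f' = "\<lambda>s. d * (eval2 FY (t ^ m, w s) - v * P)"])
      fix s assume s: "s \<in> ?S"
      have "((\<lambda>s. eval2 F ((\<lambda>_. t ^ m) s, w s)) has_field_derivative
          eval2 FX ((\<lambda>_. t ^ m) s, w s) * 0 + eval2 FY ((\<lambda>_. t ^ m) s, w s) * d) (at s)"
        by (rule r3(2)) (use elim(5) seg[OF s] r in \<open>auto simp: w_def intro!: derivative_eq_intros\<close>)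
      then have "((\<lambda>s. eval2 F (t ^ m, w s)) has_field_derivative eval2 FY (t ^ m, w s) * d) (at s)" by simp
      from DERIV_diff[OF this DERIV_cmult_right[OF DERIV_ident, of "d * (v * P)"]]
      have D: "((\<lambda>s. eval2 F (t ^ m, w s) - s * (d * (v * P))) has_field_derivative
          eval2 FY (t ^ m, w s) * d - 1 * (d * (v * P))) (at s)" .
      have eq: "eval2 FY (t ^ m, w s) * d - 1 * (d * (v * P)) = d * (eval2 FY (t ^ m, w s) - v * P)"
        by (simp add: algebra_simps)
      show "((\<lambda>s. eval2 F (t ^ m, w s) - s * (d * (v * P))) has_field_derivative
          d * (eval2 FY (t ^ m, w s) - v * P)) (at s within ?S)"
        using D unfolding eq by (rule has_field_derivative_at_within)
      show "norm (d * (eval2 FY (t ^ m, w s) - v * P)) \<le> norm d * (9 / 16 * norm (v * P))"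
        unfolding norm_mult[of d] using dev[OF s] by (intro mult_left_mono) auto
    qed auto
    moreover have "eval2 F (t ^ m, w 0) = 0" "eval2 F (t ^ m, w 1) = 0"
      using elim(8,9) by (simp_all add: along_def w_def d_def)
    ultimately have "norm d * norm (v * P) \<le> norm d * (9 / 16 * norm (v * P))"
      by (simp add: norm_mult)
    moreover have "norm d * norm (v * P) > 0" using nz v by (simp add: norm_mult)
    ultimately show False by simp
  qed
  then show False by simp
qed

end

section \<open>Polar branches compared with roots of the Y-derivative\<close>

context puiseux_data
begin

lemma along_F_bigtheta:
  assumes "h analytic_on {0}" "h 0 = 0"
  shows "along m F h \<in> \<Theta>[at 0](\<lambda>t. \<Prod>i<n. h t - Y i t)"
proof -
  have "(\<lambda>t. along m V h t * (\<Prod>i<n. h t - Y i t)) \<in> \<Theta>[at 0](\<lambda>t. 1 * (\<Prod>i<n. h t - Y i t))"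
    by (intro landau_theta.mult along_unit m0 assms V0 bigtheta_refl)
  then show ?thesis using eventually_nhds_imp_at[OF along_prod(1)[OF assms]]
    by (simp add: landau_theta.in_cong)
qed

text \<open>Differentiate the product V * \<Prod>(y - Y i). Where the derivative falls on y - Y l,
  the product over the other roots remains, times the unit V; every other term keeps the factor
  \<gamma> - Y l and is smaller by a factor t, because Y l is strictly closest.\<close>

lemma FY_isolated_root_bound:
  assumes \<gamma>: "\<gamma> analytic_on {0}" "\<gamma> 0 = 0" and l: "l < n"
    and far: "\<And>i. i < n \<Longrightarrow> i \<noteq> l \<Longrightarrow> (\<lambda>t. \<gamma> t - Y l t) \<in> O[at 0](\<lambda>t. t * (\<gamma> t - Y i t))"
  shows "(\<lambda>t. \<Prod>i\<in>{..<n}-{l}. \<gamma> t - Y i t) \<in> O[at 0](along m FY \<gamma>)"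
proof -
  define A where "A = {..<n} - {l}"
  define R where "R t = (\<Prod>i\<in>A. \<gamma> t - Y i t)" for t
  define R' where "R' t = (\<Sum>i\<in>A. \<Prod>k\<in>A-{i}. \<gamma> t - Y k t)" for t
  \<comment> \<open>The terms in which the derivative falls on V or on a factor other than y - Y
    l.\<close>
  define e where "e t = along m (deriv_Y V) \<gamma> t * ((\<gamma> t - Y l t) * R t) + along m V \<gamma> t * ((\<gamma> t - Y l t) * R' t)" for t
  have "\<forall>\<^sub>F t in nhds 0. along m FY \<gamma> t = along m V \<gamma> t * R t + e t"
  proof -
    obtain r1 where r1: "r1 > 0" "\<And>x y. norm x < r1 \<Longrightarrow> norm y < r1 \<Longrightarrow>
        eval2 F (x ^ m, y) = eval2 V (x ^ m, y) * (\<Prod>i<n. y - Y i x)"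
      using eventually_nhds_prodD[OF prodF] by auto
    obtain r2 where r2: "r2 > 0" "\<And>x y. norm x < r2 \<Longrightarrow> norm y < r2 \<Longrightarrow>
        ((\<lambda>y. eval2 V (x, y)) has_field_derivative eval2 (deriv_Y V) (x, y)) (at y)"
      using eval2_deriv_Y by blast
    obtain r3 where r3: "r3 > 0" "\<And>x y. norm x < r3 \<Longrightarrow> norm y < r3 \<Longrightarrow>
        ((\<lambda>y. eval2 F (x, y)) has_field_derivative eval2 FY (x, y)) (at y)"
      using eval2_deriv_Y by blast
    define r where "r = min r1 (min r2 r3)"
    have r: "r > 0" "r \<le> r1" "r \<le> r2" "r \<le> r3" using r1 r2 r3 by (auto simp: r_def)
    have tm: "\<forall>\<^sub>F t in nhds (0 :: complex). norm (t ^ m) < r"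
      by (rule eventually_small) (use r(1) m0 in \<open>auto simp: zero_power\<close>)
    have t1: "\<forall>\<^sub>F t in nhds (0 :: complex). norm t < r"
      by (rule eventually_small) (use r(1) in auto)
    have g1: "\<forall>\<^sub>F t in nhds 0. norm (\<gamma> t) < r"
      by (rule eventually_small[OF analytic_at_0D(1)]) (use r(1) \<gamma> in auto)
    show ?thesis using tm t1 g1
    proof eventually_elim
      case (elim t)
      have dR: "((\<lambda>y. \<Prod>i\<in>A. y - Y i t) has_field_derivative (\<Sum>i\<in>A. 1 * (\<Prod>k\<in>A-{i}. \<gamma> t - Y k t))) (at (\<gamma> t))"
        by (rule has_field_derivative_prod) (auto intro!: derivative_eq_intros)
      have dV: "((\<lambda>y. eval2 V (t ^ m, y)) has_field_derivative eval2 (deriv_Y V) (t ^ m, \<gamma> t)) (at (\<gamma> t))"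
        using r2(2) elim r by simp
      have dl: "((\<lambda>y. y - Y l t) has_field_derivative 1) (at (\<gamma> t))" by (auto intro!: derivative_eq_intros)
      have "((\<lambda>y. eval2 V (t ^ m, y) * ((y - Y l t) * (\<Prod>i\<in>A. y - Y i t))) has_field_derivative
          along m V \<gamma> t * R t + e t) (at (\<gamma> t))"
        by (rule DERIV_cong[OF DERIV_mult[OF dV DERIV_mult[OF dl dR]]])
           (simp add: R_def R'_def e_def along_def algebra_simps)
      moreover have "\<forall>\<^sub>F y in nhds (\<gamma> t). eval2 V (t ^ m, y) * ((y - Y l t) * (\<Prod>i\<in>A. y - Y i t)) = eval2 F (t ^ m, y)"
      proof -
        have "\<forall>\<^sub>F y in nhds (\<gamma> t). y \<in> ball 0 r" using elim(3) by (intro eventually_nhds_in_open) auto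
        then show ?thesis
        proof eventually_elim
          case (elim y)
          have "(\<Prod>i<n. y - Y i t) = (y - Y l t) * (\<Prod>i\<in>A. y - Y i t)"
            unfolding A_def using l by (intro prod.remove) auto
          then show ?case using r1(2)[of t y] elim \<open>norm t < r\<close> r by simp
        qed
      qed
      ultimately have "((\<lambda>y. eval2 F (t ^ m, y)) has_field_derivative along m V \<gamma> t * R t + e t) (at (\<gamma> t))"
        by (subst (asm) DERIV_cong_ev[OF refl _ refl]) auto
      moreover have "((\<lambda>y. eval2 F (t ^ m, y)) has_field_derivative eval2 FY (t ^ m, \<gamma> t)) (at (\<gamma> t))"
        using r3(2) elim r by simp
      ultimately show ?case by (auto simp: along_def[of m FY] dest: DERIV_unique)
    qed
  qed
  note FYe = eventually_nhds_imp_at[OF this]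
  have an: "(\<lambda>t. \<gamma> t - Y i t) analytic_on {0}" for i by (intro analytic_intros \<gamma> eval1_analytic)
  have eO: "e \<in> O[at 0](\<lambda>t. t * R t)"
  proof -
    have bd: "along m g \<gamma> \<in> O[at 0](\<lambda>_. 1)" for g by (rule along_bounded[OF m0 \<gamma>])
    \<comment> \<open>Needed for the term with the derivative of V, where no further factor of the
      product is lost: vanishing at 0 already gives one factor t.\<close>
    have small: "(\<lambda>t. \<gamma> t - Y l t) \<in> O[at 0](\<lambda>t. t)"
    proof -
      have "(\<lambda>t. \<gamma> t - Y l t) \<in> O[at 0](\<lambda>t. t * deriv (\<lambda>t. \<gamma> t - Y l t) t)"
        by (rule bigo_t_deriv(2)[OF an]) (use \<gamma>(2) root_zero(1)[OF l] in simp)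
      also have "(\<lambda>t. t * deriv (\<lambda>t. \<gamma> t - Y l t) t) \<in> O[at 0](\<lambda>t. t * 1)"
      proof (intro landau_o.big.mult landau_o.big_refl)
        have "deriv (\<lambda>t. \<gamma> t - Y l t) analytic_on {0}" by (intro analytic_deriv an)
        then have "isCont (deriv (\<lambda>t. \<gamma> t - Y l t)) 0" by (rule analytic_at_0D)
        then show "deriv (\<lambda>t. \<gamma> t - Y l t) \<in> O[at 0](\<lambda>_. 1)"
          by (intro bigoI_tendsto[of _ _ "deriv (\<lambda>t. \<gamma> t - Y l t) 0"]) (auto simp: isCont_def)
      qed
      finally show ?thesis by simp
    qed
    have 1: "(\<lambda>t. along m (deriv_Y V) \<gamma> t * ((\<gamma> t - Y l t) * R t)) \<in> O[at 0](\<lambda>t. 1 * (t * R t))"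
      by (intro landau_o.big.mult bd small landau_o.big_refl)
    have "(\<lambda>t. (\<gamma> t - Y l t) * (\<Prod>k\<in>A-{i}. \<gamma> t - Y k t)) \<in> O[at 0](\<lambda>t. t * R t)" if i: "i \<in> A" for i
    proof -
      have "(\<lambda>t. (\<gamma> t - Y l t) * (\<Prod>k\<in>A-{i}. \<gamma> t - Y k t)) \<in>
          O[at 0](\<lambda>t. (t * (\<gamma> t - Y i t)) * (\<Prod>k\<in>A-{i}. \<gamma> t - Y k t))"
        using i far by (intro landau_o.big.mult landau_o.big_refl) (auto simp: A_def)
      moreover have "R t = (\<gamma> t - Y i t) * (\<Prod>k\<in>A-{i}. \<gamma> t - Y k t)" for t
        unfolding R_def using i by (intro prod.remove) (auto simp: A_def)
      ultimately show ?thesis by (simp add: mult.assoc)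
    qed
    then have "(\<lambda>t. \<Sum>i\<in>A. (\<gamma> t - Y l t) * (\<Prod>k\<in>A-{i}. \<gamma> t - Y k t)) \<in> O[at 0](\<lambda>t. t * R t)"
      by (rule big_sum_in_bigo)
    then have "(\<lambda>t. (\<gamma> t - Y l t) * R' t) \<in> O[at 0](\<lambda>t. t * R t)"
      by (simp add: R'_def sum_distrib_left)
    then have "(\<lambda>t. along m V \<gamma> t * ((\<gamma> t - Y l t) * R' t)) \<in> O[at 0](\<lambda>t. 1 * (t * R t))"
      by (rule landau_o.big.mult[OF bd])
    with 1 show ?thesis unfolding e_def[abs_def] by (intro sum_in_bigo) simp_all
  qed
  have "R \<in> O[at 0](\<lambda>t. along m V \<gamma> t * R t + e t)"
    by (rule bigo_absorb[OF eO along_isCont[OF m0 \<gamma>]]) (use V0 along_at_0[OF m0 \<gamma>] in simp)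
  then have "R \<in> O[at 0](along m FY \<gamma>)" using FYe by (simp add: landau_o.big.in_cong eq_commute cong: landau_o.big.cong)
  then show ?thesis by (simp add: R_def[abs_def] A_def)
qed

text \<open>Both terms of t d/dt F along the branch are O(\<gamma> F_Y): the one with F_X by the
  polar equation, in which 1 + slope * X is a unit, and the one with F_Y because t \<gamma>' =
  O(\<gamma>). As F vanishes at the origin, \<open>bigo_t_deriv\<close> passes the bound back to
  F.\<close>

lemma polar_branch_F_bound:
  assumes g: "g \<in> set gs"
  shows "along m F (eval1 g) \<in> O[at 0](\<lambda>t. eval1 g t * along m FY (eval1 g) t)"
proof -
  let ?\<gamma> = "eval1 g"
  have \<gamma>: "?\<gamma> analytic_on {0}" "?\<gamma> 0 = 0" using eval1_analytic zero(3)[OF g] by auto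
  have "\<forall>\<^sub>F t in nhds 0. (1 + slope * t ^ m) * along m FX ?\<gamma> t = slope * (?\<gamma> t * along m FY ?\<gamma> t)"
    using along_J_root[OF g] eventually_along[OF m0 \<gamma> eval2_J]
    by eventually_elim (simp add: along_def mult.assoc)
  note rel = eventually_nhds_imp_at[OF this]
  have "((\<lambda>t. norm (1 + slope * t ^ m)) \<longlongrightarrow> norm (1 + slope * 0 ^ m)) (at 0)"
    by (intro tendsto_intros)
  then have "\<forall>\<^sub>F t in at 0. norm (1 + slope * t ^ m) > 1 / 2"
    by (rule order_tendstoD) (use m0 in \<open>simp add: zero_power\<close>)
  then have "\<forall>\<^sub>F t in at 0. norm (along m FX ?\<gamma> t) \<le> (2 * norm slope) * norm (?\<gamma> t * along m FY ?\<gamma> t)"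
    using rel
  proof eventually_elim
    case (elim t)
    have "1 / 2 * norm (along m FX ?\<gamma> t) \<le> norm (1 + slope * t ^ m) * norm (along m FX ?\<gamma> t)"
      using elim(1) by (intro mult_right_mono) auto
    also have "\<dots> = norm slope * norm (?\<gamma> t * along m FY ?\<gamma> t)"
      using elim(2) by (metis norm_mult)
    finally show ?case by simp
  qed
  then have FX: "along m FX ?\<gamma> \<in> O[at 0](\<lambda>t. ?\<gamma> t * along m FY ?\<gamma> t)" by (rule bigoI)
  have "(\<lambda>t. t ^ m * along m FX ?\<gamma> t) \<in> O[at 0](\<lambda>t. 1 * (?\<gamma> t * along m FY ?\<gamma> t))"
    using bigo_power_mono[of 0 m] by (intro landau_o.big.mult FX) simp
  then have 1: "(\<lambda>t. of_nat m * (t ^ m * along m FX ?\<gamma> t)) \<in> O[at 0](\<lambda>t. ?\<gamma> t * along m FY ?\<gamma> t)"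
    using m0 by simp
  have "(\<lambda>t. along m FY ?\<gamma> t * (t * deriv ?\<gamma> t)) \<in> O[at 0](\<lambda>t. along m FY ?\<gamma> t * ?\<gamma> t)"
    by (intro landau_o.big.mult bigo_t_deriv \<gamma> landau_o.big_refl)
  then have 2: "(\<lambda>t. along m FY ?\<gamma> t * (t * deriv ?\<gamma> t)) \<in> O[at 0](\<lambda>t. ?\<gamma> t * along m FY ?\<gamma> t)"
    by (simp add: mult.commute)
  have "(\<lambda>t. t * deriv (along m F ?\<gamma>) t) \<in> O[at 0](\<lambda>t. ?\<gamma> t * along m FY ?\<gamma> t)"
    using sum_in_bigo(1)[OF 1 2] eventually_nhds_imp_at[OF along_t_deriv[OF m0 \<gamma>, of F]]
    by (simp add: landau_o.big.in_cong)
  moreover have "along m F ?\<gamma> \<in> O[at 0](\<lambda>t. t * deriv (along m F ?\<gamma>) t)"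
    by (rule bigo_t_deriv(2)[OF along_analytic[OF m0 \<gamma>]])
       (use along_at_0[OF m0 \<gamma>] low[of 0 0] n2 in simp)
  ultimately show ?thesis by (rule landau_o.big_trans[rotated])
qed

text \<open>If F_Y vanished along the branch, \<open>polar_branch_F_bound\<close> would make F
  vanish too: a common root, excluded for reduced F.\<close>

lemma polar_branch_FY_nonzero:
  assumes g: "g \<in> set gs"
  shows "\<not> (\<forall>\<^sub>F t in nhds 0. along m FY (eval1 g) t = 0)"
proof
  assume z: "\<forall>\<^sub>F t in nhds 0. along m FY (eval1 g) t = 0"
  have g0: "coeff1 g 0 = 0" using zero(3)[OF g] .
  obtain K where "\<forall>\<^sub>F t in at 0. norm (along m F (eval1 g) t) \<le> K * norm (eval1 g t * along m FY (eval1 g) t)"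
    using polar_branch_F_bound[OF g] by (rule landau_o.bigE)
  then have "\<forall>\<^sub>F t in at 0. along m F (eval1 g) t = 0"
    using eventually_nhds_imp_at[OF z] by eventually_elim simp
  moreover have "along m F (eval1 g) 0 = 0"
    using along_at_0[OF m0 eval1_analytic, of g F] g0 low[of 0 0] n2 by simp
  ultimately have "\<forall>\<^sub>F t in nhds 0. along m F (eval1 g) t = 0" by (simp add: eventually_nhds_conv_at)
  then show False
    using reduced_no_double_root[OF m0 g0 red W(2) V0(1) W(1)] z by (simp add: along_def)
qed

text \<open>
  With \<open>l\<close> and \<open>k\<close> the closest and second closest root to the polar branch \<open>\<gamma>\<close>, Rolle's theorem yields a root of
  \<open>\<partial>F/\<partial>Y\<close> as close to \<open>\<gamma>\<close> as the root \<open>k\<close>.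
\<close>

lemma FY_root_with_small_F:
  assumes g: "g \<in> set gs" and tg: "eval1 g \<in> O[at 0](\<lambda>t. t ^ Suc m)"
  shows "\<exists>j<n-1. along m F (D j) \<in> O[at 0](\<lambda>t. t ^ Suc m * along m FY (eval1 g) t)"
proof -
  define \<gamma> where "\<gamma> = eval1 g"
  have \<gamma>: "\<gamma> analytic_on {0}" "\<gamma> 0 = 0" using eval1_analytic zero(3)[OF g] by (auto simp: \<gamma>_def)
  have an: "(\<lambda>t. \<gamma> t - Y i t) analytic_on {0}" for i by (intro analytic_intros \<gamma> eval1_analytic)
  obtain l where l: "l < n" "\<And>i. i < n \<Longrightarrow> (\<lambda>t. \<gamma> t - Y l t) \<in> O[at 0](\<lambda>t. \<gamma> t - Y i t)"
    using bigo_minimum[of "{..<n}" "\<lambda>i t. \<gamma> t - Y i t"] an n2 by (auto simp: lessThan_empty_iff)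
  have "{..<n} - {l} \<noteq> {}"
  proof -
    have "(if l = 0 then 1 else 0) \<in> {..<n} - {l}" using n2 by auto
    then show ?thesis by blast
  qed
  then obtain k where k: "k < n" "k \<noteq> l" "\<And>i. i < n \<Longrightarrow> i \<noteq> l \<Longrightarrow> (\<lambda>t. \<gamma> t - Y k t) \<in> O[at 0](\<lambda>t. \<gamma> t - Y i t)"
    using bigo_minimum[of "{..<n} - {l}" "\<lambda>i t. \<gamma> t - Y i t"] an by auto
  \<comment> \<open>Rolle's theorem for the roots l and k at the scale R = \<gamma> - Y k, which
    bounds the distance of both from \<gamma>.\<close>
  obtain j where j: "j < n - 1" "(\<lambda>t. \<gamma> t - D j t) \<in> O[at 0](\<lambda>t. \<gamma> t - Y k t)"
    using rolle[OF l(1) k(1) k(2)[symmetric] \<gamma> an[of k] l(2)[OF k(1)] landau_o.big_refl] by blast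
  \<comment> \<open>\<open>D j - Y i\<close> is the difference of \<open>\<gamma> - Y i\<close> and
    \<open>\<gamma> - D j\<close>.\<close>
  have near: "(\<lambda>t. D j t - Y i t) \<in> O[at 0](h)"
    if "(\<lambda>t. \<gamma> t - Y i t) \<in> O[at 0](h)" "(\<lambda>t. \<gamma> t - Y k t) \<in> O[at 0](h)" for i h
    using sum_in_bigo(2)[OF that(1) landau_o.big_trans[OF j(2) that(2)]] by (simp add: algebra_simps)
  define P where "P t = (\<Prod>i\<in>{..<n}-{l}. \<gamma> t - Y i t)" for t
  have "(\<lambda>t. \<Prod>i\<in>{..<n}-{l}. D j t - Y i t) \<in> O[at 0](P)"
    unfolding P_def[abs_def]
    by (rule landau_o.big_prod) (use near k in auto)
  moreover have "(\<lambda>t. D j t - Y l t) \<in> O[at 0](\<lambda>t. \<gamma> t - Y k t)"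
    by (rule near[OF l(2)[OF k(1)] landau_o.big_refl])
  ultimately have "(\<lambda>t. (D j t - Y l t) * (\<Prod>i\<in>{..<n}-{l}. D j t - Y i t)) \<in> O[at 0](\<lambda>t. (\<gamma> t - Y k t) * P t)"
    by (rule landau_o.big.mult[rotated])
  moreover have "(D j t - Y l t) * (\<Prod>i\<in>{..<n}-{l}. D j t - Y i t) = (\<Prod>i<n. D j t - Y i t)" for t
    by (rule prod.remove[symmetric]) (use l in auto)
  ultimately have Dj: "along m F (D j) \<in> O[at 0](\<lambda>t. (\<gamma> t - Y k t) * P t)"
    using landau_o.big_trans[OF bigthetaD1[OF along_F_bigtheta[OF eval1_analytic root_zero(2)[OF j(1)]]]] by simp
  have "(\<lambda>t. (\<gamma> t - Y k t) * P t) \<in> O[at 0](\<lambda>t. t ^ Suc m * along m FY \<gamma> t)"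
    using bigo_dichotomy[OF an[of k] an[of l]]
  proof
    assume "(\<lambda>t. \<gamma> t - Y k t) \<in> O[at 0](\<lambda>t. \<gamma> t - Y l t)"
    then have "(\<lambda>t. (\<gamma> t - Y k t) * P t) \<in> O[at 0](\<lambda>t. (\<gamma> t - Y l t) * P t)"
      by (intro landau_o.big.mult landau_o.big_refl)
    also have "(\<lambda>t. (\<gamma> t - Y l t) * P t) = (\<lambda>t. \<Prod>i<n. \<gamma> t - Y i t)"
      unfolding P_def by (rule ext, rule prod.remove[symmetric]) (use l in auto)
    also have "(\<lambda>t. \<Prod>i<n. \<gamma> t - Y i t) \<in> O[at 0](along m F \<gamma>)"
      using along_F_bigtheta[OF \<gamma>] by (simp add: bigtheta_def bigomega_iff_bigo)
    also have "along m F \<gamma> \<in> O[at 0](\<lambda>t. \<gamma> t * along m FY \<gamma> t)"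
      using polar_branch_F_bound[OF g] by (simp add: \<gamma>_def)
    also have "(\<lambda>t. \<gamma> t * along m FY \<gamma> t) \<in> O[at 0](\<lambda>t. t ^ Suc m * along m FY \<gamma> t)"
      using tg unfolding \<gamma>_def by (intro landau_o.big.mult landau_o.big_refl)
    finally show ?thesis .
  next
    assume far: "(\<lambda>t. \<gamma> t - Y l t) \<in> O[at 0](\<lambda>t. t * (\<gamma> t - Y k t))"
    have "(\<lambda>t. \<gamma> t - Y l t) \<in> O[at 0](\<lambda>t. t * (\<gamma> t - Y i t))" if "i < n" "i \<noteq> l" for i
      using far by (rule landau_o.big_trans) (intro landau_o.big.mult landau_o.big_refl k(3) that)
    from FY_isolated_root_bound[OF \<gamma> l(1) this]
    have "P \<in> O[at 0](along m FY \<gamma>)" by (simp add: P_def[abs_def])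
    \<comment> \<open>Here the tangency of \<gamma> and of the root to Y = 0 enters.\<close>
    moreover have "(\<lambda>t. \<gamma> t - Y k t) \<in> O[at 0](\<lambda>t. t ^ Suc m)"
      using tg Y_bound[OF k(1)] unfolding \<gamma>_def by (intro sum_in_bigo)
    ultimately show ?thesis by (intro landau_o.big.mult)
  qed
  from landau_o.big_trans[OF Dj this] show ?thesis using j(1) by (auto simp: \<gamma>_def)
qed

text \<open>Along \<open>D j\<close> the Y-derivative vanishes, so t d/dt F is m t^m F_X there.
  Dividing the bound t^(m + 1 + p) for F by t^m leaves F_X one power of t smaller than F_Y on the
  polar branch.\<close>

lemma tangent_polar_branch:
  assumes g: "g \<in> set gs" and tg: "eval1 g \<in> O[at 0](\<lambda>t. t ^ Suc m)"
  shows "\<exists>p j. j < n - 1 \<and> along m FY (eval1 g) \<in> \<Theta>[at 0](\<lambda>t. t ^ p) \<and> along m FX (D j) \<in> O[at 0](\<lambda>t. t ^ Suc p)"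
proof -
  have g0: "eval1 g 0 = 0" using zero(3)[OF g] by simp
  obtain p where p: "along m FY (eval1 g) \<in> \<Theta>[at 0](\<lambda>t. t ^ p)"
    using analytic_order_at_0[OF along_analytic[OF m0 eval1_analytic g0, of FY]] polar_branch_FY_nonzero[OF g] by blast
  obtain j where j: "j < n - 1" "along m F (D j) \<in> O[at 0](\<lambda>t. t ^ Suc m * along m FY (eval1 g) t)"
    using FY_root_with_small_F[OF assms] by blast
  note D = eval1_analytic[of "ds ! j"] root_zero(2)[OF j(1)]
  have "\<forall>\<^sub>F t in nhds 0. t * deriv (along m F (D j)) t = of_nat m * (t ^ m * along m FX (D j) t)"
    using along_t_deriv[OF m0 D, of F] along_FY_root[OF j(1)] by eventually_elim simp
  note ev = eventually_nhds_imp_at[OF this]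
  have "(\<lambda>t. of_nat m * (t ^ m * along m FX (D j) t)) \<in> O[at 0](along m F (D j))"
    using bigo_t_deriv(1)[OF along_analytic[OF m0 D, of F]] unfolding landau_o.big.in_cong[OF ev] .
  then have "(\<lambda>t. t ^ m * along m FX (D j) t) \<in> O[at 0](along m F (D j))" using m0 by simp
  also note j(2)
  also have "(\<lambda>t. t ^ Suc m * along m FY (eval1 g) t) \<in> O[at 0](\<lambda>t. t ^ Suc m * t ^ p)"
    using p by (intro landau_o.big.mult landau_o.big_refl bigthetaD1)
  finally obtain K where K: "\<forall>\<^sub>F t in at 0. norm (t ^ m * along m FX (D j) t) \<le> K * norm (t ^ Suc m * t ^ p)"
    by (rule landau_o.bigE)
  have "\<forall>\<^sub>F t in at (0 :: complex). t \<noteq> 0" by (simp add: eventually_at_filter)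
  then have "\<forall>\<^sub>F t in at 0. norm (along m FX (D j) t) \<le> K * norm (t ^ Suc p)"
    using K
  proof eventually_elim
    case (elim t)
    have "norm t ^ m * norm (along m FX (D j) t) \<le> norm t ^ m * (K * norm (t ^ Suc p))"
      using elim(2) by (simp add: norm_mult norm_power mult_ac)
    then show ?case using elim(1) by simp
  qed
  then have "along m FX (D j) \<in> O[at 0](\<lambda>t. t ^ Suc p)" by (rule bigoI)
  with p j(1) show ?thesis by blast
qed

text \<open>Test the inequality on the curve \<open>D j\<close>: the gradient reduces to its
  X-component, O(t^q), while the point has norm at least |t|^m. If q exceeded m \<theta>, the
  positive constant c would be bounded by a quantity tending to 0.\<close>

lemma exponent_lower_bound:
  assumes \<theta>: "lojasiewicz_exponent F UNIV \<theta>" and j: "j < n - 1" and q: "along m FX (D j) \<in> O[at 0](\<lambda>t. t ^ q)"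
  shows "real q \<le> real m * \<theta>"
proof (rule ccontr)
  assume neg: "\<not> ?thesis"
  define a where "a = real q - real m * \<theta>"
  have a: "a > 0" using neg by (simp add: a_def)
  obtain c where c: "c > 0" "\<forall>\<^sub>F z in nhds 0. norm (grad2 F z) \<ge> c * norm z powr \<theta>" and \<theta>0: "\<theta> \<ge> 0"
    using \<theta> unfolding lojasiewicz_exponent_def by auto
  obtain K where K: "K > 0" "\<forall>\<^sub>F t in at 0. norm (along m FX (D j) t) \<le> K * norm (t ^ q)"
    using q by (rule landau_o.bigE)
  note D = eval1_analytic[of "ds ! j"] root_zero(2)[OF j]
  have "((\<lambda>t :: complex. K * norm t powr a) \<longlongrightarrow> K * norm (0 :: complex) powr a) (at 0)"
    using a by (intro tendsto_mult tendsto_const tendsto_powr' tendsto_norm tendsto_ident_at) auto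
  then have "\<forall>\<^sub>F t in at (0 :: complex). K * norm t powr a < c"
    by (rule order_tendstoD) (use c(1) in simp)
  moreover have "\<forall>\<^sub>F t in at (0 :: complex). t \<noteq> 0" by (simp add: eventually_at_filter)
  ultimately have "\<forall>\<^sub>F t in at (0 :: complex). False"
    using K(2) eventually_nhds_imp_at[OF eventually_along[OF m0 D c(2)]] eventually_nhds_imp_at[OF along_FY_root[OF j]]
  proof eventually_elim
    case (elim t)
    have t: "norm t > 0" using elim(2) by simp
    have "norm (grad2 F (t ^ m, D j t)) = norm (along m FX (D j) t)"
      using elim(5) by (simp add: grad2_def along_def norm_Pair)
    with elim(3,4) have 1: "c * norm (t ^ m, D j t) powr \<theta> \<le> K * norm t ^ q" by (simp add: norm_power)
    have "norm t ^ m \<le> norm (t ^ m, D j t)" using norm_fst_le[of "t ^ m" "D j t"] by (simp add: norm_power)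
    then have "(norm t ^ m) powr \<theta> \<le> norm (t ^ m, D j t) powr \<theta>" using \<theta>0 by (intro powr_mono2) auto
    moreover have "(norm t ^ m) powr \<theta> = norm t powr (real m * \<theta>)"
      using t by (simp add: powr_powr flip: powr_realpow)
    ultimately have "norm t powr (real m * \<theta>) \<le> norm (t ^ m, D j t) powr \<theta>" by simp
    then have "c * norm t powr (real m * \<theta>) \<le> c * norm (t ^ m, D j t) powr \<theta>"
      using c(1) by (intro mult_left_mono) auto
    with 1 have "c * norm t powr (real m * \<theta>) \<le> K * norm t ^ q" by linarith
    also have "norm t ^ q = norm t powr (real m * \<theta>) * norm t powr a"
      using t by (simp add: a_def flip: powr_realpow powr_add)
    finally have "c \<le> K * norm t powr a" using t by (simp add: mult_ac)
    with elim(1) show False by simp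
  qed
  then show False by simp
qed

text \<open>As n \<ge> 2 there is a root of F_Y to test on. Its points have norm O(t^m), so F_X, of
  order at least n, is O(t^(m n)) there.\<close>

lemma exponent_ge_order:
  assumes \<theta>: "lojasiewicz_exponent F UNIV \<theta>"
  shows "real n \<le> \<theta>"
proof -
  have j: "0 < n - 1" using n2 by simp
  note D = eval1_analytic[of "ds ! 0"] root_zero(2)[OF j]
  obtain C where C: "C \<ge> 0" "\<forall>\<^sub>F z in nhds 0. norm (eval2 FX z) \<le> C * norm z ^ n"
    using eval2_order_bound[of n FX] FX_order by blast
  have "D 0 \<in> O[at 0](\<lambda>t. t ^ m)"
    using D_bound[OF j] bigo_power_mono[of m "Suc m"] by (rule landau_o.big_trans) simp
  then obtain K where K: "K > 0" "\<forall>\<^sub>F t in at 0. norm (D 0 t) \<le> K * norm (t ^ m)" by (rule landau_o.bigE)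
  have "\<forall>\<^sub>F t in at 0. norm (along m FX (D 0) t) \<le> (C * (1 + K) ^ n) * norm (t ^ (m * n))"
    using K(2) eventually_nhds_imp_at[OF eventually_along[OF m0 D C(2)]]
  proof eventually_elim
    case (elim t)
    have "norm (t ^ m, D 0 t) \<le> (1 + K) * norm (t ^ m)"
      using norm_Pair_le[of "t ^ m" "D 0 t"] elim(1) by (simp add: algebra_simps)
    then have "norm (t ^ m, D 0 t) ^ n \<le> ((1 + K) * norm (t ^ m)) ^ n" by (intro power_mono) auto
    then have "C * norm (t ^ m, D 0 t) ^ n \<le> C * ((1 + K) * norm (t ^ m)) ^ n" using C(1) by (rule mult_left_mono)
    with elim(2) show ?case by (simp add: along_def power_mult_distrib power_mult norm_power mult.assoc)
  qed
  then have "along m FX (D 0) \<in> O[at 0](\<lambda>t. t ^ (m * n))" by (rule bigoI)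
  from exponent_lower_bound[OF \<theta> j this] show ?thesis using m0 by simp
qed

end

section \<open>Exponents on the polar curve and on the whole plane\<close>

context puiseux_data
begin

text \<open>Off the tangent the branch has exponent n - 1 while global exponents are at least n; on
  the tangent it has p / m against at least (p + 1) / m. The uniform gap 1 / m makes the final
  inequality of infima strict.\<close>

lemma branch_exponent:
  assumes g: "g \<in> set gs"
  shows "\<exists>q\<ge>0. (\<exists>c>0. \<forall>\<^sub>F t in nhds 0. norm (grad2 F (t ^ m, eval1 g t)) \<ge> c * norm (t ^ m, eval1 g t) powr q) \<and>
    (\<forall>\<theta>. lojasiewicz_exponent F UNIV \<theta> \<longrightarrow> q + 1 / real m \<le> \<theta>)"
proof -
  define \<gamma> where "\<gamma> = eval1 g"
  have \<gamma>: "\<gamma> analytic_on {0}" "\<gamma> 0 = 0" using eval1_analytic zero(3)[OF g] by (auto simp: \<gamma>_def)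
  have grad: "norm (grad2 F (t ^ m, \<gamma> t)) \<ge> norm (along m FY \<gamma> t)" for t
    unfolding grad2_def along_def by (rule norm_snd_le)
  have punctured: "\<forall>\<^sub>F t in at (0 :: complex). t \<noteq> 0" by (simp add: eventually_at_filter)
  \<comment> \<open>At t = 0 the right side is 0, because \<open>0 powr q = 0\<close> even for q =
    0; so estimates on a punctured neighbourhood extend to t = 0.\<close>
  have at0: "norm (grad2 F (0 ^ m, \<gamma> 0)) \<ge> c * norm (0 ^ m :: complex, \<gamma> 0) powr q" for c q
    using m0 \<gamma>(2) by (simp add: zero_power flip: zero_prod_def)
  have "(\<lambda>t. t ^ m) \<in> O[at 0](\<gamma>) \<or> \<gamma> \<in> O[at 0](\<lambda>t. t * t ^ m)"
    using bigo_dichotomy[OF power_analytic \<gamma>(1)] .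
  then show ?thesis
  proof
    assume "(\<lambda>t. t ^ m) \<in> O[at 0](\<gamma>)"
    then obtain K where K: "K > 0" "\<forall>\<^sub>F t in at 0. norm (t ^ m) \<le> K * norm (\<gamma> t)" by (rule landau_o.bigE)
    obtain c where c: "c > 0" "\<forall>\<^sub>F z in nhds 0. norm (fst z) \<le> K * norm (snd z) \<longrightarrow>
        norm (eval2 FY z) \<ge> c * norm (snd z) ^ (n - 1)"
      using eval2_cone_lower_bound[OF FY_low FY_tan FY_top, of K] K(1) by auto
    have "\<forall>\<^sub>F t in at 0. norm (grad2 F (t ^ m, \<gamma> t)) \<ge> (c / (K + 1) ^ (n - 1)) * norm (t ^ m, \<gamma> t) powr real (n - 1)"
      using K(2) eventually_nhds_imp_at[OF eventually_along[OF m0 \<gamma> c(2)]] punctured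
    proof eventually_elim
      case (elim t)
      have z: "norm (t ^ m, \<gamma> t) \<le> (K + 1) * norm (\<gamma> t)"
        using norm_Pair_le[of "t ^ m" "\<gamma> t"] elim(1) by (simp add: algebra_simps)
      have "norm (t ^ m, \<gamma> t) > 0" using elim(3) by (simp add: zero_prod_def)
      then have "norm (t ^ m, \<gamma> t) powr real (n - 1) = norm (t ^ m, \<gamma> t) ^ (n - 1)" by (rule powr_realpow)
      also have "\<dots> \<le> ((K + 1) * norm (\<gamma> t)) ^ (n - 1)" by (intro power_mono z) auto
      also have "\<dots> = (K + 1) ^ (n - 1) * norm (\<gamma> t) ^ (n - 1)" by (rule power_mult_distrib)
      finally have "(c / (K + 1) ^ (n - 1)) * norm (t ^ m, \<gamma> t) powr real (n - 1) \<le>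
          (c / (K + 1) ^ (n - 1)) * ((K + 1) ^ (n - 1) * norm (\<gamma> t) ^ (n - 1))"
        using c(1) K(1) by (intro mult_left_mono) auto
      also have "\<dots> = c * norm (\<gamma> t) ^ (n - 1)" using K(1) by simp
      also have "\<dots> \<le> norm (along m FY \<gamma> t)" using elim(1,2) by (simp add: along_def)
      also note grad
      finally show ?case .
    qed
    then have "\<forall>\<^sub>F t in nhds 0. norm (grad2 F (t ^ m, \<gamma> t)) \<ge> (c / (K + 1) ^ (n - 1)) * norm (t ^ m, \<gamma> t) powr real (n - 1)"
      unfolding eventually_nhds_conv_at using at0 by blast
    moreover have "c / (K + 1) ^ (n - 1) > 0" using c(1) K(1) by simp
    moreover have "real (n - 1) + 1 / real m \<le> \<theta>" if "lojasiewicz_exponent F UNIV \<theta>" for \<theta>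
    proof -
      have "1 / real m \<le> 1" using m0 by simp
      then show ?thesis using exponent_ge_order[OF that] n2 by simp
    qed
    ultimately show ?thesis unfolding \<gamma>_def by (intro exI[of _ "real (n - 1)"]) auto
  next
    assume "\<gamma> \<in> O[at 0](\<lambda>t. t * t ^ m)"
    then have tg: "\<gamma> \<in> O[at 0](\<lambda>t. t ^ Suc m)" by simp
    obtain p j where pj: "j < n - 1" "along m FY \<gamma> \<in> \<Theta>[at 0](\<lambda>t. t ^ p)" "along m FX (D j) \<in> O[at 0](\<lambda>t. t ^ Suc p)"
      using tangent_polar_branch[OF g] tg unfolding \<gamma>_def by blast
    have "\<gamma> \<in> O[at 0](\<lambda>t. t ^ m)" using tg bigo_power_mono[of m "Suc m"] by (rule landau_o.big_trans) simp
    then obtain K where K: "K > 0" "\<forall>\<^sub>F t in at 0. norm (\<gamma> t) \<le> K * norm (t ^ m)" by (rule landau_o.bigE)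
    have "(\<lambda>t. t ^ p) \<in> O[at 0](along m FY \<gamma>)" using pj(2) by (simp add: bigtheta_def bigomega_iff_bigo)
    then obtain B where B: "B > 0" "\<forall>\<^sub>F t in at 0. norm (t ^ p) \<le> B * norm (along m FY \<gamma> t)" by (rule landau_o.bigE)
    \<comment> \<open>Points of the branch have norm at most (1 + K) |t|^m, so order p in t becomes
      exponent p / m; \<open>c\<close> absorbs the constants of both comparisons.\<close>
    define q where "q = real p / real m"
    define c where "c = 1 / (B * (1 + K) powr q)"
    have c: "c > 0" using B K by (simp add: c_def)
    have "\<forall>\<^sub>F t in at 0. norm (grad2 F (t ^ m, \<gamma> t)) \<ge> c * norm (t ^ m, \<gamma> t) powr q"
      using K(2) B(2) punctured
    proof eventually_elim
      case (elim t)
      have t: "norm t > 0" using elim(3) by simp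
      have z: "norm (t ^ m, \<gamma> t) \<le> (1 + K) * norm t ^ m"
        using norm_Pair_le[of "t ^ m" "\<gamma> t"] elim(1) by (simp add: algebra_simps norm_power)
      then have "norm (t ^ m, \<gamma> t) powr q \<le> ((1 + K) * norm t ^ m) powr q"
        by (intro powr_mono2) (auto simp: q_def)
      also have "\<dots> = (1 + K) powr q * norm t ^ p"
        using t K(1) m0 by (simp add: powr_mult powr_powr q_def flip: powr_realpow)
      finally have "c * norm (t ^ m, \<gamma> t) powr q \<le> c * ((1 + K) powr q * norm t ^ p)"
        using c by (intro mult_left_mono) auto
      also have "\<dots> = norm t ^ p / B" using K(1) by (simp add: c_def)
      also have "\<dots> \<le> norm (along m FY \<gamma> t)" using elim(2) B(1) by (simp add: norm_power field_simps)
      also note grad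
      finally show ?case .
    qed
    then have "\<forall>\<^sub>F t in nhds 0. norm (grad2 F (t ^ m, \<gamma> t)) \<ge> c * norm (t ^ m, \<gamma> t) powr q"
      unfolding eventually_nhds_conv_at using at0 by blast
    moreover have "q + 1 / real m \<le> \<theta>" if "lojasiewicz_exponent F UNIV \<theta>" for \<theta>
      using exponent_lower_bound[OF that pj(1,3)] m0 by (simp add: q_def field_simps)
    ultimately show ?thesis using c unfolding \<gamma>_def by (intro exI[of _ q]) (auto simp: q_def)
  qed
qed

text \<open>Near the origin every point of the polar curve lies on one of finitely many branches, so
  the largest branch exponent works on the whole curve. The branch attaining it supplies the gap to
  all global exponents.\<close>

theorem polar_exponent_less: "lojasiewicz_on F (polar_curve F param) < lojasiewicz F"
proof -
  from bchoice[OF ballI[OF branch_exponent]] obtain q where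
    q': "\<forall>g\<in>set gs. q g \<ge> 0 \<and>
      (\<exists>c>0. \<forall>\<^sub>F t in nhds 0. norm (grad2 F (t ^ m, eval1 g t)) \<ge> c * norm (t ^ m, eval1 g t) powr q g) \<and>
      (\<forall>\<theta>. lojasiewicz_exponent F UNIV \<theta> \<longrightarrow> q g + 1 / real m \<le> \<theta>)" ..
  have q: "q g \<ge> 0"
    "\<exists>c>0. \<forall>\<^sub>F t in nhds 0. norm (grad2 F (t ^ m, eval1 g t)) \<ge> c * norm (t ^ m, eval1 g t) powr q g"
    "lojasiewicz_exponent F UNIV \<theta> \<Longrightarrow> q g + 1 / real m \<le> \<theta>" if "g \<in> set gs" for g \<theta>
    using bspec[OF q' that] by auto
  from bchoice[OF ballI[OF q(2)]] obtain c where
    c': "\<forall>g\<in>set gs. c g > 0 \<and>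
      (\<forall>\<^sub>F t in nhds 0. norm (grad2 F (t ^ m, eval1 g t)) \<ge> c g * norm (t ^ m, eval1 g t) powr q g)" ..
  have c: "c g > 0" "\<forall>\<^sub>F t in nhds 0. norm (grad2 F (t ^ m, eval1 g t)) \<ge> c g * norm (t ^ m, eval1 g t) powr q g"
    if "g \<in> set gs" for g using bspec[OF c' that] by auto
  have ne: "set gs \<noteq> {}" using len(3) n2 by auto
  define q1 where "q1 = Max (q ` set gs)"
  define c1 where "c1 = Min (c ` set gs)"
  have q1: "q g \<le> q1" if "g \<in> set gs" for g using that by (simp add: q1_def)
  have c1: "c1 > 0" "\<And>g. g \<in> set gs \<Longrightarrow> c1 \<le> c g" using c(1) ne by (auto simp: c1_def)
  have "q1 \<in> q ` set gs" unfolding q1_def using ne by (intro Max_in) auto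
  then obtain g1 where g1: "g1 \<in> set gs" "q1 = q g1" by blast
  have "lojasiewicz_exponent F (polar_curve F param) q1"
    unfolding lojasiewicz_exponent_def
  proof (intro conjI exI[of _ c1])
    show "0 \<le> q1" using g1 q(1) by simp
    show "c1 > 0" by (rule c1)
    have "\<forall>\<^sub>F t in nhds 0. \<forall>g\<in>set gs. norm (grad2 F (t ^ m, eval1 g t)) \<ge> c g * norm (t ^ m, eval1 g t) powr q g"
      using c(2) by (intro eventually_ball_finite) auto
    then obtain r1 where r1: "r1 > 0" "\<And>t g. norm t < r1 \<Longrightarrow> g \<in> set gs \<Longrightarrow>
        norm (grad2 F (t ^ m, eval1 g t)) \<ge> c g * norm (t ^ m, eval1 g t) powr q g"
      unfolding eventually_nhds_metric by (auto simp: dist_norm)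
    obtain r2 where r2: "r2 > 0" "\<And>x y. norm x < r2 \<Longrightarrow> norm y < r2 \<Longrightarrow>
        eval2 J (x ^ m, y) = eval2 VG (x ^ m, y) * (\<Prod>i<n. y - eval1 (gs ! i) x)"
      using eventually_nhds_prodD[OF prodJ] by auto
    have "\<forall>\<^sub>F z in nhds 0. eval2 VG z \<noteq> 0"
      using isCont_tendsto_nhds[OF eval2_continuous_at_0[of VG]] V0(3) tendsto_imp_eventually_ne by force
    then obtain r3 where r3: "r3 > 0" "\<And>x y. norm x < r3 \<Longrightarrow> norm y < r3 \<Longrightarrow> eval2 VG (x, y) \<noteq> 0"
      using eventually_nhds_prodD by blast
    \<comment> \<open>The bound 1/2 keeps the norm of (x, y) at most 1, so raising the exponent to
      \<open>q1\<close> only lowers the power.\<close>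
    define r where "r = Min {1 / 2, r1, r2, r3}"
    have r: "r > 0" "r \<le> 1 / 2" "r \<le> r1" "r \<le> r2" "r \<le> r3" using r1 r2 r3 by (auto simp: r_def)
    show "\<forall>\<^sub>F z in nhds 0. z \<in> polar_curve F param \<longrightarrow> c1 * norm z powr q1 \<le> norm (grad2 F z)"
    proof (rule eventually_nhds_prodI[of "r ^ m"])
      show "r ^ m > 0" using r by simp
      fix x y :: complex assume xy: "norm x < r ^ m" "norm y < r ^ m"
      have rm: "r ^ m \<le> r" using r m0 power_decreasing[of 1 m r] by simp
      show "(x, y) \<in> polar_curve F param \<longrightarrow> c1 * norm (x, y) powr q1 \<le> norm (grad2 F (x, y))"
      proof
        assume "(x, y) \<in> polar_curve F param"
        then have J0: "eval2 J (x, y) = 0" by (simp add: polar_curve_def J_def)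
        \<comment> \<open>Any m-th root of x will do: the product formula holds for all small
          t.\<close>
        obtain t where t: "x = t ^ m" using exists_complex_root[of m x] m0 by auto
        have tr: "norm t < r" using power_less_imp_less_base[of "norm t" m r] xy(1) r(1) by (simp add: t norm_power)
        have "(\<Prod>i<n. y - eval1 (gs ! i) t) = 0"
          using r2(2)[of t y] r3(2)[of x y] J0 t tr xy r rm by simp
        then obtain k where k: "k < n" "y = eval1 (gs ! k) t" by auto
        let ?g = "gs ! k"
        have g: "?g \<in> set gs" using k len(3) by simp
        have "norm (x, y) \<le> norm x + norm y" by (rule norm_Pair_le)
        also have "\<dots> \<le> 1" using xy rm r by linarith
        finally have z1: "norm (x, y) \<le> 1" .
        have "c1 * norm (x, y) powr q1 \<le> c ?g * norm (x, y) powr q ?g"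
          using c1(2)[OF g] c(1)[OF g] q1[OF g] z1 by (intro mult_mono powr_mono') auto
        also have "\<dots> \<le> norm (grad2 F (x, y))"
          using r1(2)[of t ?g] tr r g t k by simp
        finally show "c1 * norm (x, y) powr q1 \<le> norm (grad2 F (x, y))" .
      qed
    qed
  qed
  then have "lojasiewicz_on F (polar_curve F param) \<le> ereal q1"
    unfolding lojasiewicz_on_eq by (intro Inf_lower) auto
  also have "ereal q1 < ereal (q1 + 1 / real m)" using m0 by simp
  also have "ereal (q1 + 1 / real m) \<le> lojasiewicz F"
    unfolding lojasiewicz_def lojasiewicz_on_eq using q(3)[OF g1(1)] g1(2) by (intro Inf_greatest) auto
  finally show ?thesis .
qed

end

context unitangent_normal
begin

theorem polar_exponent_less: "lojasiewicz_on F (polar_curve F param) < lojasiewicz F"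
proof -
  obtain W V mF where F: "lead_coeff W = 1" "coeff2 V 0 0 \<noteq> 0" "F = V * emb W" "mF > 0"
    and mF: "\<And>m. m > 0 \<Longrightarrow> mF dvd m \<Longrightarrow> \<exists>ys. length ys = n \<and> (\<forall>y\<in>set ys. coeff1 y 0 = 0) \<and> ramp m W = root_prod ys \<and>
      (\<forall>\<^sub>F z in nhds 0. eval2 F (fst z ^ m, snd z) = eval2 V (fst z ^ m, snd z) * (\<Prod>i<n. snd z - eval1 (ys ! i) (fst z)))"
  proof -
    have "coeff2 F 0 j = 0" if "j < n" for j using low[of 0 j] that by simp
    from puiseux_roots[OF this top] show thesis using that by blast
  qed
  obtain WD VD mD where FY: "coeff2 VD 0 0 \<noteq> 0" "mD > 0"
    and mD: "\<And>m. m > 0 \<Longrightarrow> mD dvd m \<Longrightarrow> \<exists>ys. length ys = n - 1 \<and> (\<forall>y\<in>set ys. coeff1 y 0 = 0) \<and> ramp m WD = root_prod ys \<and>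
      (\<forall>\<^sub>F z in nhds 0. eval2 FY (fst z ^ m, snd z) = eval2 VD (fst z ^ m, snd z) * (\<Prod>i<n-1. snd z - eval1 (ys ! i) (fst z)))"
  proof -
    have "coeff2 FY 0 j = 0" if "j < n - 1" for j using FY_low[of 0 j] that by simp
    from puiseux_roots[OF this FY_top] show thesis using that by blast
  qed
  obtain WG VG mG where J: "coeff2 VG 0 0 \<noteq> 0" "mG > 0"
    and mG: "\<And>m. m > 0 \<Longrightarrow> mG dvd m \<Longrightarrow> \<exists>ys. length ys = n \<and> (\<forall>y\<in>set ys. coeff1 y 0 = 0) \<and> ramp m WG = root_prod ys \<and>
      (\<forall>\<^sub>F z in nhds 0. eval2 J (fst z ^ m, snd z) = eval2 VG (fst z ^ m, snd z) * (\<Prod>i<n. snd z - eval1 (ys ! i) (fst z)))"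
    using puiseux_roots[OF J_low J_top] by blast
  \<comment> \<open>A common ramification index, so that the roots of all three series are series in
    the same t.\<close>
  define m where "m = mF * mD * mG"
  have m: "m > 0" "mF dvd m" "mD dvd m" "mG dvd m" using F(4) FY(2) J(2) by (auto simp: m_def)
  obtain ys where ys: "length ys = n" "\<And>y. y \<in> set ys \<Longrightarrow> coeff1 y 0 = 0" "ramp m W = root_prod ys"
      "\<forall>\<^sub>F z in nhds 0. eval2 F (fst z ^ m, snd z) = eval2 V (fst z ^ m, snd z) * (\<Prod>i<n. snd z - eval1 (ys ! i) (fst z))"
    using mF[OF m(1,2)] by blast
  obtain ds where ds: "length ds = n - 1" "\<And>y. y \<in> set ds \<Longrightarrow> coeff1 y 0 = 0"
      "\<forall>\<^sub>F z in nhds 0. eval2 FY (fst z ^ m, snd z) = eval2 VD (fst z ^ m, snd z) * (\<Prod>i<n-1. snd z - eval1 (ds ! i) (fst z))"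
    using mD[OF m(1,3)] by blast
  obtain gs where gs: "length gs = n" "\<And>y. y \<in> set gs \<Longrightarrow> coeff1 y 0 = 0"
      "\<forall>\<^sub>F z in nhds 0. eval2 J (fst z ^ m, snd z) = eval2 VG (fst z ^ m, snd z) * (\<Prod>i<n. snd z - eval1 (gs ! i) (fst z))"
    using mG[OF m(1,4)] by blast
  interpret puiseux_data F n m ys ds gs W V VD VG
    by unfold_locales (use m F FY J ys ds gs in auto)
  show ?thesis by (rule polar_exponent_less)
qed

end

section \<open>Linear changes of coordinates\<close>

definition lin :: "complex \<Rightarrow> complex \<Rightarrow> complex \<Rightarrow> complex \<Rightarrow> complex \<times> complex \<Rightarrow> complex \<times> complex" where
  "lin p p' q q' z = (p * fst z + p' * snd z, q * fst z + q' * snd z)"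

lemma norm_lin_le: "norm (lin p p' q q' z) \<le> (norm p + norm p' + norm q + norm q') * norm z"
proof -
  have "norm (fst z) \<le> norm z" "norm (snd z) \<le> norm z"
    using norm_fst_le[of "fst z" "snd z"] norm_snd_le[of "snd z" "fst z"] by simp_all
  then have b: "norm (a * fst z) \<le> norm a * norm z" "norm (a * snd z) \<le> norm a * norm z" for a
    by (simp_all add: norm_mult mult_left_mono)
  have "norm (lin p p' q q' z) \<le> norm (p * fst z + p' * snd z) + norm (q * fst z + q' * snd z)"
    unfolding lin_def by (rule norm_Pair_le)
  also have "\<dots> \<le> (norm (p * fst z) + norm (p' * snd z)) + (norm (q * fst z) + norm (q' * snd z))"
    by (intro add_mono norm_triangle_ineq)
  also have "\<dots> \<le> (norm p * norm z + norm p' * norm z) + (norm q * norm z + norm q' * norm z)"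
    by (intro add_mono b)
  finally show ?thesis by (simp add: algebra_simps)
qed

lemma lin_tendsto: "filterlim (lin p p' q q') (nhds 0) (nhds 0)"
proof -
  have "isCont (lin p p' q q') 0" unfolding lin_def[abs_def] by (intro continuous_intros)
  from isCont_tendsto_nhds[OF this] show ?thesis by (simp add: lin_def zero_prod_def)
qed

lemmas eventually_lin = eventually_compose_filterlim[OF _ lin_tendsto]

section \<open>Linear substitution in power series\<close>

lemma eval2_by_degree:
  assumes conv: "converges_on f r" and x: "norm x \<le> r" and y: "norm y \<le> r"
  shows "eval2 f (x, y) = (\<Sum>\<^sub>\<infinity>d. \<Sum>a\<le>d. coeff2 f a (d - a) * x ^ a * y ^ (d - a))"
proof -
  let ?h = "\<lambda>(a, b). coeff2 f a b * x ^ a * y ^ b"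
  let ?S = "Sigma UNIV (\<lambda>d :: nat. {..d})"
  \<comment> \<open>Terms are grouped by total degree d, because a linear substitution acts within
    each degree.\<close>
  have bij: "bij_betw (\<lambda>(d, a). (a, d - a)) ?S UNIV"
    by (rule bij_betwI[of _ _ _ "\<lambda>(a, b). (a + b, a)"]) auto
  have s: "?h summable_on UNIV" using eval2_summable[OF assms] .
  have eq: "(\<lambda>p. ?h ((\<lambda>(d, a). (a, d - a)) p)) = (\<lambda>(d, a). coeff2 f a (d - a) * x ^ a * y ^ (d - a))"
    by (auto simp: fun_eq_iff)
  have "(\<lambda>p. ?h ((\<lambda>(d, a). (a, d - a)) p)) summable_on ?S"
    using summable_on_reindex_bij_betw[OF bij, of ?h] s by blast
  then have s': "(\<lambda>(d, a). coeff2 f a (d - a) * x ^ a * y ^ (d - a)) summable_on ?S" unfolding eq .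
  have "eval2 f (x, y) = infsum ?h UNIV" by (simp add: eval2_def)
  also have "\<dots> = infsum (\<lambda>p. ?h ((\<lambda>(d, a). (a, d - a)) p)) ?S"
    by (rule infsum_reindex_bij_betw[OF bij, symmetric])
  also have "\<dots> = infsum (\<lambda>(d, a). coeff2 f a (d - a) * x ^ a * y ^ (d - a)) ?S" unfolding eq ..
  also have "\<dots> = (\<Sum>\<^sub>\<infinity>d. \<Sum>\<^sub>\<infinity>a\<in>{..d}. coeff2 f a (d - a) * x ^ a * y ^ (d - a))"
    by (rule infsum_Sigma'_banach[OF s', symmetric])
  finally show ?thesis by simp
qed

text \<open>The homogenisation of \<open>P\<close> in degree \<open>d\<close>, where \<open>P\<close> is a polynomial in \<open>Y / X\<close>.\<close>

definition homogenize :: "nat \<Rightarrow> complex poly \<Rightarrow> complex \<Rightarrow> complex \<Rightarrow> complex" where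
  "homogenize d P x y = (\<Sum>a\<le>d. coeff P (d - a) * x ^ a * y ^ (d - a))"

lemma homogenize_linear_mult:
  assumes "degree P \<le> d"
  shows "homogenize (Suc d) ([:u, v:] * P) x y = (u * x + v * y) * homogenize d P x y"
proof -
  have c: "coeff ([:u, v:] * P) k = u * coeff P k + (if k = 0 then 0 else v * coeff P (k - 1))" for k
    by (cases k) auto
  have "homogenize (Suc d) ([:u, v:] * P) x y =
      (\<Sum>a\<le>Suc d. u * coeff P (Suc d - a) * x ^ a * y ^ (Suc d - a)) +
      (\<Sum>a\<le>Suc d. (if Suc d - a = 0 then 0 else v * coeff P (Suc d - a - 1)) * x ^ a * y ^ (Suc d - a))"
    unfolding homogenize_def c sum.distrib[symmetric] by (intro sum.cong) (auto simp: algebra_simps)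
  also have "(\<Sum>a\<le>Suc d. u * coeff P (Suc d - a) * x ^ a * y ^ (Suc d - a)) = u * x * homogenize d P x y"
    using assms unfolding homogenize_def sum.atMost_Suc_shift by (simp add: coeff_eq_0 sum_distrib_left mult_ac)
  also have "(\<Sum>a\<le>Suc d. (if Suc d - a = 0 then 0 else v * coeff P (Suc d - a - 1)) * x ^ a * y ^ (Suc d - a))
      = v * y * homogenize d P x y"
    unfolding homogenize_def sum.atMost_Suc sum_distrib_left
    by (simp, intro sum.cong) (auto simp: Suc_diff_le mult_ac)
  finally show ?thesis by (simp add: algebra_simps)
qed

lemma degree_linear_product: "degree ([:p, p':] ^ i * [:q, q':] ^ j) \<le> i + j" for p :: "'a :: comm_ring_1"
proof -
  have "degree ([:p, p':] ^ i * [:q, q':] ^ j) \<le> degree ([:p, p':] ^ i) + degree ([:q, q':] ^ j)" by (rule degree_mult_le)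
  also have "\<dots> \<le> degree [:p, p':] * i + degree [:q, q':] * j" by (intro add_mono degree_power_le)
  also have "\<dots> \<le> 1 * i + 1 * j" by (intro add_mono mult_right_mono) auto
  finally show ?thesis by simp
qed

lemma homogenize_linear_product:
  "homogenize (i + j) ([:p, p':] ^ i * [:q, q':] ^ j) x y = (p * x + p' * y) ^ i * (q * x + q' * y) ^ j"
proof (induction i)
  case 0
  show ?case
  proof (induction j)
    case 0
    show ?case by (simp add: homogenize_def)
  next
    case (Suc j)
    have "degree ([:q, q':] ^ j) \<le> j" using degree_linear_product[of 0 0 0 q q' j] by simp
    from homogenize_linear_mult[OF this] Suc show ?case by simp
  qed
next
  case (Suc i)
  from homogenize_linear_mult[OF degree_linear_product[of p p' i q q' j], of p p'] Suc show ?case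
    by (simp only: power_Suc mult.assoc add_Suc)
qed

text \<open>Multiplication by u + v Y enlarges the maximal coefficient by a factor of at most |u| +
  |v|.\<close>

lemma coeff_linear_product_bound:
  assumes K: "norm p + norm p' \<le> K" "norm q + norm q' \<le> K"
  shows "norm (coeff ([:p, p':] ^ i * [:q, q':] ^ j :: complex poly) b) \<le> K ^ (i + j)"
proof -
  have step: "norm (coeff ([:u, v:] * P) b) \<le> K * B"
    if uv: "norm u + norm v \<le> K" and B: "\<And>b. norm (coeff P b) \<le> B" for u v :: complex and P B b
  proof -
    have B0: "B \<ge> 0" using B[of 0] norm_ge_zero order_trans by blast
    have "norm (coeff ([:u, v:] * P) b) \<le> norm u * B + norm v * B"
    proof (cases b)
      case 0
      then show ?thesis using B[of 0] B0 by (auto simp: norm_mult mult_left_mono intro: add_increasing2)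
    next
      case (Suc c)
      have "norm (u * coeff P b + v * coeff P c) \<le> norm u * norm (coeff P b) + norm v * norm (coeff P c)"
        by (metis norm_mult norm_triangle_ineq)
      also have "\<dots> \<le> norm u * B + norm v * B" using B by (intro add_mono mult_left_mono) auto
      finally show ?thesis using Suc by simp
    qed
    also have "\<dots> \<le> K * B" using uv B0 by (simp add: mult_right_mono flip: distrib_right)
    finally show ?thesis .
  qed
  show ?thesis
  proof (induction i arbitrary: b)
    case 0
    show ?case
    proof (induction j arbitrary: b)
      case (Suc j)
      from step[OF K(2) Suc, of b] show ?case by simp
    qed (auto simp: coeff_1)
  next
    case (Suc i)
    from step[OF K(1) Suc, of b] show ?case by (simp only: power_Suc mult.assoc add_Suc)
  qed
qed

text \<open>In degree d each new coefficient is a sum of d + 1 old ones with weights bounded by K^d,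
  and d + 1 \<le> 2^d keeps the growth geometric. The explicit formula is part of the statement
  because initial forms are later computed from it.\<close>

theorem linear_substitution_exists:
  "\<exists>g. (\<forall>a b. coeff2 g a b = (\<Sum>i\<le>a+b. coeff2 f i (a + b - i) * coeff ([:p, p':] ^ i * [:q, q':] ^ (a + b - i)) b)) \<and>
     (\<forall>\<^sub>F z in nhds 0. eval2 g z = eval2 f (lin p p' q q' z))"
proof -
  obtain C R where CR: "C \<ge> 0" "R > 0" "\<And>i j. norm (coeff2 f i j) \<le> C * R ^ (i + j)"
    using coeff2_bound by blast
  define K where "K = norm p + norm p' + norm q + norm q' + 1"
  have K: "norm p + norm p' \<le> K" "norm q + norm q' \<le> K" "K > 0" by (auto simp: K_def add_nonneg_pos)
  have "\<exists>g. \<forall>a b. coeff2 g a b = (\<Sum>i\<le>a+b. coeff2 f i (a + b - i) * coeff ([:p, p':] ^ i * [:q, q':] ^ (a + b - i)) b)"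
  proof (rule exists_cps2[of C "2 * (R * K)"])
    fix a b
    have "norm (\<Sum>i\<le>a+b. coeff2 f i (a + b - i) * coeff ([:p, p':] ^ i * [:q, q':] ^ (a + b - i)) b) \<le>
        (\<Sum>i\<le>a+b. (C * R ^ (a + b)) * K ^ (a + b))"
    proof (rule sum_norm_le)
      fix i assume "i \<in> {..a + b}"
      then have "i + (a + b - i) = a + b" by simp
      then show "norm (coeff2 f i (a + b - i) * coeff ([:p, p':] ^ i * [:q, q':] ^ (a + b - i)) b) \<le> (C * R ^ (a + b)) * K ^ (a + b)"
        using CR(3)[of i "a + b - i"] coeff_linear_product_bound[OF K(1,2), of i "a + b - i" b] CR K
        unfolding norm_mult by (intro mult_mono) auto
    qed
    also have "\<dots> = real (Suc (a + b)) * (C * (R * K) ^ (a + b))" by (simp add: power_mult_distrib mult.assoc)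
    also have "\<dots> \<le> 2 ^ (a + b) * (C * (R * K) ^ (a + b))"
      using CR K by (intro mult_right_mono Suc_le_two_power) auto
    also have "\<dots> = C * (2 * (R * K)) ^ (a + b)" by (simp only: power_mult_distrib mult_ac)
    finally show "norm (\<Sum>i\<le>a+b. coeff2 f i (a + b - i) * coeff ([:p, p':] ^ i * [:q, q':] ^ (a + b - i)) b) \<le> C * (2 * (R * K)) ^ (a + b)" .
  qed (use CR K in auto)
  then obtain g where g: "\<And>a b. coeff2 g a b = (\<Sum>i\<le>a+b. coeff2 f i (a + b - i) * coeff ([:p, p':] ^ i * [:q, q':] ^ (a + b - i)) b)"
    by blast
  have "\<forall>\<^sub>F r in at_right 0. converges_on f r \<and> converges_on g r"
    by (intro eventually_conj eventually_converges_on)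
  then obtain r where r: "r > 0" "converges_on f r" "converges_on g r"
    using eventually_at_right_0_obtain by blast
  have "\<forall>\<^sub>F z in nhds (0 :: complex \<times> complex). norm z < r"
    using r(1) eventually_nhds_metric[of _ "0 :: complex \<times> complex"] by auto
  then have "\<forall>\<^sub>F z in nhds 0. eval2 g z = eval2 f (lin p p' q q' z)"
    using eventually_lin[OF \<open>\<forall>\<^sub>F z in nhds (0 :: complex \<times> complex). norm z < r\<close>, of p p' q q']
  proof eventually_elim
    case (elim z)
    obtain x y where z: "z = (x, y)" by (cases z)
    define x' y' where "x' = p * x + p' * y" and "y' = q * x + q' * y"
    have w: "lin p p' q q' z = (x', y')" by (simp add: lin_def z x'_def y'_def)
    have "norm x \<le> norm z" "norm y \<le> norm z" "norm x' \<le> norm (x', y')" "norm y' \<le> norm (x', y')"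
      unfolding z by (simp_all add: norm_fst_le norm_snd_le)
    then have s: "norm x \<le> r" "norm y \<le> r" "norm x' \<le> r" "norm y' \<le> r" using elim unfolding w by linarith+
    have "(\<Sum>a\<le>d. coeff2 g a (d - a) * x ^ a * y ^ (d - a)) = (\<Sum>i\<le>d. coeff2 f i (d - i) * x' ^ i * y' ^ (d - i))" for d
    proof -
      have "(\<Sum>a\<le>d. coeff2 g a (d - a) * x ^ a * y ^ (d - a)) =
          (\<Sum>a\<le>d. \<Sum>i\<le>d. coeff2 f i (d - i) * (coeff ([:p, p':] ^ i * [:q, q':] ^ (d - i)) (d - a) * x ^ a * y ^ (d - a)))"
        by (intro sum.cong refl) (simp add: g sum_distrib_right mult.assoc)
      also have "\<dots> = (\<Sum>i\<le>d. coeff2 f i (d - i) * homogenize (i + (d - i)) ([:p, p':] ^ i * [:q, q':] ^ (d - i)) x y)"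
        by (subst sum.swap) (simp add: homogenize_def sum_distrib_left)
      also have "\<dots> = (\<Sum>i\<le>d. coeff2 f i (d - i) * x' ^ i * y' ^ (d - i))"
        unfolding homogenize_linear_product by (simp add: x'_def y'_def mult.assoc)
      finally show ?thesis .
    qed
    then show ?case
      unfolding w unfolding z eval2_by_degree[OF r(3) s(1,2)] eval2_by_degree[OF r(2) s(3,4)] by simp
  qed
  with g show ?thesis by blast
qed

text \<open>The chain rule: gradients transform by the transposed matrix, hence the order
  \<open>p q p' q'\<close>.\<close>

lemma grad2_lin:
  assumes "\<forall>\<^sub>F z in nhds 0. eval2 g z = eval2 f (lin p p' q q' z)"
  shows "\<forall>\<^sub>F z in nhds 0. grad2 g z = lin p q p' q' (grad2 f (lin p p' q q' z))"
proof -
  obtain r1 where r1: "r1 > 0" "\<And>x y. norm x < r1 \<Longrightarrow> norm y < r1 \<Longrightarrow> eval2 g (x, y) = eval2 f (lin p p' q q' (x, y))"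
    using eventually_nhds_prodD[OF assms] by blast
  obtain r2 where r2: "r2 > 0" "\<And>x y. norm x < r2 \<Longrightarrow> norm y < r2 \<Longrightarrow>
      ((\<lambda>x. eval2 g (x, y)) has_field_derivative eval2 (deriv_X g) (x, y)) (at x)"
    using eval2_deriv_X by blast
  obtain r3 where r3: "r3 > 0" "\<And>x y. norm x < r3 \<Longrightarrow> norm y < r3 \<Longrightarrow>
      ((\<lambda>y. eval2 g (x, y)) has_field_derivative eval2 (deriv_Y g) (x, y)) (at y)"
    using eval2_deriv_Y by blast
  obtain r4 where r4: "r4 > 0" "\<And>a b a' b' t. norm (a t) < r4 \<Longrightarrow> norm (b t) < r4 \<Longrightarrow>
     (a has_field_derivative a') (at t) \<Longrightarrow> (b has_field_derivative b') (at t) \<Longrightarrow>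
     ((\<lambda>t. eval2 f (a t, b t)) has_field_derivative
        eval2 (deriv_X f) (a t, b t) * a' + eval2 (deriv_Y f) (a t, b t) * b') (at t)"
    using eval2_chain[of f] by blast
  have "\<forall>\<^sub>F z in nhds (0 :: complex \<times> complex). norm z < r4"
    using r4(1) eventually_nhds_metric[of _ "0 :: complex \<times> complex"] by auto
  from eventually_lin[OF this] obtain r5 where r5: "r5 > 0"
    "\<And>x y. norm x < r5 \<Longrightarrow> norm y < r5 \<Longrightarrow> norm (lin p p' q q' (x, y)) < r4"
    using eventually_nhds_prodD by blast
  define r where "r = Min {r1, r2, r3, r5}"
  have r: "r > 0" "r \<le> r1" "r \<le> r2" "r \<le> r3" "r \<le> r5" using r1 r2 r3 r5 by (auto simp: r_def)
  show ?thesis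
  proof (rule eventually_nhds_prodI[OF r(1)])
    fix x y :: complex assume xy: "norm x < r" "norm y < r"
    have sm: "norm (lin p p' q q' (x, y)) < r4" using r5(2) xy r by simp
    have "norm (p * x + p' * y) \<le> norm (lin p p' q q' (x, y))" "norm (q * x + q' * y) \<le> norm (lin p p' q q' (x, y))"
      unfolding lin_def fst_conv snd_conv by (rule norm_fst_le, rule norm_snd_le)
    with sm have s: "norm (p * x + p' * y) < r4" "norm (q * x + q' * y) < r4" by auto
    have bx: "\<forall>\<^sub>F u in nhds x. u \<in> ball 0 r" "\<forall>\<^sub>F u in nhds y. u \<in> ball 0 r"
      by (rule eventually_nhds_in_open; use xy in simp)+
    have "((\<lambda>x. eval2 f (p * x + p' * y, q * x + q' * y)) has_field_derivative
        eval2 (deriv_X f) (p * x + p' * y, q * x + q' * y) * p + eval2 (deriv_Y f) (p * x + p' * y, q * x + q' * y) * q) (at x)"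
      by (rule r4(2)) (use s in \<open>auto intro!: derivative_eq_intros\<close>)
    moreover have "\<forall>\<^sub>F u in nhds x. eval2 f (p * u + p' * y, q * u + q' * y) = eval2 g (u, y)"
      using bx(1) by eventually_elim (use r1(2) xy r in \<open>simp add: lin_def\<close>)
    ultimately have "((\<lambda>x. eval2 g (x, y)) has_field_derivative
        eval2 (deriv_X f) (p * x + p' * y, q * x + q' * y) * p + eval2 (deriv_Y f) (p * x + p' * y, q * x + q' * y) * q) (at x)"
      by (subst (asm) DERIV_cong_ev[OF refl _ refl])
    moreover have "((\<lambda>x. eval2 g (x, y)) has_field_derivative eval2 (deriv_X g) (x, y)) (at x)"
      using r2(2) xy r by simp
    ultimately have 1: "eval2 (deriv_X g) (x, y) =
        eval2 (deriv_X f) (p * x + p' * y, q * x + q' * y) * p + eval2 (deriv_Y f) (p * x + p' * y, q * x + q' * y) * q"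
      by (rule DERIV_unique[rotated])
    have "((\<lambda>y. eval2 f (p * x + p' * y, q * x + q' * y)) has_field_derivative
        eval2 (deriv_X f) (p * x + p' * y, q * x + q' * y) * p' + eval2 (deriv_Y f) (p * x + p' * y, q * x + q' * y) * q') (at y)"
      by (rule r4(2)) (use s in \<open>auto intro!: derivative_eq_intros\<close>)
    moreover have "\<forall>\<^sub>F u in nhds y. eval2 f (p * x + p' * u, q * x + q' * u) = eval2 g (x, u)"
      using bx(2) by eventually_elim (use r1(2) xy r in \<open>simp add: lin_def\<close>)
    ultimately have "((\<lambda>y. eval2 g (x, y)) has_field_derivative
        eval2 (deriv_X f) (p * x + p' * y, q * x + q' * y) * p' + eval2 (deriv_Y f) (p * x + p' * y, q * x + q' * y) * q') (at y)"
      by (subst (asm) DERIV_cong_ev[OF refl _ refl])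
    moreover have "((\<lambda>y. eval2 g (x, y)) has_field_derivative eval2 (deriv_Y g) (x, y)) (at y)"
      using r3(2) xy r by simp
    ultimately have 2: "eval2 (deriv_Y g) (x, y) =
        eval2 (deriv_X f) (p * x + p' * y, q * x + q' * y) * p' + eval2 (deriv_Y f) (p * x + p' * y, q * x + q' * y) * q'"
      by (rule DERIV_unique[rotated])
    show "grad2 g (x, y) = lin p q p' q' (grad2 f (lin p p' q q' (x, y)))"
      using 1 2 by (simp add: grad2_def lin_def mult.commute)
  qed
qed

text \<open>\<open>K\<close> bounds both the linear map and its transpose; the former costs
  \<open>K powr \<theta>\<close> in the norm of the point, the latter K in the gradient. This is one
  implication, and the inverse map supplies the other.\<close>

lemma lojasiewicz_exponent_lin:
  assumes fg: "\<forall>\<^sub>F z in nhds 0. eval2 g z = eval2 f (lin p p' q q' z)"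
    and inv: "\<And>z. lin p p' q q' (lin a b c d z) = z"
    and AB: "\<forall>\<^sub>F z in nhds 0. lin p p' q q' z \<in> B \<longrightarrow> z \<in> A"
    and \<theta>: "lojasiewicz_exponent g A \<theta>"
  shows "lojasiewicz_exponent f B \<theta>"
proof -
  obtain k where k: "k > 0" "\<forall>\<^sub>F z in nhds 0. z \<in> A \<longrightarrow> norm (grad2 g z) \<ge> k * norm z powr \<theta>" and \<theta>0: "\<theta> \<ge> 0"
    using \<theta> unfolding lojasiewicz_exponent_def by auto
  define K where "K = norm p + norm p' + norm q + norm q' + 1"
  have K: "K > 0" by (simp add: K_def add_nonneg_pos)
  have le: "norm (lin p p' q q' z) \<le> K * norm z" "norm (lin p q p' q' z) \<le> K * norm z" for z
    by (rule order_trans[OF norm_lin_le mult_right_mono]; simp add: K_def)+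
  have "\<forall>\<^sub>F w in nhds 0. w \<in> B \<longrightarrow> norm (grad2 f w) \<ge> (k / (K * K powr \<theta>)) * norm w powr \<theta>"
    using eventually_lin[OF k(2), of a b c d] eventually_lin[OF AB, of a b c d] eventually_lin[OF grad2_lin[OF fg], of a b c d]
  proof eventually_elim
    case (elim w)
    show ?case
    proof
      assume "w \<in> B"
      define z where "z = lin a b c d w"
      have w: "lin p p' q q' z = w" unfolding z_def by (rule inv)
      have zA: "z \<in> A" using elim(2) \<open>w \<in> B\<close> w by (simp add: z_def)
      have "norm w powr \<theta> \<le> (K * norm z) powr \<theta>" using le(1)[of z] \<theta>0 unfolding w by (intro powr_mono2) auto
      also have "\<dots> = K powr \<theta> * norm z powr \<theta>" using K by (simp add: powr_mult)
      finally have "(k / (K * K powr \<theta>)) * norm w powr \<theta> \<le> (k / (K * K powr \<theta>)) * (K powr \<theta> * norm z powr \<theta>)"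
        using k(1) K by (intro mult_left_mono) auto
      also have "\<dots> = (k * norm z powr \<theta>) / K" using K by simp
      also have "\<dots> \<le> norm (grad2 g z) / K" using elim(1) zA K by (intro divide_right_mono) (auto simp: z_def)
      also have "norm (grad2 g z) \<le> K * norm (grad2 f w)" using elim(3) le(2) w by (simp add: z_def)
      then have "norm (grad2 g z) / K \<le> norm (grad2 f w)" using K by (simp add: field_simps)
      finally show "(k / (K * K powr \<theta>)) * norm w powr \<theta> \<le> norm (grad2 f w)" .
    qed
  qed
  moreover have "k / (K * K powr \<theta>) > 0" using k(1) K by simp
  ultimately show ?thesis using \<theta>0 unfolding lojasiewicz_exponent_def by blast
qed

lemma eval2_lin_inverse:
  assumes "\<forall>\<^sub>F z in nhds 0. eval2 g z = eval2 f (lin p p' q q' z)"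
    and "\<And>z. lin p p' q q' (lin a b c d z) = z"
  shows "\<forall>\<^sub>F z in nhds 0. eval2 f z = eval2 g (lin a b c d z)"
  using eventually_lin[OF assms(1), of a b c d] by eventually_elim (simp add: assms(2))

lemma lojasiewicz_on_lin:
  assumes fg: "\<forall>\<^sub>F z in nhds 0. eval2 g z = eval2 f (lin p p' q q' z)"
    and TS: "\<And>z. lin p p' q q' (lin a b c d z) = z" and ST: "\<And>z. lin a b c d (lin p p' q q' z) = z"
    and AB: "\<forall>\<^sub>F z in nhds 0. z \<in> A \<longleftrightarrow> lin p p' q q' z \<in> B"
  shows "lojasiewicz_on g A = lojasiewicz_on f B"
proof -
  have 1: "\<forall>\<^sub>F z in nhds 0. lin p p' q q' z \<in> B \<longrightarrow> z \<in> A" using AB by eventually_elim simp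
  have 2: "\<forall>\<^sub>F z in nhds 0. lin a b c d z \<in> A \<longrightarrow> z \<in> B"
    using eventually_lin[OF AB, of a b c d] by eventually_elim (simp add: TS)
  have "lojasiewicz_exponent g A \<theta> \<longleftrightarrow> lojasiewicz_exponent f B \<theta>" for \<theta>
    using lojasiewicz_exponent_lin[OF fg TS 1] lojasiewicz_exponent_lin[OF eval2_lin_inverse[OF fg TS] ST 2] by blast
  then have "lojasiewicz_exponent g A = lojasiewicz_exponent f B" by (rule ext)
  then show ?thesis by (simp only: lojasiewicz_on_eq)
qed

text \<open>A square factor P^2 of g is carried to a square factor P'^2 of f. Irreducibility is not
  transported: P' is a nonzero non-unit, so one of its irreducible factors contradicts reducedness
  of f.\<close>

lemma reduced2_lin:
  assumes fg: "\<forall>\<^sub>F z in nhds 0. eval2 g z = eval2 f (lin p p' q q' z)"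
    and TS: "\<And>z. lin p p' q q' (lin a b c d z) = z" and ST: "\<And>z. lin a b c d (lin p p' q q' z) = z"
    and red: "reduced2 f"
  shows "reduced2 g"
  unfolding reduced2_def
proof (intro allI impI notI)
  fix P assume P: "irreducible P" "P ^ 2 dvd g"
  obtain B where B: "g = P ^ 2 * B" using P(2) by (rule dvdE)
  obtain P' where P': "\<forall>\<^sub>F z in nhds 0. eval2 P' z = eval2 P (lin a b c d z)"
    using linear_substitution_exists[of P a b c d] by blast
  obtain B' where B': "\<forall>\<^sub>F z in nhds 0. eval2 B' z = eval2 B (lin a b c d z)"
    using linear_substitution_exists[of B a b c d] by blast
  have "\<forall>\<^sub>F z in nhds 0. eval2 f z = eval2 (P' ^ 2 * B') z"
    using eval2_lin_inverse[OF fg TS] P' B' eventually_lin[OF eval2_mult[of "P ^ 2" B], of a b c d]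
      eventually_lin[OF eval2_mult[of P P], of a b c d] eval2_mult[of "P' ^ 2" B'] eval2_mult[of P' P']
    by eventually_elim (simp add: B power2_eq_square)
  then have f: "f = P' ^ 2 * B'" by (rule eval2_eq_imp)
  have "P' \<noteq> 0"
  proof
    assume "P' = 0"
    with eval2_lin_inverse[OF P' ST] have "\<forall>\<^sub>F z in nhds 0. eval2 P z = 0" by simp
    then have "P = 0" by (rule eval2_eq_0_imp)
    with P(1) show False by simp
  qed
  moreover have "coeff2 P' 0 0 = 0"
  proof -
    have "eval2 P' 0 = eval2 P (lin a b c d 0)" using P' by (rule eventually_nhds_x_imp_x)
    moreover have "lin a b c d 0 = 0" by (simp add: lin_def zero_prod_def)
    moreover have "coeff2 P 0 0 = 0" using irreducible_not_unit[OF P(1)] by (simp add: cps2_dvd_1_iff)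
    ultimately show ?thesis by simp
  qed
  ultimately obtain r where r: "irreducible r" "r dvd P'" using cps2_irreducible_factor by blast
  have "r ^ 2 dvd f" unfolding f using r(2) by (intro dvd_mult2 dvd_power_same)
  with r(1) red show False by (auto simp: reduced2_def)
qed

lemma eval2_jacobian2:
  "\<forall>\<^sub>F z in nhds 0. eval2 (jacobian2 g f) z = fst (grad2 g z) * snd (grad2 f z) - snd (grad2 g z) * fst (grad2 f z)"
  using eval2_diff[of "deriv_X g * deriv_Y f" "deriv_Y g * deriv_X f"]
    eval2_mult[of "deriv_X g" "deriv_Y f"] eval2_mult[of "deriv_Y g" "deriv_X f"]
  unfolding jacobian2_def by eventually_elim (simp add: grad2_def)

text \<open>The Jacobian picks up the determinant, so an invertible change of coordinates carries
  polar curves to polar curves.\<close>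

lemma jacobian2_lin:
  assumes "\<forall>\<^sub>F z in nhds 0. eval2 g z = eval2 f (lin p p' q q' z)"
    and "\<forall>\<^sub>F z in nhds 0. eval2 l z = eval2 k (lin p p' q q' z)"
  shows "\<forall>\<^sub>F z in nhds 0. eval2 (jacobian2 l g) z = (p * q' - p' * q) * eval2 (jacobian2 k f) (lin p p' q q' z)"
  using eval2_jacobian2[of l g] eventually_lin[OF eval2_jacobian2[of k f], of p p' q q']
    grad2_lin[OF assms(1)] grad2_lin[OF assms(2)]
proof eventually_elim
  case (elim z)
  show ?case unfolding elim(1,2) unfolding elim(3,4) by (simp add: lin_def algebra_simps)
qed

lemma lin_inverse:
  assumes "p * q' - p' * q = \<Delta>" "\<Delta> \<noteq> 0"
  shows "lin p p' q q' (lin (q' / \<Delta>) (- p' / \<Delta>) (- q / \<Delta>) (p / \<Delta>) z) = z"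
    "lin (q' / \<Delta>) (- p' / \<Delta>) (- q / \<Delta>) (p / \<Delta>) (lin p p' q q' z) = z"
proof -
  have id: "(p * q' - p' * q) * x / \<Delta> = x" for x using assms by simp
  have "p * (q' / \<Delta> * x + - p' / \<Delta> * y) + p' * (- q / \<Delta> * x + p / \<Delta> * y) = (p * q' - p' * q) * x / \<Delta>"
    "q * (q' / \<Delta> * x + - p' / \<Delta> * y) + q' * (- q / \<Delta> * x + p / \<Delta> * y) = (p * q' - p' * q) * y / \<Delta>"
    "q' / \<Delta> * (p * x + p' * y) + - p' / \<Delta> * (q * x + q' * y) = (p * q' - p' * q) * x / \<Delta>"
    "- q / \<Delta> * (p * x + p' * y) + p / \<Delta> * (q * x + q' * y) = (p * q' - p' * q) * y / \<Delta>" for x y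
    using assms(2) by (simp_all add: field_simps)
  then show "lin p p' q q' (lin (q' / \<Delta>) (- p' / \<Delta>) (- q / \<Delta>) (p / \<Delta>) z) = z"
    "lin (q' / \<Delta>) (- p' / \<Delta>) (- q / \<Delta>) (p / \<Delta>) (lin p p' q q' z) = z"
    unfolding id by (simp_all only: lin_def fst_conv snd_conv prod.collapse)
qed

section \<open>The initial form in coordinates adapted to the tangent\<close>

lemma coeff_linear_product_top:
  "coeff ([:p, p':] ^ i * [:q, q':] ^ j) (i + j) = p' ^ i * q' ^ j" for p :: complex
proof -
  \<comment> \<open>Evaluation at (0, 1) leaves only the coefficient of top degree.\<close>
  have "homogenize (i + j) P 0 1 = (\<Sum>a\<le>i+j. if a = 0 then coeff P (i + j) else 0)" for P
    unfolding homogenize_def by (intro sum.cong) auto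
  then show ?thesis using homogenize_linear_product[of i j p p' q q' 0 1] by simp
qed

text \<open>Over the complex numbers a polynomial without nonzero roots is a monomial. It is applied
  to the dehomogenised initial form.\<close>

lemma coeff_eq_0_if_only_root_0:
  fixes H :: "complex poly"
  assumes root: "\<And>s. poly H s = 0 \<Longrightarrow> s = 0" and b: "b < degree H"
  shows "coeff H b = 0"
proof -
  have H0: "H \<noteq> 0" using b by auto
  obtain R where R: "H = [:- 0, 1:] ^ order 0 H * R" "\<not> [:- 0, 1:] dvd R" using order_decomp[OF H0] by blast
  have "degree R = 0"
  proof (rule ccontr)
    assume "degree R \<noteq> 0"
    then have "\<not> constant (poly R)" by (simp add: constant_degree)
    then obtain s where s: "poly R s = 0" using fundamental_theorem_of_algebra by blast
    then have "poly H s = 0" by (subst R(1)) simp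
    then have "s = 0" by (rule root)
    with s R(2) show False by (simp add: poly_eq_0_iff_dvd)
  qed
  then obtain r where r: "R = [:r:]" by (rule degree_eq_zeroE)
  have "[:- 0, 1:] ^ k * [:r:] = monom r k" for k by (simp add: monom_altdef mult.commute)
  then have "H = monom r (order 0 H)" using R(1) r by metis
  then show ?thesis using b H0 by (metis coeff_monom degree_monom_eq monom_eq_0_iff less_irrefl)
qed

lemma ord2_eq_enat:
  assumes "ord2 f = enat n" "i + j < n"
  shows "coeff2 f i j = 0"
proof (rule ccontr)
  assume "coeff2 f i j \<noteq> 0"
  then have "ord2 f \<le> enat (i + j)" unfolding ord2_def by (intro Inf_lower) auto
  with assms show False by simp
qed

theorem corollary1p8:
  fixes f :: cps2
  assumes "reduced2 f" and "singular2 f" and "unitangent f"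
  shows "special_direction f (tangent_direction f)"
proof -
  obtain n where n: "ord2 f = enat n" "2 \<le> n"
    using assms(2) unfolding singular2_def by (cases "ord2 f") (auto simp: numeral_eq_enat)
  have tn: "the_enat (ord2 f) = n" using n by simp
  define w where "w = tangent_direction f"
  have w: "initial_form_vanishes_at f w" and uniq: "\<And>w'. initial_form_vanishes_at f w' \<Longrightarrow> w' = w"
    using theI'[OF ex1_tangent_direction[OF assms(3)]] ex1_tangent_direction[OF assms(3)]
    unfolding w_def tangent_direction_def by auto
  obtain p q where pq: "w = abs_proj_line (p, q)" "proportional (p, q) (p, q)"
    by (metis Quotient_proj_line Quotient_abs_rep Quotient_rep_reflp surj_pair)
  then have nz: "(p, q) \<noteq> (0, 0)" by (simp add: proportional_def)
  have vanish: "poly2 (initial_form f) p q = 0"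
    using w pq by (simp add: initial_form_vanishes_at.abs_eq)
  have only: "p * v = q * u" if "(u, v) \<noteq> (0, 0)" "poly2 (initial_form f) u v = 0" for u v
  proof -
    have pr: "proportional (u, v) (u, v)"
      using that(1) by (auto simp: proportional_def intro: exI[of _ 1])
    then have "initial_form_vanishes_at f (abs_proj_line (u, v))"
      using that(2) by (simp add: initial_form_vanishes_at.abs_eq)
    then have "abs_proj_line (u, v) = abs_proj_line (p, q)" using uniq pq(1) by simp
    then have "proportional (u, v) (p, q)"
      using Quotient_rel[OF Quotient_proj_line, of "(u, v)" "(p, q)"] pr pq(2) by simp
    then show ?thesis by (auto simp: proportional_def)
  qed
  \<comment> \<open>Completes (p, q) to a basis, so that \<open>?T\<close> sends the X-axis to the
    tangent line.\<close>
  obtain p' q' where det: "p * q' - p' * q \<noteq> 0"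
  proof (cases "p = 0")
    case True
    with nz that[of 0 1] show thesis by simp
  next
    case False
    with that[of 1 0] show thesis by simp
  qed
  define \<Delta> where "\<Delta> = p * q' - p' * q"
  have \<Delta>: "\<Delta> \<noteq> 0" using det by (simp add: \<Delta>_def)
  let ?T = "lin p p' q q'"
  let ?S = "lin (q' / \<Delta>) (- p' / \<Delta>) (- q / \<Delta>) (p / \<Delta>)"
  have TS: "?T (?S z) = z" and ST: "?S (?T z) = z" for z
    using lin_inverse[OF \<Delta>_def[symmetric] \<Delta>] by auto
  obtain F where F: "\<And>a b. coeff2 F a b = (\<Sum>i\<le>a+b. coeff2 f i (a + b - i) * coeff ([:p, p':] ^ i * [:q, q':] ^ (a + b - i)) b)"
    and FT: "\<forall>\<^sub>F z in nhds 0. eval2 F z = eval2 f (?T z)"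
    using linear_substitution_exists[of f p p' q q'] by blast
  \<comment> \<open>The part of degree n of F at X = 1, Y = s, that is, the initial form of f at (p,
    q) + s (p', q').\<close>
  define H where "H = (\<Sum>i\<le>n. smult (coeff2 f i (n - i)) ([:p, p':] ^ i * [:q, q':] ^ (n - i)))"
  have FH: "coeff2 F a b = coeff H b" if "a + b = n" for a b
    unfolding F H_def coeff_sum that by simp
  have "coeff ([:p, p':] ^ i * [:q, q':] ^ (n - i)) n = p' ^ i * q' ^ (n - i)" if "i \<le> n" for i
    using coeff_linear_product_top[of p p' i q q' "n - i"] that by simp
  then have Hn: "coeff H n = poly2 (initial_form f) p' q'"
    unfolding H_def coeff_sum poly2_initial_form tn by (intro sum.cong refl) (simp add: mult.assoc)
  \<comment> \<open>The leading coefficient is the value of the initial form at (p', q'), which is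
    not proportional to the tangent (p, q).\<close>
  have Hn0: "coeff H n \<noteq> 0"
  proof
    assume "coeff H n = 0"
    moreover have "(p', q') \<noteq> (0, 0)" using det by auto
    ultimately show False using only[of p' q'] Hn det by (simp add: mult.commute)
  qed
  have "degree H \<le> n" unfolding H_def
  proof (intro degree_sum_le finite_atMost)
    fix i assume "i \<in> {..n}"
    then have "i + (n - i) = n" by simp
    then show "degree (smult (coeff2 f i (n - i)) ([:p, p':] ^ i * [:q, q':] ^ (n - i))) \<le> n"
      using degree_smult_le degree_linear_product[of p p' i q q' "n - i"] by (metis order_trans)
  qed
  then have dH: "degree H = n" using Hn0 le_degree by (metis antisym)
  \<comment> \<open>A root s gives a zero of the initial form of f; by unitangency it is
    proportional to (p, q), which forces s = 0.\<close>
  have rootH: "s = 0" if "poly H s = 0" for s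
  proof -
    have "poly H s = poly2 (initial_form f) (p + p' * s) (q + q' * s)"
      unfolding H_def poly2_initial_form tn poly_sum by (simp add: mult.assoc mult.commute[of s])
    moreover have "(p + p' * s, q + q' * s) \<noteq> (0, 0)"
    proof
      assume "(p + p' * s, q + q' * s) = (0, 0)"
      then have "p = - p' * s" "q = - q' * s" by (auto simp: add_eq_0_iff2)
      then have "p * q' - p' * q = 0" by simp
      with det show False by simp
    qed
    ultimately have "p * (q + q' * s) = q * (p + p' * s)" using only that by simp
    then have "s * (p * q' - p' * q) = 0" by (simp add: algebra_simps)
    then show ?thesis using det by simp
  qed
  interpret unitangent_normal F n
  proof unfold_locales
    show "reduced2 F" by (rule reduced2_lin[OF FT TS ST assms(1)])
    show "2 \<le> n" by (rule n)
    show "coeff2 F i j = 0" if "i + j < n" for i j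
      unfolding F by (rule sum.neutral) (use that ord2_eq_enat[OF n(1)] in auto)
    show "coeff2 F i j = 0" if "i + j = n" "i > 0" for i j
      unfolding FH[OF that(1)] by (rule coeff_eq_0_if_only_root_0[OF rootH]) (use that dH in auto)
    show "coeff2 F 0 n \<noteq> 0" using FH[of 0 n] Hn0 by simp
  qed
  \<comment> \<open>\<open>param\<close> carried back by the inverse map. Its initial form is (p Y -
    q X) / \<Delta>, which vanishes at (p, q).\<close>
  obtain l where l: "\<And>a b. coeff2 l a b = (\<Sum>i\<le>a+b. coeff2 param i (a + b - i) *
        coeff ([:q' / \<Delta>, - p' / \<Delta>:] ^ i * [:- q / \<Delta>, p / \<Delta>:] ^ (a + b - i)) b)"
    and lS: "\<forall>\<^sub>F z in nhds 0. eval2 l z = eval2 param (?S z)"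
    using linear_substitution_exists[of param "q' / \<Delta>" "- p' / \<Delta>" "- q / \<Delta>" "p / \<Delta>"] by blast
  have l00: "coeff2 l 0 0 = 0" by (simp add: l coeff2_param)
  have l10: "coeff2 l 1 0 = - q / \<Delta>" by (simp add: l coeff2_param)
  have l01: "coeff2 l 0 1 = p / \<Delta>" by (simp add: l coeff2_param)
  have ordl: "ord2 l = 1"
  proof (rule antisym)
    have "coeff2 l 1 0 \<noteq> 0 \<or> coeff2 l 0 1 \<noteq> 0" using nz \<Delta> l10 l01 by auto
    then have "\<exists>i j. enat (i + j) = 1 \<and> coeff2 l i j \<noteq> 0"
      by (metis add_0 add_0_right one_enat_def)
    then show "ord2 l \<le> 1" unfolding ord2_def by (intro Inf_lower) force
    show "1 \<le> ord2 l" unfolding ord2_def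
    proof (rule Inf_greatest)
      fix e assume "e \<in> {enat (i + j) |i j. coeff2 l i j \<noteq> 0}"
      then obtain i j where "e = enat (i + j)" "coeff2 l i j \<noteq> 0" by blast
      with l00 show "1 \<le> e" by (cases i; cases j) (auto simp: one_enat_def)
    qed
  qed
  have lT: "\<forall>\<^sub>F z in nhds 0. eval2 param z = eval2 l (?T z)" by (rule eval2_lin_inverse[OF lS ST])
  have polar: "\<forall>\<^sub>F z in nhds 0. z \<in> polar_curve F param \<longleftrightarrow> ?T z \<in> polar_curve f l"
    using jacobian2_lin[OF FT lT] by eventually_elim (use det in \<open>simp add: polar_curve_def\<close>)
  have "lojasiewicz_on F (polar_curve F param) = lojasiewicz_on f (polar_curve f l)"
    by (rule lojasiewicz_on_lin[OF FT TS ST polar])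
  moreover have "lojasiewicz F = lojasiewicz f"
    unfolding lojasiewicz_def by (rule lojasiewicz_on_lin[OF FT TS ST]) simp
  ultimately have "lojasiewicz_on f (polar_curve f l) < lojasiewicz f" using polar_exponent_less by simp
  then have "special_parameter f l" using ordl by (simp add: special_parameter_def regular_parameter_def)
  moreover have "initial_form_vanishes_at l w"
  proof -
    have "the_enat (ord2 l) = 1" using ordl by (simp add: one_enat_def)
    then have "poly2 (initial_form l) p q = 0"
      using l10 l01 by (simp add: poly2_initial_form)
    then show ?thesis using pq by (simp add: initial_form_vanishes_at.abs_eq)
  qed
  ultimately show ?thesis unfolding special_direction_def w_def by blast
qed

end
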